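(* Let $0<K<N$ be an integer, $\alpha=(\alpha_1,\dots,\alpha_K)$ with $\alpha_i\in(0,1]$, $\beta=(\beta_{K+1},\dots,\beta_N)$ with $\beta_k>0$, $\gamma\in(0,1)$, and all $\beta_k\gamma$ non-integer. Let $\widetilde m\in C(\mathbb R^N\setminus\{0\})$ be bounded and let $n_j$, $j\in\mathbb Z$, be the functions associated with $\widetilde m$ as in the context. Suppose that $$\widetilde m(0,\xi^{(2)})=0\quad\text{for all }\xi^{(2)}\in\mathbb R^{N-K}\setminus\{0\},$$ and that for some $\mu>0$ $$\int_{\mathbb R^N}\Bigl(1+\sum_{k=1}^K|x_k|^{\alpha_k\gamma}\Bigr)|n_j(x)|\,dx\le\mu\qquad\text{for all }j\in\mathbb Z.$$ Let $u\in C^{\alpha\gamma}_{x^{(1)}}(\mathbb R^N)$ have compact support, so that in particular $\langle u\rangle^{(\alpha\gamma)}_{x^{(1)},\mathbb R^N}<\infty$, and let $v=F^{-1}(\widetilde m\,\widetilde u)$. Then $v$ satisfies the Hölder condition with respect to all variables and $$\langle v\rangle^{(\alpha\gamma,\beta\gamma)}_{x^{(1)},x^{(2)},\mathbb R^N}\le C\mu\,\langle u\rangle^{(\alpha\gamma)}_{x^{(1)},\mathbb R^N},$$ where $C$ depends only on the fixed data $N,K,\alpha,\beta,\gamma$ and the cut-off $\omega$ (not on $u$, $\widetilde m$ or $\mu$).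
   Context: Write $x=(x^{(1)},x^{(2)})\in\mathbb R^N$ with $x^{(1)}=(x_1,\dots,x_K)$, $x^{(2)}=(x_{K+1},\dots,x_N)$, and similarly $\xi=(\xi^{(1)},\xi^{(2)})$. The Fourier transform is $\widetilde u(\xi)=F(u)(\xi)=\int_{\mathbb R^N}e^{-ix\cdot\xi}u(x)\,dx$ (extended to $L_2(\mathbb R^N)$), and $F^{-1}$ is its inverse. Let $\rho(\xi)=\sum_{k=1}^K|\xi_k|^{\alpha_k}+\sum_{k=K+1}^N|\xi_k|^{\beta_k}$. Fix $\omega\in C^\infty([0,\infty))$ with values in $[0,1]$, $\omega\equiv1$ on $[1/2,2]$, $\omega\equiv0$ on $[0,1/4]\cup[4,\infty)$, and put $\chi(\xi)=\omega(\rho(\xi))$. For $j\in\mathbb Z$ let $$A_jx=(2^{j/\alpha_1}x_1,\dots,2^{j/\alpha_K}x_K,2^{j/\beta_{K+1}}x_{K+1},\dots,2^{j/\beta_N}x_N),\qquad a_j=\det A_j.$$ For a bounded $\widetilde m\in C(\mathbb R^N\setminus\{0\})$ put $\widetilde m_j(\xi)=\widetilde m(\xi)\chi(A_j^{-1}\xi)$, $m_j=F^{-1}(\widetilde m_j)$, $n_j(x)=a_j^{-1}m_j(A_j^{-1}x)$. For a positive non-integer $l$, $$\langle u\rangle^{(l)}_{x_i,\mathbb R^N}=\sup_{x\in\mathbb R^N,\,h>0}\frac{|D^{[l]}_{x_i}u(x_1,\dots,x_i+h,\dots,x_N)-D^{[l]}_{x_i}u(x)|}{h^{l-[l]}},$$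 where $[l]$ is the integer part of $l$. Put $\langle u\rangle^{(\alpha\gamma)}_{x^{(1)},\mathbb R^N}=\sum_{k=1}^K\langle u\rangle^{(\alpha_k\gamma)}_{x_k,\mathbb R^N}$ and $$\langle v\rangle^{(\alpha\gamma,\beta\gamma)}_{x^{(1)},x^{(2)},\mathbb R^N}=\sum_{k=1}^K\langle v\rangle^{(\alpha_k\gamma)}_{x_k,\mathbb R^N}+\sum_{k=K+1}^N\langle v\rangle^{(\beta_k\gamma)}_{x_k,\mathbb R^N}.$$ The space $C^{\alpha\gamma}_{x^{(1)}}(\mathbb R^N)$ consists of the bounded continuous functions $u$ on $\mathbb R^N$ with $\langle u\rangle^{(\alpha\gamma)}_{x^{(1)},\mathbb R^N}<\infty$. *)

theory Defs
  imports "HOL-Analysis.Analysis"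
begin

(* A point of R^N is a pair (x1, x2) of type (real^'k) \<times> (real^'l), with CARD('k) = K and
   CARD('l) = N - K; both cardinals are positive, so 0 < K < N holds automatically.
   The exponents \<alpha> are indexed by 'k and the exponents \<beta> by 'l. *)


definition fourier :: "('a::euclidean_space \<Rightarrow> complex) \<Rightarrow> 'a \<Rightarrow> complex" where
  "fourier u \<xi> = (LINT x|lborel. exp (- \<i> * of_real (x \<bullet> \<xi>)) * u x)"

definition square_integrable :: "('a::euclidean_space \<Rightarrow> complex) \<Rightarrow> bool" where
  "square_integrable f \<longleftrightarrow> f \<in> borel_measurable lborel \<and> integrable lborel (\<lambda>x. (cmod (f x))\<^sup>2)"

definition L2_tendsto ::
    "(nat \<Rightarrow> 'a::euclidean_space \<Rightarrow> complex) \<Rightarrow> ('a \<Rightarrow> complex) \<Rightarrow> bool" where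
  "L2_tendsto \<phi> f \<longleftrightarrow> (\<lambda>n. \<integral>\<^sup>+x. ennreal ((cmod (\<phi> n x - f x))\<^sup>2) \<partial>lborel) \<longlonglongrightarrow> 0"

(* The extension of the Fourier integral from L_1 \<inter> L_2 to L_2 by continuity. Both arguments
   represent classes modulo null sets. *)
definition has_L2_fourier ::
    "('a::euclidean_space \<Rightarrow> complex) \<Rightarrow> ('a \<Rightarrow> complex) \<Rightarrow> bool" where
  "has_L2_fourier f g \<longleftrightarrow> square_integrable f \<and> square_integrable g \<and>
     (\<exists>\<phi>. (\<forall>n. integrable lborel (\<phi> n) \<and> square_integrable (\<phi> n)) \<and>
          L2_tendsto \<phi> f \<and> L2_tendsto (\<lambda>n. fourier (\<phi> n)) g)"

(* Some representative of the inverse transform, which is unique only up to null sets. *)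
definition inv_fourier :: "('a::euclidean_space \<Rightarrow> complex) \<Rightarrow> 'a \<Rightarrow> complex" where
  "inv_fourier g = (SOME f. has_L2_fourier f g)"


definition aniso_rho ::
    "('k::finite \<Rightarrow> real) \<Rightarrow> ('l::finite \<Rightarrow> real) \<Rightarrow> (real^'k) \<times> (real^'l) \<Rightarrow> real" where
  "aniso_rho \<alpha> \<beta> \<xi> =
     (\<Sum>k\<in>UNIV. \<bar>fst \<xi> $ k\<bar> powr \<alpha> k) + (\<Sum>k\<in>UNIV. \<bar>snd \<xi> $ k\<bar> powr \<beta> k)"

definition smooth_halfline :: "(real \<Rightarrow> real) \<Rightarrow> bool" where
  "smooth_halfline \<omega> \<longleftrightarrow> (\<exists>D :: nat \<Rightarrow> real \<Rightarrow> real. (\<forall>t\<ge>0. D 0 t = \<omega> t) \<and>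
     (\<forall>n. \<forall>t\<ge>0. (D n has_real_derivative D (Suc n) t) (at t within {0..})))"

definition cutoff :: "(real \<Rightarrow> real) \<Rightarrow> bool" where
  "cutoff \<omega> \<longleftrightarrow> smooth_halfline \<omega> \<and> \<omega> ` {0..} \<subseteq> {0..1} \<and>
     (\<forall>t\<in>{1/2..2}. \<omega> t = 1) \<and> (\<forall>t\<in>{0..1/4} \<union> {4..}. \<omega> t = 0)"

definition dil :: "('k::finite \<Rightarrow> real) \<Rightarrow> ('l::finite \<Rightarrow> real) \<Rightarrow> int \<Rightarrow>
    (real^'k) \<times> (real^'l) \<Rightarrow> (real^'k) \<times> (real^'l)" where
  "dil \<alpha> \<beta> j x = ((\<chi> k. 2 powr (of_int j / \<alpha> k) * fst x $ k),
                  (\<chi> k. 2 powr (of_int j / \<beta> k) * snd x $ k))"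

(* The determinant of the diagonal map dil \<alpha> \<beta> j. *)
definition dil_det :: "('k::finite \<Rightarrow> real) \<Rightarrow> ('l::finite \<Rightarrow> real) \<Rightarrow> int \<Rightarrow> real" where
  "dil_det \<alpha> \<beta> j =
     (\<Prod>k\<in>UNIV. 2 powr (of_int j / \<alpha> k)) * (\<Prod>k\<in>UNIV. 2 powr (of_int j / \<beta> k))"

definition mult_piece :: "('k::finite \<Rightarrow> real) \<Rightarrow> ('l::finite \<Rightarrow> real) \<Rightarrow> (real \<Rightarrow> real) \<Rightarrow>
    ((real^'k) \<times> (real^'l) \<Rightarrow> complex) \<Rightarrow> int \<Rightarrow> (real^'k) \<times> (real^'l) \<Rightarrow> complex" where
  "mult_piece \<alpha> \<beta> \<omega> m j \<xi> = m \<xi> * of_real (\<omega> (aniso_rho \<alpha> \<beta> (inv (dil \<alpha> \<beta> j) \<xi>)))"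

definition norm_kernel :: "('k::finite \<Rightarrow> real) \<Rightarrow> ('l::finite \<Rightarrow> real) \<Rightarrow> (real \<Rightarrow> real) \<Rightarrow>
    ((real^'k) \<times> (real^'l) \<Rightarrow> complex) \<Rightarrow> int \<Rightarrow> (real^'k) \<times> (real^'l) \<Rightarrow> complex" where
  "norm_kernel \<alpha> \<beta> \<omega> m j x =
     inv_fourier (mult_piece \<alpha> \<beta> \<omega> m j) (inv (dil \<alpha> \<beta> j) x) / of_real (dil_det \<alpha> \<beta> j)"


definition pderiv_dir ::
    "'a::euclidean_space \<Rightarrow> ('a \<Rightarrow> complex) \<Rightarrow> 'a \<Rightarrow> complex" where
  "pderiv_dir e u x = vector_derivative (\<lambda>t. u (x + t *\<^sub>R e)) (at 0)"

(* Value \<infinity> if the derivative of order [l] in the direction e fails to exist somewhere;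
   vector_derivative is unspecified in that case. *)
definition holder_seminorm ::
    "'a::euclidean_space \<Rightarrow> real \<Rightarrow> ('a \<Rightarrow> complex) \<Rightarrow> ennreal" where
  "holder_seminorm e l u =
     (if \<forall>i<nat \<lfloor>l\<rfloor>. \<forall>x. (\<lambda>t. (pderiv_dir e ^^ i) u (x + t *\<^sub>R e)) differentiable (at 0)
      then SUP x. SUP h\<in>{0<..}. ennreal (cmod ((pderiv_dir e ^^ nat \<lfloor>l\<rfloor>) u (x + h *\<^sub>R e)
             - (pderiv_dir e ^^ nat \<lfloor>l\<rfloor>) u x) / h powr (l - of_int \<lfloor>l\<rfloor>))
      else \<infinity>)"

definition holder1 :: "('k::finite \<Rightarrow> real) \<Rightarrow> real \<Rightarrow>
    ((real^'k) \<times> (real^'l::finite) \<Rightarrow> complex) \<Rightarrow> ennreal" where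
  "holder1 \<alpha> \<gamma> u = (\<Sum>k\<in>UNIV. holder_seminorm (axis k 1, 0) (\<alpha> k * \<gamma>) u)"

definition holder12 :: "('k::finite \<Rightarrow> real) \<Rightarrow> ('l::finite \<Rightarrow> real) \<Rightarrow> real \<Rightarrow>
    ((real^'k) \<times> (real^'l) \<Rightarrow> complex) \<Rightarrow> ennreal" where
  "holder12 \<alpha> \<beta> \<gamma> v = (\<Sum>k\<in>UNIV. holder_seminorm (axis k 1, 0) (\<alpha> k * \<gamma>) v)
                   + (\<Sum>k\<in>UNIV. holder_seminorm (0, axis k 1) (\<beta> k * \<gamma>) v)"

definition holder1_space :: "('k::finite \<Rightarrow> real) \<Rightarrow> real \<Rightarrow>
    ((real^'k) \<times> (real^'l::finite) \<Rightarrow> complex) set" where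
  "holder1_space \<alpha> \<gamma> = {u. continuous_on UNIV u \<and> bounded (range u) \<and> holder1 \<alpha> \<gamma> u < \<infinity>}"

end

(* Idea. Choose a smooth resolution of the identity theta_j adapted to the dilations A_j, with
   theta_j supported where chi(A_j^{-1} xi) = 1, and let v_j be the inverse transform of
   m theta_j u^. Since m vanishes for xi^(1) = 0, the kernel m_j has integral zero in x^(1) for almost
   every x^(2), so in (m_j * u)(x) one may subtract u(x^(1), x^(2) - y^(2)) from u(x - y); the
   weighted bound on n_j, rescaled, then gives |m_j * u| <= 2^(-j gamma) mu <u>. No regularity of u
   in x^(2) has been used. As v_j arises from m_j * u by a multiplier with an integrable kernel, a
   derivative of order s in direction i costs a factor 2^(j s / a_i), in all directions alike, and the
   Hoelder estimate of sum v_j follows from summing min(2^(j(s-l)/a_i), h 2^(j(s+1-l)/a_i)). The low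
   frequencies converge because u is integrable.

   As rho is not smooth on the coordinate planes, theta_j is not built from rho directly but as a
   difference of dilates of a convolution p * q of compactly supported continuous functions: its
   inverse transform is a product of two square integrable functions, hence integrable.

   The L_2 theory of the Fourier transform (Plancherel, inversion, uniqueness) is obtained from
   Gaussian regularisation. *)

theory Submission
  imports Defs "HOL-Probability.Probability"
begin

text \<open>The condition on \<open>n_j\<close> bounds m_j * u in the supremum norm and says nothing
  about derivatives of v. Derivatives therefore fall on the second cut-off: xi_b^s theta_j is, up to
  a power of 2, a dilate of one fixed function, and dilation preserves the L1 norm of the kernel
  behind it. The norms \<open>W\<close> are thus fixed before m, u and \<mu> enter, which is where
  the uniformity of the constant comes from.

  The bound 2^(-j \<gamma>) holds for every j and yields the Hoelder estimate, but it grows as j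
  tends to minus infinity and does not make the series for v converge. Convergence there rests on a
  bound that involves the size of m u^, which must not leak into the constant; it is used for
  existence only.

  \<open>inv_fourier\<close> selects some L2 representative, whereas the cancellation condition
  lives on the null set xi^(1) = 0. Integrability of the kernel makes its Fourier integral
  continuous, so that it can be evaluated there.\<close>

lemmas LINT_cong = Bochner_Integration.integral_cong
  and integrable_dominated = Bochner_Integration.integrable_bound
  and norm_LINT_le = Bochner_Integration.integral_norm_bound_integral

text \<open>Common core of the substitutions below: once Lebesgue measure is known to be
  \<open>d\<close> times its image under \<open>T\<close>, the affine and the diagonal case need
  only their Jacobians. The nonnegative version, applied to norms, also decides
  integrability.\<close>

lemma lborel_transfer:
  fixes T :: "'a::euclidean_space \<Rightarrow> 'a" and d :: real
    and f :: "'a \<Rightarrow> 'b::{banach,second_countable_topology}"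
  assumes T[measurable]: "T \<in> borel \<rightarrow>\<^sub>M borel" and d: "d > 0"
    and eq: "lborel = density (distr lborel borel T) (\<lambda>_. ennreal d)"
  shows "g \<in> borel_measurable borel \<Longrightarrow>
      (\<integral>\<^sup>+x. g x \<partial>lborel) = ennreal d * (\<integral>\<^sup>+x. g (T x) \<partial>lborel)"
    and "f \<in> borel_measurable borel \<Longrightarrow> integrable lborel (\<lambda>x. f (T x)) \<longleftrightarrow> integrable lborel f"
    and "f \<in> borel_measurable borel \<Longrightarrow> (\<integral>x. f x \<partial>lborel) = d *\<^sub>R (\<integral>x. f (T x) \<partial>lborel)"
proof -
  show nn: "(\<integral>\<^sup>+x. g x \<partial>lborel) = ennreal d * (\<integral>\<^sup>+x. g (T x) \<partial>lborel)"
    if [measurable]: "g \<in> borel_measurable borel" for g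
    by (subst eq) (simp add: nn_integral_density nn_integral_distr nn_integral_cmult)
  assume f[measurable]: "f \<in> borel_measurable borel"
  show "integrable lborel (\<lambda>x. f (T x)) \<longleftrightarrow> integrable lborel f"
    unfolding integrable_iff_bounded
    using nn[of "\<lambda>x. ennreal (norm (f x))"] d
    by (auto simp: ennreal_mult_less_top)
  show "(\<integral>x. f x \<partial>lborel) = d *\<^sub>R (\<integral>x. f (T x) \<partial>lborel)"
    using d by (subst eq) (simp add: integral_density integral_distr)
qed

lemma
  fixes f :: "'a::euclidean_space \<Rightarrow> 'b::{banach,second_countable_topology}" and t :: 'a and c :: real
  assumes c: "c \<noteq> 0" and f: "f \<in> borel_measurable borel"
  shows integrable_lborel_affine: "integrable lborel (\<lambda>x. f (t + c *\<^sub>R x)) \<longleftrightarrow> integrable lborel f"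
    and integral_lborel_affine: "(\<integral>x. f x \<partial>lborel) = \<bar>c\<bar>^DIM('a) *\<^sub>R (\<integral>x. f (t + c *\<^sub>R x) \<partial>lborel)"
  using lborel_transfer(2,3)[OF _ _ lborel_affine[OF c, of t] f] c by auto

lemma
  fixes f :: "'a::euclidean_space \<Rightarrow> 'b::{banach,second_countable_topology}" and t :: 'a
  assumes f: "f \<in> borel_measurable borel"
  shows integrable_lborel_shift: "integrable lborel (\<lambda>x. f (t + x)) \<longleftrightarrow> integrable lborel f"
    and integrable_lborel_shift': "integrable lborel (\<lambda>x. f (x - t)) \<longleftrightarrow> integrable lborel f"
    and integrable_lborel_minus: "integrable lborel (\<lambda>x. f (- x)) \<longleftrightarrow> integrable lborel f"
    and integral_lborel_shift: "(\<integral>x. f (t + x) \<partial>lborel) = (\<integral>x. f x \<partial>lborel)"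
    and integral_lborel_shift': "(\<integral>x. f (x - t) \<partial>lborel) = (\<integral>x. f x \<partial>lborel)"
    and integral_lborel_minus: "(\<integral>x. f (- x) \<partial>lborel) = (\<integral>x. f x \<partial>lborel)"
  using integrable_lborel_affine[of 1 f t] integrable_lborel_affine[of 1 f "-t"]
    integrable_lborel_affine[of "-1" f 0]
    integral_lborel_affine[of 1 f t] integral_lborel_affine[of 1 f "-t"]
    integral_lborel_affine[of "-1" f 0] f
  by (simp_all add: algebra_simps)

lemma nn_integral_lborel_minus:
  fixes f :: "'a::euclidean_space \<Rightarrow> ennreal"
  assumes "f \<in> borel_measurable borel"
  shows "(\<integral>\<^sup>+x. f (- x) \<partial>lborel) = (\<integral>\<^sup>+x. f x \<partial>lborel)"
  using lborel_transfer(1)[OF _ _ lborel_affine[of "-1" "0::'a"] assms] by simp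

section \<open>The Fourier integral\<close>

lemma norm_exp_minus_i [simp]: "cmod (exp (- (\<i> * complex_of_real t))) = 1"
  by (simp add: norm_exp_eq_Re)

lemma borel_measurable_fourier_kernel [measurable]:
  "(\<lambda>x::'a::euclidean_space. exp (- (\<i> * complex_of_real (x \<bullet> \<xi>)))) \<in> borel_measurable borel"
  by (intro borel_measurable_continuous_onI continuous_intros)

lemma integrable_fourier_kernel:
  assumes "integrable lborel u"
  shows "integrable lborel (\<lambda>x::'a::euclidean_space. exp (- (\<i> * complex_of_real (x \<bullet> \<xi>))) * u x)"
proof -
  note [measurable] = borel_measurable_integrable[OF assms]
  show ?thesis
    using assms by (rule integrable_dominated) (auto simp: norm_mult)
qed

lemma cmod_fourier_le: "cmod (fourier u \<xi>) \<le> (LINT x|lborel. cmod (u x))"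
  unfolding fourier_def
  by (rule order_trans[OF integral_norm_bound]) (simp add: norm_mult)

lemma continuous_fourier:
  assumes "integrable lborel u"
  shows "continuous_on UNIV (fourier u)"
proof -
  have "(\<lambda>n. fourier u (X n)) \<longlonglongrightarrow> fourier u \<xi>" if X: "X \<longlonglongrightarrow> \<xi>" for X \<xi>
    unfolding fourier_def
  proof (rule integral_dominated_convergence[where w = "\<lambda>x. cmod (u x)"])
    show "integrable lborel (\<lambda>x. cmod (u x))" using assms by simp
    show "AE x in lborel. (\<lambda>n. exp (- \<i> * complex_of_real (x \<bullet> X n)) * u x)
        \<longlonglongrightarrow> exp (- \<i> * complex_of_real (x \<bullet> \<xi>)) * u x"
      by (intro AE_I2 tendsto_intros X)
  qed (use assms in \<open>auto simp: norm_mult\<close>)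
  then show ?thesis
    by (simp add: continuous_on_sequentially o_def)
qed

lemma borel_measurable_fourier [measurable]:
  "integrable lborel u \<Longrightarrow> fourier u \<in> borel_measurable borel"
  by (intro borel_measurable_continuous_onI continuous_fourier)

lemma fourier_add:
  "integrable lborel u \<Longrightarrow> integrable lborel v \<Longrightarrow>
    fourier (\<lambda>x. u x + v x) \<xi> = fourier u \<xi> + fourier v \<xi>"
  unfolding fourier_def using integrable_fourier_kernel[of u \<xi>] integrable_fourier_kernel[of v \<xi>]
  by (simp add: distrib_left)

lemma fourier_diff:
  "integrable lborel u \<Longrightarrow> integrable lborel v \<Longrightarrow>
    fourier (\<lambda>x. u x - v x) \<xi> = fourier u \<xi> - fourier v \<xi>"
  unfolding fourier_def using integrable_fourier_kernel[of u \<xi>] integrable_fourier_kernel[of v \<xi>]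
  by (simp add: right_diff_distrib)

lemma fourier_cmult: "fourier (\<lambda>x. c * u x) \<xi> = c * fourier u \<xi>"
proof -
  have "fourier (\<lambda>x. c * u x) \<xi> = (LINT x|lborel. c * (exp (- \<i> * of_real (x \<bullet> \<xi>)) * u x))"
    unfolding fourier_def by (intro LINT_cong) auto
  then show ?thesis by (simp add: fourier_def)
qed

lemma fourier_minus_arg:
  assumes [measurable]: "u \<in> borel_measurable borel"
  shows "fourier (\<lambda>x. u (- x)) \<xi> = fourier u (- \<xi>)"
  unfolding fourier_def
  using integral_lborel_minus[of "\<lambda>x. exp (- \<i> * of_real (x \<bullet> -\<xi>)) * u x"] by simp

lemma fourier_modulate:
  "fourier (\<lambda>\<xi>. exp (\<i> * complex_of_real (x \<bullet> \<xi>)) * u \<xi>) y = fourier u (y - x)"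
  unfolding fourier_def
  by (intro LINT_cong)
     (auto simp: algebra_simps inner_commute simp flip: exp_add mult.assoc)

lemma fourier_cnj: "cnj (fourier u \<xi>) = fourier (\<lambda>x. cnj (u x)) (- \<xi>)"
  unfolding fourier_def Bochner_Integration.integral_cnj[symmetric]
  by (intro LINT_cong) (auto simp: exp_cnj)

lemma integrable_pair_times:
  fixes f :: "'a::euclidean_space \<Rightarrow> complex" and g :: "'b::euclidean_space \<Rightarrow> complex"
  assumes f: "integrable lborel f" and g: "integrable lborel g"
  shows "integrable (lborel \<Otimes>\<^sub>M lborel) (\<lambda>(x,y). f x * g y)"
proof -
  note [measurable] = borel_measurable_integrable[OF f] borel_measurable_integrable[OF g]
  show ?thesis
    using f g by (intro lborel_pair.Fubini_integrable) (auto simp: norm_mult)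
qed

text \<open>Fubini for \<open>exp (- \<i> * of_real (x \<bullet> y)) * (f x * g y)\<close>: the
  exponential is unimodular and symmetric in x and y, so the transform may be placed on either
  factor. Inversion, Plancherel and uniqueness are all derived from this identity.\<close>

lemma fourier_multiplication_formula:
  fixes f g :: "'a::euclidean_space \<Rightarrow> complex"
  assumes f: "integrable lborel f" and g: "integrable lborel g"
  shows "(LINT x|lborel. fourier f x * g x) = (LINT x|lborel. f x * fourier g x)"
proof -
  note [measurable] = borel_measurable_integrable[OF f] borel_measurable_integrable[OF g]
  let ?h = "\<lambda>x y. exp (- \<i> * of_real (x \<bullet> y)) * (f x * g y)"
  have i: "integrable (lborel \<Otimes>\<^sub>M lborel) (case_prod ?h)"
    using integrable_pair_times[OF f g]
    by (rule integrable_dominated) (auto simp: norm_mult)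
  have "(LINT y|lborel. fourier f y * g y) = (LINT y|lborel. LINT x|lborel. ?h x y)"
    unfolding fourier_def by (simp flip: integral_mult_left_zero add: mult.assoc)
  also have "\<dots> = (LINT x|lborel. LINT y|lborel. ?h x y)"
    by (rule lborel_pair.Fubini_integral[OF i])
  also have "\<dots> = (LINT x|lborel. f x * fourier g x)"
    unfolding fourier_def
    by (simp flip: integral_mult_right_zero add: inner_commute mult_ac)
  finally show ?thesis .
qed

section \<open>The Gaussian\<close>

definition gauss :: "'a::euclidean_space \<Rightarrow> real" where
  "gauss x = exp (- (norm x)\<^sup>2 / 2)"

lemma gauss_pos [simp]: "gauss x > 0" and gauss_nonneg [simp]: "gauss x \<ge> 0"
  and abs_gauss [simp]: "\<bar>gauss x\<bar> = gauss x" and gauss_le_1 [simp]: "gauss x \<le> 1" and gauss_0 [simp]: "gauss 0 = 1"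
  by (auto simp: gauss_def)

lemma gauss_minus [simp]: "gauss (- x) = gauss x"
  by (simp add: gauss_def)

lemma continuous_gauss [continuous_intros]:
  "continuous_on S f \<Longrightarrow> continuous_on S (\<lambda>x. gauss (f x))"
  unfolding gauss_def by (intro continuous_intros) auto

lemma borel_measurable_gauss [measurable]: "gauss \<in> borel_measurable borel"
  by (intro borel_measurable_continuous_onI continuous_intros)

lemma tendsto_gauss [tendsto_intros]: "(f \<longlongrightarrow> a) F \<Longrightarrow> ((\<lambda>x. gauss (f x)) \<longlongrightarrow> gauss a) F"
  unfolding gauss_def by (intro tendsto_intros) auto

text \<open>The transform is read off from the characteristic function of the standard normal law,
  evaluated at \<open>- t\<close> because probability theory uses the kernel exp(i t x); the sign
  disappears since the Gaussian is even.\<close>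

lemma gauss_1d:
  "integrable lborel (\<lambda>x. exp (- (\<i> * complex_of_real (x * t))) * complex_of_real (gauss x))"
  "(LINT x|lborel. exp (- (\<i> * complex_of_real (x * t))) * complex_of_real (gauss x))
    = sqrt (2 * pi) * gauss t"
proof -
  have g: "gauss x = sqrt (2 * pi) * std_normal_density x" for x
    by (simp add: gauss_def std_normal_density_def)
  have "integrable lborel (\<lambda>x::real. complex_of_real (gauss x))"
    unfolding g by (intro integrable_of_real integrable_mult_right integrable_normal_density) auto
  then show "integrable lborel (\<lambda>x. exp (- (\<i> * complex_of_real (x * t))) * complex_of_real (gauss x))"
    using integrable_fourier_kernel[of "\<lambda>x::real. complex_of_real (gauss x)" t] by simp
  have "complex_of_real (gauss t) = char std_normal_distribution (- t)"
    by (simp add: char_std_normal_distribution gauss_def)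
  also have "\<dots> = (CLINT x|lborel. std_normal_density x *\<^sub>R exp (- (\<i> * complex_of_real (x * t))))"
    unfolding char_def by (subst integral_density) (auto simp: mult.commute)
  finally show "(LINT x|lborel. exp (- (\<i> * complex_of_real (x * t))) * complex_of_real (gauss x))
    = sqrt (2 * pi) * gauss t"
  proof -
    assume *: "complex_of_real (gauss t) = \<dots>"
    have "(LINT x|lborel. exp (- (\<i> * complex_of_real (x * t))) * complex_of_real (gauss x)) =
      (LINT x|lborel. complex_of_real (sqrt (2 * pi)) *
         (std_normal_density x *\<^sub>R exp (- (\<i> * complex_of_real (x * t)))))"
      unfolding g by (intro LINT_cong) (auto simp: scaleR_conv_of_real mult_ac)
    also have "\<dots> = complex_of_real (sqrt (2 * pi)) *
      (LINT x|lborel. (std_normal_density x *\<^sub>R exp (- (\<i> * complex_of_real (x * t)))))"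
      by (rule integral_mult_right_zero)
    finally show ?thesis using * by simp
  qed
qed

lemma gauss_prod: "gauss x = (\<Prod>b\<in>Basis. gauss (x \<bullet> b))"
proof -
  have "(norm x)\<^sup>2 = (\<Sum>b\<in>Basis. (x \<bullet> b)\<^sup>2)"
    by (subst power2_norm_eq_inner, subst euclidean_inner) (simp add: power2_eq_square)
  then have "- (norm x)\<^sup>2 / 2 = (\<Sum>b\<in>Basis. - (x \<bullet> b)\<^sup>2 / 2)"
    by (simp add: sum_divide_distrib sum_negf)
  then show ?thesis
    by (simp add: gauss_def exp_sum)
qed

text \<open>Kernel and Gaussian both factor over the coordinates, and \<open>lborel\<close> is the
  image of a product of one-dimensional Lebesgue measures, so the integral is a product of
  one-dimensional ones. Frequency 0 gives the integrability.\<close>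

lemma gauss_nd:
  fixes \<xi> :: "'a::euclidean_space"
  shows "integrable lborel (\<lambda>x::'a. complex_of_real (gauss x))"
    and "fourier (\<lambda>x. complex_of_real (gauss x)) \<xi> = of_real (sqrt (2 * pi) ^ DIM('a) * gauss \<xi>)"
proof -
  interpret product_sigma_finite "\<lambda>_::'a. lborel::real measure" ..
  interpret finite_product_sigma_finite "\<lambda>_::'a. lborel::real measure" Basis by standard simp
  have gm [measurable]: "(\<lambda>x::real. complex_of_real (gauss x)) \<in> borel_measurable borel" by measurable
  define q where "q \<xi> b x = exp (- (\<i> * complex_of_real (x * (\<xi> \<bullet> b)))) * complex_of_real (gauss x)"
    for \<xi> b :: 'a and x
  have qi: "integrable lborel (q \<xi> b)" for \<xi> b
    unfolding q_def by (rule gauss_1d)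
  have eq: "exp (- (\<i> * complex_of_real (x \<bullet> \<xi>))) * complex_of_real (gauss x) = (\<Prod>b\<in>Basis. q \<xi> b (x \<bullet> b))"
    for x \<xi> :: 'a
  proof -
    have "x \<bullet> \<xi> = (\<Sum>b\<in>Basis. (x \<bullet> b) * (\<xi> \<bullet> b))"
      by (rule euclidean_inner)
    then show ?thesis
      by (simp add: q_def prod.distrib exp_sum sum_distrib_left gauss_prod[of x] flip: sum_negf)
  qed
  have S [measurable]: "(\<lambda>f. \<Sum>b\<in>Basis. f b *\<^sub>R b) \<in> (\<Pi>\<^sub>M b\<in>(Basis::'a set). (lborel::real measure)) \<rightarrow>\<^sub>M borel"
    by measurable
  have sb: "(\<Sum>b'\<in>Basis. f b' *\<^sub>R b') \<bullet> b = f b" if "b \<in> Basis" for f and b :: 'a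
    using that by (simp add: inner_sum_left inner_Basis if_distrib sum.delta cong: if_cong)
  have [measurable]: "(\<lambda>x::'a. \<Prod>b\<in>Basis. q \<xi> b (x \<bullet> b)) \<in> borel_measurable borel" for \<xi>
    unfolding eq[symmetric] by measurable
  have ii: "integrable lborel (\<lambda>x::'a. \<Prod>b\<in>Basis. q \<xi> b (x \<bullet> b))" for \<xi>
    unfolding lborel_eq[where 'a='a]
    by (subst integrable_distr_eq) (auto simp: sb intro!: product_integrable_prod qi)
  show "integrable lborel (\<lambda>x::'a. complex_of_real (gauss x))"
    using ii[of 0] eq[of _ 0] by simp
  have "fourier (\<lambda>x::'a. complex_of_real (gauss x)) \<xi> = (LINT x|lborel. (\<Prod>b\<in>Basis. q \<xi> b (x \<bullet> b)))"
    by (simp add: fourier_def eq)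
  also have "\<dots> = (\<integral>f. (\<Prod>b\<in>Basis. q \<xi> b (f b)) \<partial>(\<Pi>\<^sub>M b\<in>(Basis::'a set). lborel))"
    unfolding lborel_eq[where 'a='a] by (subst integral_distr) (auto simp: sb)
  also have "\<dots> = (\<Prod>b\<in>Basis. integral\<^sup>L lborel (q \<xi> b))"
    by (rule product_integral_prod) (auto intro: qi)
  also have "\<dots> = (\<Prod>b\<in>Basis. of_real (sqrt (2 * pi) * gauss (\<xi> \<bullet> b)))"
    unfolding q_def gauss_1d(2) by simp
  also have "\<dots> = of_real (sqrt (2 * pi) ^ DIM('a) * gauss \<xi>)"
    by (simp add: prod.distrib gauss_prod[of \<xi>])
  finally show "fourier (\<lambda>x. complex_of_real (gauss x)) \<xi> = of_real (sqrt (2 * pi) ^ DIM('a) * gauss \<xi>)" .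
qed

lemma borel_measurable_cnj [measurable]: "cnj \<in> borel_measurable borel"
  by (intro borel_measurable_continuous_onI continuous_on_cnj continuous_on_id)

lemma exists_null_sequence:
  obtains e :: "nat \<Rightarrow> real" where "\<And>n. e n > 0" "e \<longlonglongrightarrow> 0"
  by (rule that[of "\<lambda>n. inverse (real (Suc n))"]) (use LIMSEQ_inverse_real_of_nat in auto)

section \<open>Convolution\<close>

text \<open>A working class for the classical theory: integrability gives the Fourier integral,
  boundedness and continuity give pointwise limits of Gaussian means, and together they imply square
  integrability. Convolution with an integrable function preserves the class.\<close>

definition bcL1 :: "('a::euclidean_space \<Rightarrow> complex) \<Rightarrow> bool" where
  "bcL1 f \<longleftrightarrow> continuous_on UNIV f \<and> bounded (range f) \<and> integrable lborel f"

definition Cc :: "('a::euclidean_space \<Rightarrow> complex) \<Rightarrow> bool" where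
  "Cc f \<longleftrightarrow> continuous_on UNIV f \<and> bounded {x. f x \<noteq> 0}"

definition conv :: "('a::euclidean_space \<Rightarrow> complex) \<Rightarrow> ('a \<Rightarrow> complex) \<Rightarrow> 'a \<Rightarrow> complex" where
  "conv f g x = (LINT y|lborel. f y * g (x - y))"

lemma bcL1D:
  assumes "bcL1 f"
  shows "continuous_on UNIV f" "bounded (range f)" "integrable lborel f" "f \<in> borel_measurable borel"
  using assms by (auto simp: bcL1_def intro: borel_measurable_continuous_onI)

lemma bounded_range_obtain:
  fixes f :: "'a \<Rightarrow> complex"
  assumes "bounded (range f)"
  obtains B where "B > 0" "\<And>x. cmod (f x) \<le> B"
  using assms unfolding bounded_pos by auto

lemma integrable_bounded_times:
  fixes f g :: "'a::euclidean_space \<Rightarrow> complex"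
  assumes "\<And>x. cmod (f x) \<le> B" "f \<in> borel_measurable borel" "integrable lborel g"
  shows "integrable lborel (\<lambda>x. f x * g x)" "integrable lborel (\<lambda>x. g x * f x)"
proof -
  note [measurable] = borel_measurable_integrable[OF assms(3)] assms(2)
  have "integrable lborel (\<lambda>x. B * cmod (g x))" using assms(3) by simp
  then show "integrable lborel (\<lambda>x. f x * g x)"
    by (rule integrable_dominated)
       (use assms(1) in \<open>auto simp: norm_mult intro!: mult_right_mono order_trans[OF _ abs_ge_self]\<close>)
  then show "integrable lborel (\<lambda>x. g x * f x)"
    by (simp add: mult.commute)
qed

lemma CcD:
  assumes "Cc f"
  shows "continuous_on UNIV f" "bounded {x. f x \<noteq> 0}" "bounded (range f)" "integrable lborel f"
    "f \<in> borel_measurable borel" "bcL1 f"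
proof -
  show c: "continuous_on UNIV f" and b: "bounded {x. f x \<noteq> 0}"
    using assms by (auto simp: Cc_def)
  obtain R where R: "\<And>x. f x \<noteq> 0 \<Longrightarrow> norm x \<le> R"
    using b unfolding bounded_iff by auto
  have cb: "continuous_on (cball 0 R) f"
    using c continuous_on_subset by blast
  have "range f \<subseteq> insert 0 (f ` cball 0 R)"
    using R by force
  then show br: "bounded (range f)"
    using compact_imp_bounded[OF compact_continuous_image[OF cb compact_cball]]
    by (meson bounded_insert bounded_subset)
  have "integrable lborel (\<lambda>x. indicator (cball 0 R) x *\<^sub>R f x)"
    using cb by (rule borel_integrable_compact[OF compact_cball])
  also have "(\<lambda>x. indicator (cball 0 R) x *\<^sub>R f x) = f"
    using R by (auto simp: indicator_def fun_eq_iff)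
  finally show i: "integrable lborel f" .
  show "f \<in> borel_measurable borel"
    by (rule borel_measurable_continuous_onI[OF c])
  show "bcL1 f" using c br i by (simp add: bcL1_def)
qed

lemma bcL1_diff: "bcL1 f \<Longrightarrow> bcL1 g \<Longrightarrow> bcL1 (\<lambda>x. f x - g x)"
  unfolding bcL1_def using bounded_minus_comp[of f UNIV g]
  by (auto intro!: continuous_intros)

lemma conv_bounded:
  assumes f: "integrable lborel f" and B: "\<And>x. cmod (g x) \<le> B" and "g \<in> borel_measurable borel"
  shows "integrable lborel (\<lambda>y. f y * g (x - y))"
    and "cmod (conv f g x) \<le> (LINT y|lborel. cmod (f y)) * B"
proof -
  note [measurable] = borel_measurable_integrable[OF f] assms(3)
  show i: "integrable lborel (\<lambda>y. f y * g (x - y))"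
    using B by (intro integrable_bounded_times(2)[OF _ _ f]) auto
  have "cmod (conv f g x) \<le> (LINT y|lborel. cmod (f y) * B)"
    unfolding conv_def
    by (rule norm_LINT_le[OF i])
       (use f B in \<open>auto simp: norm_mult intro!: mult_left_mono\<close>)
  then show "cmod (conv f g x) \<le> (LINT y|lborel. cmod (f y)) * B" by simp
qed

lemma continuous_conv:
  assumes f: "integrable lborel f" and g: "continuous_on UNIV g" "bounded (range g)"
  shows "continuous_on UNIV (conv f g)"
proof -
  obtain B where B: "\<And>x. cmod (g x) \<le> B"
    using bounded_range_obtain[OF g(2)] by blast
  note [measurable] = borel_measurable_integrable[OF f] borel_measurable_continuous_onI[OF g(1)]
  have gi: "isCont g z" for z
    using g(1) by (simp add: continuous_on_eq_continuous_at)
  have "(\<lambda>n. conv f g (X n)) \<longlonglongrightarrow> conv f g \<xi>" if X: "X \<longlonglongrightarrow> \<xi>" for X \<xi>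
    unfolding conv_def
  proof (rule integral_dominated_convergence[where w = "\<lambda>x. cmod (f x) * B"])
    show "integrable lborel (\<lambda>x. cmod (f x) * B)" using f by simp
    show "AE x in lborel. (\<lambda>n. f x * g (X n - x)) \<longlonglongrightarrow> f x * g (\<xi> - x)"
      by (intro AE_I2 tendsto_intros isCont_tendsto_compose[OF gi] X)
  qed (use B in \<open>auto simp: norm_mult intro!: mult_left_mono\<close>)
  then show ?thesis
    by (simp add: continuous_on_sequentially o_def)
qed

text \<open>Tonelli: for fixed \<open>y\<close> the translate of \<open>g\<close> has the same L1
  norm as \<open>g\<close>, so the iterated integral of the modulus is finite. This gives both the
  integrability of a convolution and the interchange behind its transform.\<close>

lemma integrable_pair_shift:
  fixes f g :: "'a::euclidean_space \<Rightarrow> complex"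
  assumes f: "integrable lborel f" and g: "integrable lborel g"
  shows "integrable (lborel \<Otimes>\<^sub>M lborel) (\<lambda>(y,x). f y * g (x - y))"
proof -
  note [measurable] = borel_measurable_integrable[OF f] borel_measurable_integrable[OF g]
  have *: "integrable lborel (\<lambda>x. g (x - y))" for y
    using g by (subst integrable_lborel_shift') auto
  have **: "(LINT x|lborel. cmod (g (x - y))) = (LINT x|lborel. cmod (g x))" for y
    by (subst integral_lborel_shift'[of "\<lambda>x. cmod (g x)"]) auto
  show ?thesis
    using f * by (intro lborel_pair.Fubini_integrable) (auto simp: norm_mult **)
qed

lemma integrable_conv:
  assumes f: "integrable lborel f" and g: "integrable lborel g"
  shows "integrable lborel (conv f g)"
  using lborel_pair.integrable_snd[OF integrable_pair_shift[OF f g]]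
  by (simp add: conv_def[abs_def])

lemma fourier_conv:
  assumes f: "integrable lborel f" and g: "integrable lborel g"
  shows "fourier (conv f g) \<xi> = fourier f \<xi> * fourier g \<xi>"
proof -
  note [measurable] = borel_measurable_integrable[OF f] borel_measurable_integrable[OF g]
  let ?h = "\<lambda>y x. exp (- \<i> * of_real (x \<bullet> \<xi>)) * (f y * g (x - y))"
  have i: "integrable (lborel \<Otimes>\<^sub>M lborel) (case_prod ?h)"
    using integrable_pair_shift[OF f g]
    by (rule integrable_dominated) (auto simp: norm_mult)
  have *: "(LINT x|lborel. ?h y x) = exp (- \<i> * of_real (y \<bullet> \<xi>)) * f y * fourier g \<xi>" for y
  proof -
    have "(LINT x|lborel. ?h y x) = (LINT x|lborel. ?h y (y + x))"
      by (rule integral_lborel_shift[symmetric]) measurable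
    also have "\<dots> = (LINT x|lborel. (exp (- \<i> * of_real (y \<bullet> \<xi>)) * f y) * (exp (- \<i> * of_real (x \<bullet> \<xi>)) * g x))"
      by (intro LINT_cong) (auto simp: algebra_simps exp_diff exp_minus divide_inverse)
    also have "\<dots> = exp (- \<i> * of_real (y \<bullet> \<xi>)) * f y * fourier g \<xi>"
      unfolding fourier_def by (rule integral_mult_right_zero)
    finally show ?thesis .
  qed
  have "fourier (conv f g) \<xi> = (LINT x|lborel. LINT y|lborel. ?h y x)"
    unfolding fourier_def conv_def by (simp flip: integral_mult_right_zero)
  also have "\<dots> = (LINT y|lborel. LINT x|lborel. ?h y x)"
    by (rule lborel_pair.Fubini_integral[OF i])
  also have "\<dots> = fourier f \<xi> * fourier g \<xi>"
    unfolding * fourier_def[of f] by simp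
  finally show ?thesis .
qed

lemma bcL1_conv:
  assumes f: "integrable lborel f" and g: "bcL1 g"
  shows "bcL1 (conv f g)"
proof -
  obtain B where B: "\<And>x. cmod (g x) \<le> B"
    using bounded_range_obtain[OF bcL1D(2)[OF g]] by blast
  have "bounded (range (conv f g))"
    using conv_bounded(2)[OF f B bcL1D(4)[OF g]] unfolding bounded_iff by auto
  then show ?thesis
    using f g by (auto simp: bcL1_def intro: continuous_conv integrable_conv)
qed

lemma Cc_conv:
  assumes f: "Cc f" and g: "Cc g"
  shows "Cc (conv f g)"
proof -
  obtain R S where R: "\<And>x. f x \<noteq> 0 \<Longrightarrow> norm x \<le> R" and S: "\<And>x. g x \<noteq> 0 \<Longrightarrow> norm x \<le> S"
    using CcD(2)[OF f] CcD(2)[OF g] unfolding bounded_iff by auto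
  have "norm x \<le> R + S" if "conv f g x \<noteq> 0" for x
  proof (rule ccontr)
    assume "\<not> norm x \<le> R + S"
    then have "f y * g (x - y) = 0" for y
      using R[of y] S[of "x - y"] norm_triangle_sub[of x y] by fastforce
    then have "(\<lambda>y. f y * g (x - y)) = (\<lambda>y. 0)" by blast
    then show False using that by (simp add: conv_def)
  qed
  then have "bounded {x. conv f g x \<noteq> 0}"
    unfolding bounded_iff by auto
  then show ?thesis
    using continuous_conv[OF CcD(4)[OF f] CcD(1,3)[OF g]] by (simp add: Cc_def)
qed

section \<open>Gaussian mollification, inversion and the Plancherel identity\<close>

text \<open>The total mass of \<open>gauss\<close>; its square is the factor (2 pi)^N of the
  inversion formula.\<close>

abbreviation sd :: "'a::euclidean_space itself \<Rightarrow> real" where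
  "sd T \<equiv> sqrt (2 * pi) ^ DIM('a)"

lemma sd_sq: "sd TYPE('a::euclidean_space) * sd TYPE('a) = (2 * pi) ^ DIM('a)"
  unfolding power_mult_distrib[symmetric] real_sqrt_mult_self by simp

text \<open>The density of the centred normal law with standard deviation \<open>e\<close> in every
  coordinate, hence of integral one. It is complex-valued so that it can enter
  \<open>conv\<close>.\<close>

definition gkernel :: "real \<Rightarrow> 'a::euclidean_space \<Rightarrow> complex" where
  "gkernel e y = of_real (gauss ((1 / e) *\<^sub>R y) / (sd TYPE('a) * e ^ DIM('a)))"

abbreviation "mollify e f \<equiv> conv f (gkernel e)"

lemma integrable_gauss_scaled:
  assumes "e > 0"
  shows "integrable lborel (\<lambda>x::'a::euclidean_space. complex_of_real (gauss (e *\<^sub>R x)))"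
  using integrable_lborel_affine[of e "\<lambda>x::'a. complex_of_real (gauss x)" 0] gauss_nd(1)[where 'a='a] assms
  by simp

lemma fourier_gauss_scaled:
  assumes "e > 0"
  shows "fourier (\<lambda>x::'a::euclidean_space. complex_of_real (gauss (e *\<^sub>R x))) \<xi>
    = (2 * pi) ^ DIM('a) * gkernel e \<xi>"
proof -
  let ?f = "\<lambda>x::'a. exp (- (\<i> * complex_of_real (x \<bullet> ((1/e) *\<^sub>R \<xi>)))) * complex_of_real (gauss x)"
  have "fourier (\<lambda>x::'a. complex_of_real (gauss x)) ((1/e) *\<^sub>R \<xi>) =
      e ^ DIM('a) *\<^sub>R (LINT x|lborel. ?f (0 + e *\<^sub>R x))"
    unfolding fourier_def using assms integral_lborel_affine[of e ?f 0] by simp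
  also have "(LINT x|lborel. ?f (0 + e *\<^sub>R x)) = fourier (\<lambda>x::'a. complex_of_real (gauss (e *\<^sub>R x))) \<xi>"
    unfolding fourier_def using assms by simp
  finally have "e ^ DIM('a) *\<^sub>R fourier (\<lambda>x::'a. complex_of_real (gauss (e *\<^sub>R x))) \<xi>
     = sd TYPE('a) * gauss ((1/e) *\<^sub>R \<xi>)"
    by (simp add: gauss_nd(2))
  then have "fourier (\<lambda>x::'a. complex_of_real (gauss (e *\<^sub>R x))) \<xi>
     = of_real (sd TYPE('a) * gauss ((1/e) *\<^sub>R \<xi>) / e ^ DIM('a))"
    using assms by (simp add: field_simps scaleR_conv_of_real)
  also have "sd TYPE('a) * gauss ((1/e) *\<^sub>R \<xi>) / e ^ DIM('a)
      = (2 * pi) ^ DIM('a) * (gauss ((1/e) *\<^sub>R \<xi>) / (sd TYPE('a) * e ^ DIM('a)))"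
    unfolding sd_sq[symmetric] using assms by (simp add: field_simps)
  finally show ?thesis by (simp add: gkernel_def)
qed

lemma gkernel_commute: "gkernel e (x - y) = gkernel e (y - x)"
  unfolding gkernel_def minus_diff_eq[of y x, symmetric] scaleR_minus_right gauss_minus ..

lemma gkernel_eq:
  "gkernel e = (\<lambda>y::'a::euclidean_space. of_real (1 / (sd TYPE('a) * e ^ DIM('a))) * complex_of_real (gauss ((1/e) *\<^sub>R y)))"
  by (simp add: gkernel_def fun_eq_iff)

lemma bcL1_gkernel:
  assumes e: "e > 0"
  shows "bcL1 (gkernel e :: 'a::euclidean_space \<Rightarrow> complex)"
  unfolding bcL1_def
proof (intro conjI)
  have "cmod (gkernel e y) \<le> cmod (of_real (1 / (sd TYPE('a) * e ^ DIM('a))))" for y :: 'a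
    unfolding gkernel_eq norm_mult by (rule mult_left_le) auto
  then show "bounded (range (gkernel e :: 'a \<Rightarrow> complex))"
    unfolding bounded_iff by blast
  show "integrable lborel (gkernel e :: 'a \<Rightarrow> complex)"
    unfolding gkernel_eq using e by (intro integrable_mult_right integrable_gauss_scaled) simp
  show "continuous_on UNIV (gkernel e :: 'a \<Rightarrow> complex)"
    unfolding gkernel_eq by (intro continuous_on_mult continuous_on_const continuous_on_of_real
       continuous_gauss continuous_on_scaleR continuous_on_id)
qed

lemma fourier_gkernel: "e > 0 \<Longrightarrow> fourier (gkernel e) \<xi> = gauss (e *\<^sub>R \<xi>)"
  for \<xi> :: "'a::euclidean_space"
proof -
  assume e: "e > 0"
  have "fourier (gkernel e) \<xi> = of_real (1 / (sd TYPE('a) * e ^ DIM('a))) *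
      fourier (\<lambda>y. complex_of_real (gauss ((1/e) *\<^sub>R y))) \<xi>"
    unfolding gkernel_eq by (rule fourier_cmult)
  also have "\<dots> = of_real (1 / (sd TYPE('a) * e ^ DIM('a))) * ((2 * pi) ^ DIM('a) * gkernel (1/e) \<xi>)"
    using fourier_gauss_scaled[of "1/e" \<xi>] e by simp
  also have "\<dots> = of_real ((1 / (sd TYPE('a) * e ^ DIM('a))) * (sd TYPE('a) * sd TYPE('a)) * (gauss (e *\<^sub>R \<xi>) / (sd TYPE('a) * (1/e) ^ DIM('a))))"
    unfolding sd_sq gkernel_def by simp
  also have "\<dots> = gauss (e *\<^sub>R \<xi>)"
    using e by (simp add: field_simps)
  finally show ?thesis .
qed

text \<open>Inversion with a damping factor, which makes the integral absolutely convergent for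
  every integrable \<open>f\<close>. The multiplication formula moves the transform onto a modulated
  Gaussian, whose transform is a translated \<open>gkernel\<close>.\<close>

lemma fourier_gauss_times_fourier:
  fixes f :: "'a::euclidean_space \<Rightarrow> complex"
  assumes f: "integrable lborel f" and e: "e > 0"
  shows "fourier (\<lambda>\<xi>. fourier f \<xi> * gauss (e *\<^sub>R \<xi>)) (- x) = (2 * pi) ^ DIM('a) * mollify e f x"
proof -
  let ?g = "\<lambda>\<xi>. exp (\<i> * complex_of_real (x \<bullet> \<xi>)) * complex_of_real (gauss (e *\<^sub>R \<xi>))"
  have g: "integrable lborel ?g"
    using integrable_fourier_kernel[OF integrable_gauss_scaled[OF e], of "- x"]
    unfolding inner_commute[of x] by simp
  have "fourier (\<lambda>\<xi>. fourier f \<xi> * gauss (e *\<^sub>R \<xi>)) (- x) = (LINT \<xi>|lborel. fourier f \<xi> * ?g \<xi>)"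
    unfolding fourier_def[of _ "- x"]
    by (intro LINT_cong) (auto simp: inner_commute[of x])
  also have "\<dots> = (LINT y|lborel. f y * fourier ?g y)"
    by (rule fourier_multiplication_formula[OF f g])
  also have "\<dots> = (LINT y|lborel. (2 * pi) ^ DIM('a) * (f y * gkernel e (x - y)))"
    unfolding fourier_modulate fourier_gauss_scaled[OF e] gkernel_commute[of e x]
    by (simp add: mult_ac)
  also have "\<dots> = (2 * pi) ^ DIM('a) * mollify e f x"
    unfolding conv_def by simp
  finally show ?thesis .
qed

text \<open>Substituting y = x + e z moves \<open>e\<close> out of the kernel into the argument of
  \<open>f\<close>, so that for bounded \<open>f\<close> a multiple of one fixed Gaussian dominates
  as \<open>e\<close> tends to 0.\<close>

lemma mollify_eq:
  fixes f :: "'a::euclidean_space \<Rightarrow> complex"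
  assumes f: "f \<in> borel_measurable borel" and e: "e > 0"
  shows "mollify e f x = (LINT z|lborel. f (x + e *\<^sub>R z) * gauss z) / sd TYPE('a)"
proof -
  note [measurable] = f borel_measurable_integrable[OF bcL1D(3)[OF bcL1_gkernel[OF e]]]
  have "mollify e f x = e ^ DIM('a) *\<^sub>R (LINT z|lborel. f (x + e *\<^sub>R z) * gkernel e (x - (x + e *\<^sub>R z)))"
    unfolding conv_def using e
    by (subst integral_lborel_affine[of e _ x]) auto
  also have "\<dots> = (LINT z|lborel. e ^ DIM('a) *\<^sub>R (f (x + e *\<^sub>R z) * gkernel e (x - (x + e *\<^sub>R z))))"
    by simp
  also have "\<dots> = (LINT z|lborel. f (x + e *\<^sub>R z) * gauss z / sd TYPE('a))"
    using e by (intro LINT_cong) (auto simp: gkernel_def scaleR_conv_of_real)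
  finally show ?thesis by simp
qed

lemma integral_gauss: "(LINT z|lborel. complex_of_real (gauss (z::'a::euclidean_space))) = sd TYPE('a)"
  using gauss_nd(2)[of "0::'a"] by (simp add: fourier_def)

lemma integrable_gauss: "integrable lborel (gauss :: 'a::euclidean_space \<Rightarrow> real)"
  using gauss_nd(1) by (simp add: complex_of_real_integrable_eq)

lemma mollify_bound:
  fixes f :: "'a::euclidean_space \<Rightarrow> complex"
  assumes f: "f \<in> borel_measurable borel" and e: "e > 0" and B: "\<And>x. cmod (f x) \<le> B"
  shows "cmod (mollify e f x) \<le> B"
proof -
  have "cmod (LINT z|lborel. f (x + e *\<^sub>R z) * gauss z) \<le> (LINT z|lborel. B * gauss (z::'a))"
  proof (rule norm_LINT_le)
    show "integrable lborel (\<lambda>z. f (x + e *\<^sub>R z) * gauss z)"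
      using B f by (intro integrable_bounded_times(1)[where B=B] gauss_nd) auto
    show "integrable lborel (\<lambda>z::'a. B * gauss z)" using integrable_gauss[where 'a='a] by simp
  qed (use B gauss_pos in \<open>auto simp: norm_mult less_imp_le intro!: mult_right_mono\<close>)
  also have "(LINT z|lborel. B * gauss (z::'a)) = B * sd TYPE('a)"
  proof -
    have "complex_of_real (LINT z|lborel. gauss (z::'a)) = sd TYPE('a)"
      using integral_gauss[where 'a='a] by simp
    then show ?thesis by (simp only: of_real_eq_iff) simp
  qed
  finally show ?thesis
    unfolding mollify_eq[OF f e] by (simp add: norm_divide norm_mult norm_power divide_le_eq)
qed

lemma mollify_tendsto:
  fixes f :: "'a::euclidean_space \<Rightarrow> complex"
  assumes f: "continuous_on UNIV f" "bounded (range f)" and e: "\<And>n. e n > 0" "e \<longlonglongrightarrow> 0"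
  shows "(\<lambda>n. mollify (e n) f x) \<longlonglongrightarrow> f x"
proof -
  obtain B where B: "\<And>x. cmod (f x) \<le> B"
    using bounded_range_obtain[OF f(2)] by blast
  note [measurable] = borel_measurable_continuous_onI[OF f(1)]
  have fi: "isCont f z" for z
    using f(1) by (simp add: continuous_on_eq_continuous_at)
  have "(\<lambda>n. LINT z|lborel. f (x + e n *\<^sub>R z) * gauss z) \<longlonglongrightarrow> (LINT z|lborel. f x * gauss (z::'a))"
  proof (rule integral_dominated_convergence[where w="\<lambda>z. B * gauss z"])
    show "integrable lborel (\<lambda>z::'a. B * gauss z)" using integrable_gauss[where 'a='a] by simp
    have "(\<lambda>n. x + e n *\<^sub>R z) \<longlonglongrightarrow> x" for z
      by (rule tendsto_eq_intros e refl)+ simp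
    then show "AE z in lborel. (\<lambda>n. f (x + e n *\<^sub>R z) * gauss z) \<longlonglongrightarrow> f x * gauss z"
      by (intro AE_I2 tendsto_intros isCont_tendsto_compose[OF fi])
    show "AE z in lborel. norm (f (x + e n *\<^sub>R z) * gauss z) \<le> B * gauss z" for n
      using B gauss_pos by (auto simp: norm_mult less_imp_le intro!: mult_right_mono)
  qed auto
  then have "(\<lambda>n. (LINT z|lborel. f (x + e n *\<^sub>R z) * gauss z) / sd TYPE('a))
     \<longlonglongrightarrow> (LINT z|lborel. f x * gauss (z::'a)) / sd TYPE('a)"
    by (intro tendsto_intros) auto
  then show ?thesis
    using e integral_gauss[where 'a='a] by (simp add: mollify_eq)
qed

text \<open>Both sides are limits of the same damped integrals: dominated convergence with majorant
  \<open>cmod (fourier f \<xi>)\<close> gives the left side, and the approximate identity at a point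
  of continuity gives the right.\<close>

lemma fourier_inversion:
  fixes f :: "'a::euclidean_space \<Rightarrow> complex"
  assumes f: "bcL1 f" and i: "integrable lborel (fourier f)"
  shows "fourier (fourier f) (- x) = (2 * pi) ^ DIM('a) * f x"
proof -
  obtain e :: "nat \<Rightarrow> real" where e: "\<And>n. e n > 0" "e \<longlonglongrightarrow> 0"
    by (rule exists_null_sequence) blast
  note [measurable] = borel_measurable_integrable[OF i]
  have "(\<lambda>n. fourier (\<lambda>\<xi>. fourier f \<xi> * gauss (e n *\<^sub>R \<xi>)) (- x)) \<longlonglongrightarrow> fourier (fourier f) (- x)"
    unfolding fourier_def[of _ "- x"]
  proof (rule integral_dominated_convergence[where w="\<lambda>\<xi>. cmod (fourier f \<xi>)"])
    have "(\<lambda>n. complex_of_real (gauss (e n *\<^sub>R \<xi>))) \<longlonglongrightarrow> 1" for \<xi> :: 'a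
      by (rule tendsto_eq_intros e refl)+ simp
    from tendsto_mult[OF tendsto_const tendsto_mult[OF tendsto_const this]]
    show "AE \<xi> in lborel. (\<lambda>n. exp (- \<i> * complex_of_real (\<xi> \<bullet> - x)) * (fourier f \<xi> * gauss (e n *\<^sub>R \<xi>)))
       \<longlonglongrightarrow> exp (- \<i> * complex_of_real (\<xi> \<bullet> - x)) * fourier f \<xi>"
      unfolding mult_1_right by (rule AE_I2)
    show "AE \<xi> in lborel. norm (exp (- \<i> * complex_of_real (\<xi> \<bullet> - x)) * (fourier f \<xi> * gauss (e n *\<^sub>R \<xi>)))
       \<le> cmod (fourier f \<xi>)" for n
      using gauss_le_1 gauss_pos by (auto simp: norm_mult less_imp_le mult_left_le)
  qed (use i in auto)
  moreover have "(\<lambda>n. fourier (\<lambda>\<xi>. fourier f \<xi> * gauss (e n *\<^sub>R \<xi>)) (- x)) \<longlonglongrightarrow> (2 * pi) ^ DIM('a) * f x"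
    unfolding fourier_gauss_times_fourier[OF bcL1D(3)[OF f] e(1)]
    by (intro tendsto_intros mollify_tendsto bcL1D[OF f] e)
  ultimately show ?thesis
    by (rule LIMSEQ_unique)
qed

lemma integrable_square_bcL1:
  fixes f :: "'a::euclidean_space \<Rightarrow> complex"
  assumes "bcL1 f"
  shows "integrable lborel (\<lambda>x. (cmod (f x))\<^sup>2)"
proof -
  obtain B where B: "\<And>x. cmod (f x) \<le> B"
    using bounded_range_obtain[OF bcL1D(2)[OF assms]] by blast
  note [measurable] = bcL1D(4)[OF assms]
  have "integrable lborel (\<lambda>x. B * cmod (f x))" using bcL1D(3)[OF assms] by simp
  then show ?thesis
    by (rule integrable_dominated)
       (use B in \<open>auto simp: power2_eq_square intro!: mult_right_mono order_trans[OF _ abs_ge_self]\<close>)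
qed

lemma plancherel:
  fixes f :: "'a::euclidean_space \<Rightarrow> complex"
  assumes f: "bcL1 f"
  shows "integrable lborel (\<lambda>\<xi>::'a::euclidean_space. (cmod (fourier f \<xi>))\<^sup>2)"
    and "(LINT \<xi>|lborel. (cmod (fourier f \<xi>))\<^sup>2) = (2 * pi) ^ DIM('a) * (LINT x|lborel. (cmod (f x))\<^sup>2)"
proof -
  obtain e :: "nat \<Rightarrow> real" where e: "\<And>n. e n > 0" "e \<longlonglongrightarrow> 0"
    by (rule exists_null_sequence) blast
  obtain B where B: "\<And>x. cmod (f x) \<le> B"
    using bounded_range_obtain[OF bcL1D(2)[OF f]] by blast
  note fi = bcL1D(3)[OF f]
  note [measurable] = bcL1D(4)[OF f] borel_measurable_fourier[OF fi]
  define Q where "Q n = (LINT \<xi>|lborel. (cmod (fourier f \<xi>))\<^sup>2 * gauss (e n *\<^sub>R \<xi>))" for n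
  \<comment> \<open>Conjugation together with reflection turns \<open>fourier f\<close> into its
    complex conjugate, so that the squared modulus becomes a product of two transforms.\<close>
  let ?h = "\<lambda>x. cnj (f (- x))"
  have h: "integrable lborel ?h"
    using integrable_lborel_minus[of f] fi by simp
  have Fh: "fourier ?h \<xi> = cnj (fourier f \<xi>)" for \<xi>
    by (subst fourier_minus_arg[of "\<lambda>x. cnj (f x)"]) (auto simp: fourier_cnj)
  have Fb: "cmod (fourier f \<xi>) \<le> (LINT x|lborel. cmod (f x))" for \<xi>
    by (rule cmod_fourier_le)
  have gi: "integrable lborel (\<lambda>\<xi>. fourier f \<xi> * gauss (e n *\<^sub>R \<xi>))" for n
    by (rule integrable_bounded_times(1)[OF Fb _ integrable_gauss_scaled[OF e(1)]]) measurable
  have Qi: "integrable lborel (\<lambda>\<xi>. cnj (fourier f \<xi>) * (fourier f \<xi> * gauss (e n *\<^sub>R \<xi>)))" for n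
    by (rule integrable_bounded_times(1)[OF _ _ gi]) (use Fb in auto)
  have cQ: "cnj (fourier f \<xi>) * (fourier f \<xi> * gauss (e n *\<^sub>R \<xi>))
      = of_real ((cmod (fourier f \<xi>))\<^sup>2 * gauss (e n *\<^sub>R \<xi>))" for n \<xi>
    unfolding of_real_mult complex_norm_square by (simp add: mult_ac)
  have Qr: "integrable lborel (\<lambda>\<xi>. (cmod (fourier f \<xi>))\<^sup>2 * gauss (e n *\<^sub>R \<xi>))" for n
    using Qi[of n] unfolding cQ complex_of_real_integrable_eq .
  have "complex_of_real (Q n) = (2 * pi) ^ DIM('a) * (LINT x|lborel. cnj (f x) * mollify (e n) f x)" for n
  proof -
    have "complex_of_real (Q n) = (LINT \<xi>|lborel. fourier ?h \<xi> * (fourier f \<xi> * gauss (e n *\<^sub>R \<xi>)))"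
      unfolding Q_def Fh cQ by (rule integral_complex_of_real[symmetric])
    also have "\<dots> = (LINT x|lborel. cnj (f (- x)) * fourier (\<lambda>\<xi>. fourier f \<xi> * gauss (e n *\<^sub>R \<xi>)) x)"
      by (rule fourier_multiplication_formula[OF h gi])
    also have "\<dots> = (LINT x|lborel. cnj (f x) * fourier (\<lambda>\<xi>. fourier f \<xi> * gauss (e n *\<^sub>R \<xi>)) (- x))"
      using gi by (subst integral_lborel_minus[symmetric]) auto
    also have "\<dots> = (LINT x|lborel. (2 * pi) ^ DIM('a) * (cnj (f x) * mollify (e n) f x))"
      unfolding fourier_gauss_times_fourier[OF fi e(1)] by (simp add: mult_ac)
    finally show ?thesis by simp
  qed
  moreover have "(\<lambda>n. (2 * pi) ^ DIM('a) * (LINT x|lborel. cnj (f x) * mollify (e n) f x))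
     \<longlonglongrightarrow> (2 * pi) ^ DIM('a) * (LINT x|lborel. cnj (f x) * f x)"
  proof (intro tendsto_intros, rule integral_dominated_convergence[where w="\<lambda>x. cmod (f x) * B"])
    show "AE x in lborel. (\<lambda>n. cnj (f x) * mollify (e n) f x) \<longlonglongrightarrow> cnj (f x) * f x"
      by (intro AE_I2 tendsto_intros mollify_tendsto bcL1D[OF f] e)
    show "AE x in lborel. norm (cnj (f x) * mollify (e n) f x) \<le> cmod (f x) * B" for n
      using mollify_bound[OF bcL1D(4)[OF f] e(1) B] by (auto simp: norm_mult intro!: mult_left_mono)
    show "(\<lambda>x. cnj (f x) * mollify (e n) f x) \<in> borel_measurable lborel" for n
      using borel_measurable_continuous_onI[OF continuous_conv[OF fi bcL1D(1,2)[OF bcL1_gkernel[OF e(1)]]]]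
      by auto
  qed (use fi in auto)
  moreover have "(2 * pi) ^ DIM('a) * (LINT x|lborel. cnj (f x) * f x)
      = complex_of_real ((2 * pi) ^ DIM('a) * (LINT x|lborel. (cmod (f x))\<^sup>2))"
  proof -
    have *: "(LINT x|lborel. cnj (f x) * f x) = (LINT x|lborel. complex_of_real ((cmod (f x))\<^sup>2))"
      unfolding complex_norm_square by (simp add: mult.commute)
    show ?thesis unfolding * integral_complex_of_real by simp
  qed
  ultimately have "(\<lambda>n. complex_of_real (Q n)) \<longlonglongrightarrow> of_real ((2 * pi) ^ DIM('a) * (LINT x|lborel. (cmod (f x))\<^sup>2))"
    by simp
  then have Qlim: "Q \<longlonglongrightarrow> (2 * pi) ^ DIM('a) * (LINT x|lborel. (cmod (f x))\<^sup>2)"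
    by (simp only: tendsto_of_real_iff)
  have glim: "(\<lambda>n. (cmod (fourier f \<xi>))\<^sup>2 * gauss (e n *\<^sub>R \<xi>)) \<longlonglongrightarrow> (cmod (fourier f \<xi>))\<^sup>2" for \<xi>
    by (rule tendsto_eq_intros e refl)+ simp
  have Qnn: "(\<integral>\<^sup>+\<xi>. ennreal ((cmod (fourier f \<xi>))\<^sup>2 * gauss (e n *\<^sub>R \<xi>)) \<partial>lborel) = ennreal (Q n)" for n
    unfolding Q_def using Qr gauss_pos by (intro nn_integral_eq_integral) (auto simp: less_imp_le)
  have "(\<integral>\<^sup>+\<xi>. ennreal ((cmod (fourier f \<xi>))\<^sup>2) \<partial>lborel)
      = (\<integral>\<^sup>+\<xi>. liminf (\<lambda>n. ennreal ((cmod (fourier f \<xi>))\<^sup>2 * gauss (e n *\<^sub>R \<xi>))) \<partial>lborel)"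
    by (intro nn_integral_cong lim_imp_Liminf[symmetric] tendsto_ennrealI glim) auto
  also have "\<dots> \<le> liminf (\<lambda>n. ennreal (Q n))"
    unfolding Qnn[symmetric] by (rule nn_integral_liminf) auto
  also have "\<dots> = ennreal ((2 * pi) ^ DIM('a) * (LINT x|lborel. (cmod (f x))\<^sup>2))"
    by (intro lim_imp_Liminf tendsto_ennrealI Qlim) auto
  finally show I: "integrable lborel (\<lambda>\<xi>::'a::euclidean_space. (cmod (fourier f \<xi>))\<^sup>2)"
    unfolding integrable_iff_bounded by (auto intro: order.strict_trans1)
  have "Q \<longlonglongrightarrow> (LINT \<xi>|lborel. (cmod (fourier f \<xi>))\<^sup>2)"
    unfolding Q_def
    by (rule integral_dominated_convergence[where w="\<lambda>\<xi>. (cmod (fourier f \<xi>))\<^sup>2"])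
       (use I glim gauss_le_1 gauss_pos in \<open>auto simp: less_imp_le mult_left_le\<close>)
  then show "(LINT \<xi>|lborel. (cmod (fourier f \<xi>))\<^sup>2) = (2 * pi) ^ DIM('a) * (LINT x|lborel. (cmod (f x))\<^sup>2)"
    using Qlim LIMSEQ_unique by blast
qed

lemma plancherel_nn:
  fixes f :: "'a::euclidean_space \<Rightarrow> complex"
  assumes f: "bcL1 f"
  shows "(\<integral>\<^sup>+x. ennreal ((cmod (f x))\<^sup>2) \<partial>lborel) =
    ennreal (1 / (2 * pi) ^ DIM('a)) * (\<integral>\<^sup>+\<xi>. ennreal ((cmod (fourier f \<xi>))\<^sup>2) \<partial>(lborel::'a::euclidean_space measure))"
  using plancherel[OF f] integrable_square_bcL1[OF f]
  by (simp add: nn_integral_eq_integral flip: ennreal_mult)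

text \<open>Convergence is checked on the Fourier side, where the error is
  \<open>fourier f \<xi>\<close> times \<open>gauss (e n *\<^sub>R \<xi>) - 1\<close>; the second
  factor has modulus at most one and tends to 0 pointwise.\<close>

lemma mollify_L2_tendsto:
  fixes f :: "'a::euclidean_space \<Rightarrow> complex"
  assumes f: "bcL1 f" and e: "\<And>n. e n > 0" "e \<longlonglongrightarrow> 0"
  shows "L2_tendsto (\<lambda>n. mollify (e n) f) (f :: 'a::euclidean_space \<Rightarrow> complex)"
proof -
  note fi = bcL1D(3)[OF f]
  note [measurable] = bcL1D(4)[OF f] borel_measurable_fourier[OF fi]
  note pl = plancherel[OF f]
  have m: "bcL1 (mollify (e n) f)" for n
    by (intro bcL1_conv fi bcL1_gkernel e)
  have F: "fourier (\<lambda>x. mollify (e n) f x - f x) \<xi> = fourier f \<xi> * (gauss (e n *\<^sub>R \<xi>) - 1)" for n \<xi>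
    using e by (simp add: fourier_diff bcL1D(3)[OF m] fi fourier_conv bcL1D(3)[OF bcL1_gkernel] fourier_gkernel algebra_simps)
  have g: "cmod (of_real (gauss x) - 1) \<le> 1" for x :: 'a
  proof -
    have "complex_of_real (gauss x) - 1 = of_real (gauss x - 1)" by simp
    then show ?thesis by (simp only: norm_of_real) (simp add: abs_le_iff)
  qed
  have "(\<lambda>n. \<integral>\<^sup>+\<xi>. ennreal ((cmod (fourier f \<xi> * (gauss (e n *\<^sub>R \<xi>) - 1)))\<^sup>2) \<partial>lborel) \<longlonglongrightarrow> (\<integral>\<^sup>+\<xi>. 0 \<partial>(lborel :: 'a measure))"
  proof (rule nn_integral_dominated_convergence[where w="\<lambda>\<xi>. ennreal ((cmod (fourier f \<xi>))\<^sup>2)"])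
    show "(\<integral>\<^sup>+\<xi>. ennreal ((cmod (fourier f \<xi>))\<^sup>2) \<partial>lborel) < \<infinity>"
      using pl(1) by (simp add: nn_integral_eq_integral)
    show "AE \<xi> in lborel. ennreal ((cmod (fourier f \<xi> * (gauss (e n *\<^sub>R \<xi>) - 1)))\<^sup>2) \<le> ennreal ((cmod (fourier f \<xi>))\<^sup>2)" for n
      using g by (auto simp: norm_mult intro!: ennreal_leI power_mono mult_left_le)
    have "(\<lambda>n. ennreal ((cmod (fourier f \<xi> * (complex_of_real (gauss (e n *\<^sub>R \<xi>)) - 1)))\<^sup>2))
       \<longlonglongrightarrow> ennreal ((cmod (fourier f \<xi> * (complex_of_real (gauss (0 *\<^sub>R \<xi>)) - 1)))\<^sup>2)" for \<xi>
      by (intro tendsto_intros tendsto_ennrealI e)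
    then show "AE \<xi> in lborel. (\<lambda>n. ennreal ((cmod (fourier f \<xi> * (gauss (e n *\<^sub>R \<xi>) - 1)))\<^sup>2)) \<longlonglongrightarrow> 0"
      by simp
  qed auto
  then have "(\<lambda>n. ennreal (1 / (2 * pi) ^ DIM('a)) * (\<integral>\<^sup>+\<xi>. ennreal ((cmod (fourier f \<xi> * (gauss (e n *\<^sub>R \<xi>) - 1)))\<^sup>2) \<partial>lborel)) \<longlonglongrightarrow> 
     ennreal (1 / (2 * pi) ^ DIM('a)) * 0"
    by (intro tendsto_mult_ennreal) auto
  then show ?thesis
    unfolding L2_tendsto_def plancherel_nn[OF bcL1_diff[OF m f]] F by simp
qed

section \<open>The Fourier transform on square integrable functions\<close>

abbreviation nn2 :: "('a::euclidean_space \<Rightarrow> complex) \<Rightarrow> ennreal" where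
  "nn2 f \<equiv> \<integral>\<^sup>+x. ennreal ((cmod (f x))\<^sup>2) \<partial>lborel"

lemma square_integrable_iff:
  "square_integrable f \<longleftrightarrow> f \<in> borel_measurable borel \<and> nn2 f < \<infinity>"
  by (auto simp: square_integrable_def integrable_iff_bounded)

lemma square_integrable_measurable: "square_integrable f \<Longrightarrow> f \<in> borel_measurable borel"
  by (simp add: square_integrable_iff)

lemma nn2_add_le:
  assumes [measurable]: "f \<in> borel_measurable borel" "g \<in> borel_measurable borel"
  shows "nn2 (\<lambda>x. f x + g x) \<le> 2 * nn2 f + 2 * nn2 g"
proof -
  have "(cmod (f x + g x))\<^sup>2 \<le> 2 * (cmod (f x))\<^sup>2 + 2 * (cmod (g x))\<^sup>2" for x
  proof -
    have "(cmod (f x + g x))\<^sup>2 \<le> (cmod (f x) + cmod (g x))\<^sup>2"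
      by (intro power_mono norm_triangle_ineq) auto
    also have "\<dots> \<le> 2 * (cmod (f x))\<^sup>2 + 2 * (cmod (g x))\<^sup>2"
      using sum_squares_bound[of "cmod (f x)" "cmod (g x)"] by (simp add: power2_sum)
    finally show ?thesis .
  qed
  then have "nn2 (\<lambda>x. f x + g x) \<le> (\<integral>\<^sup>+x. ennreal (2 * (cmod (f x))\<^sup>2 + 2 * (cmod (g x))\<^sup>2) \<partial>lborel)"
    by (intro nn_integral_mono ennreal_leI)
  also have "\<dots> = (\<integral>\<^sup>+x. 2 * ennreal ((cmod (f x))\<^sup>2) + 2 * ennreal ((cmod (g x))\<^sup>2) \<partial>lborel)"
    by (intro nn_integral_cong) (simp add: ennreal_mult)
  also have "\<dots> = 2 * nn2 f + 2 * nn2 g"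
    by (simp add: nn_integral_add nn_integral_cmult)
  finally show ?thesis .
qed

lemma nn2_diff_commute: "nn2 (\<lambda>x. f x - g x) = nn2 (\<lambda>x. g x - f x)"
  by (simp add: norm_minus_commute)

lemma nn2_diff_trans:
  assumes [measurable]: "f \<in> borel_measurable borel" "g \<in> borel_measurable borel" "h \<in> borel_measurable borel"
  shows "nn2 (\<lambda>x. f x - h x) \<le> 2 * nn2 (\<lambda>x. f x - g x) + 2 * nn2 (\<lambda>x. g x - h x)"
  using nn2_add_le[of "\<lambda>x. f x - g x" "\<lambda>x. g x - h x"] by simp

lemma square_integrable_diff:
  assumes "square_integrable f" "square_integrable g"
  shows "square_integrable (\<lambda>x. f x - g x)"
proof -
  note [measurable] = square_integrable_measurable[OF assms(1)] square_integrable_measurable[OF assms(2)]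
  have "nn2 (\<lambda>x. f x - g x) \<le> 2 * nn2 f + 2 * nn2 g"
    using nn2_add_le[of f "\<lambda>x. - g x"] by simp
  also have "\<dots> < \<infinity>"
    using assms by (auto simp: square_integrable_iff ennreal_mult_less_top)
  finally show ?thesis by (simp add: square_integrable_iff)
qed

lemma square_integrable_bcL1: "bcL1 f \<Longrightarrow> square_integrable f"
  using integrable_square_bcL1 bcL1D(4) by (auto simp: square_integrable_def)

lemma square_integrable_fourier: "bcL1 f \<Longrightarrow> square_integrable (fourier f)"
  using plancherel(1) borel_measurable_fourier bcL1D(3) by (auto simp: square_integrable_def)

lemma integrable_times_square_integrable:
  assumes f: "square_integrable f" and g: "square_integrable g"
  shows "integrable lborel (\<lambda>x. f x * g x)"
proof -
  note [measurable] = square_integrable_measurable[OF f] square_integrable_measurable[OF g]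
  have "integrable lborel (\<lambda>x. (cmod (f x))\<^sup>2 + (cmod (g x))\<^sup>2)"
    using f g by (auto simp: square_integrable_def)
  then show ?thesis
  proof (rule integrable_dominated)
    have "cmod (f x * g x) \<le> (cmod (f x))\<^sup>2 + (cmod (g x))\<^sup>2" for x
    proof -
      have "2 * (cmod (f x) * cmod (g x)) \<le> (cmod (f x))\<^sup>2 + (cmod (g x))\<^sup>2"
        using sum_squares_bound[of "cmod (f x)" "cmod (g x)"] by simp
      moreover have "0 \<le> cmod (f x) * cmod (g x)" by simp
      ultimately show ?thesis unfolding norm_mult by linarith
    qed
    then show "AE x in lborel. norm (f x * g x) \<le> norm ((cmod (f x))\<^sup>2 + (cmod (g x))\<^sup>2)"
      by simp
  qed measurable
qed

lemma Cauchy_Schwarz_nn2: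
  assumes f: "square_integrable f" and g: "square_integrable g"
  shows "(ennreal (cmod (LINT x|lborel. f x * g x)))\<^sup>2 \<le> nn2 f * nn2 g"
proof -
  note [measurable] = square_integrable_measurable[OF f] square_integrable_measurable[OF g]
  have "ennreal (cmod (LINT x|lborel. f x * g x)) \<le> (\<integral>\<^sup>+x. ennreal (cmod (f x * g x)) \<partial>lborel)"
    by (rule integral_norm_bound_ennreal[OF integrable_times_square_integrable[OF f g]])
  also have "\<dots> = (\<integral>\<^sup>+x. ennreal (cmod (f x)) * ennreal (cmod (g x)) \<partial>lborel)"
    by (simp add: norm_mult ennreal_mult)
  finally have "(ennreal (cmod (LINT x|lborel. f x * g x)))\<^sup>2 \<le>
     (\<integral>\<^sup>+x. ennreal (cmod (f x)) * ennreal (cmod (g x)) \<partial>lborel)\<^sup>2"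
    by (rule power_mono) simp
  also have "\<dots> \<le> (\<integral>\<^sup>+x. (ennreal (cmod (f x)))\<^sup>2 \<partial>lborel) * (\<integral>\<^sup>+x. (ennreal (cmod (g x)))\<^sup>2 \<partial>lborel)"
    by (rule Cauchy_Schwarz_nn_integral) measurable
  also have "\<dots> = nn2 f * nn2 g"
    by (simp add: ennreal_power)
  finally show ?thesis .
qed

lemma L2_tendsto_eventually_square_integrable:
  assumes "L2_tendsto \<phi> f" "square_integrable f" "\<And>n. \<phi> n \<in> borel_measurable borel"
  shows "eventually (\<lambda>n. square_integrable (\<phi> n)) sequentially"
proof -
  note [measurable] = assms(3) square_integrable_measurable[OF assms(2)]
  have "eventually (\<lambda>n. nn2 (\<lambda>x. \<phi> n x - f x) < 1) sequentially"
    using assms(1) unfolding L2_tendsto_def by (rule order_tendstoD) simp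
  then show ?thesis
  proof eventually_elim
    case (elim n)
    then have d: "square_integrable (\<lambda>x. \<phi> n x - f x)"
      by (auto simp: square_integrable_iff intro: less_trans)
    have "nn2 (\<phi> n) \<le> 2 * nn2 (\<lambda>x. \<phi> n x - f x) + 2 * nn2 f"
      using nn2_add_le[of "\<lambda>x. \<phi> n x - f x" f] by simp
    also have "\<dots> < \<infinity>"
      using d assms(2) by (auto simp: square_integrable_iff ennreal_mult_less_top)
    finally show ?case using assms(3) by (simp add: square_integrable_iff)
  qed
qed

text \<open>Cauchy-Schwarz. The approximants are only assumed measurable; being L2-close to
  \<open>f\<close> they are square integrable from some index on, and the estimate is made from
  there.\<close>

lemma L2_tendsto_pairing:
  assumes lim: "L2_tendsto \<phi> f" and f: "square_integrable f" and \<phi>: "\<And>n. \<phi> n \<in> borel_measurable borel"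
    and g: "square_integrable g"
  shows "(\<lambda>n. LINT x|lborel. \<phi> n x * g x) \<longlonglongrightarrow> (LINT x|lborel. f x * g x)"
proof -
  note [measurable] = \<phi> square_integrable_measurable[OF f] square_integrable_measurable[OF g]
  let ?d = "\<lambda>n. (LINT x|lborel. \<phi> n x * g x) - (LINT x|lborel. f x * g x)"
  have ev: "eventually (\<lambda>n. ennreal ((cmod (?d n))\<^sup>2) \<le> nn2 (\<lambda>x. \<phi> n x - f x) * nn2 g) sequentially"
    using L2_tendsto_eventually_square_integrable[OF lim f \<phi>]
  proof eventually_elim
    case (elim n)
    have "?d n = (LINT x|lborel. (\<phi> n x - f x) * g x)"
      using integrable_times_square_integrable[OF elim g] integrable_times_square_integrable[OF f g]
      by (simp add: left_diff_distrib)
    then show ?case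
      using Cauchy_Schwarz_nn2[OF square_integrable_diff[OF elim f] g] by (simp add: ennreal_power)
  qed
  have "(\<lambda>n. nn2 (\<lambda>x. \<phi> n x - f x) * nn2 g) \<longlonglongrightarrow> 0 * nn2 g"
    using lim g unfolding L2_tendsto_def square_integrable_iff
    by (intro tendsto_mult_ennreal) auto
  then have "(\<lambda>n. ennreal ((cmod (?d n))\<^sup>2)) \<longlonglongrightarrow> 0"
    by (intro tendsto_sandwich[OF _ ev tendsto_const]) auto
  then have "(\<lambda>n. (cmod (?d n))\<^sup>2) \<longlonglongrightarrow> 0"
    by (subst (asm) tendsto_ennreal_iff[of _ _ 0, unfolded ennreal_0]) auto
  then have "(\<lambda>n. sqrt ((cmod (?d n))\<^sup>2)) \<longlonglongrightarrow> sqrt 0"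
    by (rule tendsto_real_sqrt)
  then have "?d \<longlonglongrightarrow> 0"
    by (simp add: tendsto_norm_zero_iff)
  then show ?thesis
    by (simp add: LIM_zero_iff)
qed

lemma has_L2_fourier_bcL1:
  assumes f: "bcL1 f"
  shows "has_L2_fourier f (fourier f)"
  unfolding has_L2_fourier_def
proof (intro conjI exI[of _ "\<lambda>_. f"] allI)
  show "L2_tendsto (\<lambda>n. f) f" "L2_tendsto (\<lambda>n. fourier f) (fourier f)"
    by (simp_all add: L2_tendsto_def)
qed (use f in \<open>auto simp: square_integrable_bcL1 square_integrable_fourier bcL1D\<close>)

text \<open>The transform of \<open>g\<close> is square integrable but possibly not integrable, so
  it is approximated by its Gaussian-damped versions \<open>\<phi>\<close>. Their transforms are
  exactly the Gaussian means of \<open>g\<close>, which converge to \<open>g\<close> in L2.\<close>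

lemma has_L2_fourier_inverse:
  fixes g :: "'a::euclidean_space \<Rightarrow> complex"
  assumes g: "bcL1 g"
  shows "has_L2_fourier (\<lambda>x. fourier g (- x) / (2 * pi) ^ DIM('a)) g"
proof -
  define c where "c = complex_of_real ((2 * pi) ^ DIM('a))"
  have c0: "c \<noteq> 0" by (simp add: c_def)
  define f where "f x = fourier g (- x) / c" for x
  note gi = bcL1D(3)[OF g]
  note [measurable] = borel_measurable_fourier[OF gi]
  have fm[measurable]: "f \<in> borel_measurable borel" unfolding f_def by measurable
  have fs: "square_integrable f"
  proof -
    have "integrable lborel (\<lambda>x. (cmod (fourier g (- x)))\<^sup>2 / (cmod c)\<^sup>2)"
      using plancherel(1)[OF g] integrable_lborel_minus[of "\<lambda>x. (cmod (fourier g x))\<^sup>2"]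
      by (intro integrable_divide) auto
    then show ?thesis
      by (simp add: square_integrable_def f_def norm_divide power_divide)
  qed
  obtain e :: "nat \<Rightarrow> real" where e: "\<And>n. e n > 0" "e \<longlonglongrightarrow> 0"
    by (rule exists_null_sequence) blast
  define \<phi> where "\<phi> n x = f x * gauss (e n *\<^sub>R x)" for n x
  have fb: "cmod (f x) \<le> (LINT x|lborel. cmod (g x)) / cmod c" for x
    unfolding f_def norm_divide by (intro divide_right_mono cmod_fourier_le) auto
  have \<phi>i: "integrable lborel (\<phi> n)" for n
    unfolding \<phi>_def by (rule integrable_bounded_times(1)[OF fb fm integrable_gauss_scaled[OF e(1)]])
  have \<phi>s: "square_integrable (\<phi> n)" for n
  proof -
    have "integrable lborel (\<lambda>x. (cmod (\<phi> n x))\<^sup>2)"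
    proof (rule integrable_dominated)
      show "integrable lborel (\<lambda>x. (cmod (f x))\<^sup>2)" using fs by (simp add: square_integrable_def)
      show "AE x in lborel. norm ((cmod (\<phi> n x))\<^sup>2) \<le> norm ((cmod (f x))\<^sup>2)"
        by (auto simp: \<phi>_def norm_mult intro!: power_mono mult_left_le)
    qed (use \<phi>i in measurable)
    then show ?thesis using \<phi>i by (simp add: square_integrable_def)
  qed
  have F\<phi>: "fourier (\<phi> n) = mollify (e n) g" for n
  proof
    fix \<xi> :: 'a
    have "fourier (\<phi> n) \<xi> = fourier (\<lambda>x. (\<lambda>y. (1/c) * (fourier g y * gauss (e n *\<^sub>R y))) (- x)) \<xi>"
      by (rule arg_cong[where f="\<lambda>h. fourier h \<xi>"]) (auto simp: \<phi>_def f_def)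
    also have "\<dots> = (1/c) * fourier (\<lambda>y. fourier g y * gauss (e n *\<^sub>R y)) (- \<xi>)"
      by (subst fourier_minus_arg) (simp_all add: fourier_cmult del: times_divide_eq_left)
    also have "\<dots> = mollify (e n) g \<xi>"
      unfolding fourier_gauss_times_fourier[OF gi e(1)] c_def[symmetric] using c0 by simp
    finally show "fourier (\<phi> n) \<xi> = mollify (e n) g \<xi>" .
  qed
  have "L2_tendsto \<phi> f"
    unfolding L2_tendsto_def
  proof -
    have "(\<lambda>n. nn2 (\<lambda>x. \<phi> n x - f x)) \<longlonglongrightarrow> (\<integral>\<^sup>+x. 0 \<partial>(lborel :: 'a measure))"
    proof (rule nn_integral_dominated_convergence[where w="\<lambda>x. ennreal ((cmod (f x))\<^sup>2)"])
      show "nn2 f < \<infinity>" using fs by (simp add: square_integrable_iff)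
      have *: "\<phi> n x - f x = f x * of_real (gauss (e n *\<^sub>R x) - 1)" for n x
        by (simp add: \<phi>_def algebra_simps)
      show "AE x in lborel. ennreal ((cmod (\<phi> n x - f x))\<^sup>2) \<le> ennreal ((cmod (f x))\<^sup>2)" for n
        unfolding * norm_mult norm_of_real
        by (auto intro!: ennreal_leI power_mono mult_left_le simp: abs_le_iff)
      have "(\<lambda>n. ennreal ((cmod (\<phi> n x - f x))\<^sup>2)) \<longlonglongrightarrow> ennreal ((cmod (f x * of_real (gauss (0 *\<^sub>R x) - 1)))\<^sup>2)" for x
        unfolding * by (intro tendsto_intros tendsto_ennrealI e)
      then show "AE x in lborel. (\<lambda>n. ennreal ((cmod (\<phi> n x - f x))\<^sup>2)) \<longlonglongrightarrow> 0"
        by simp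
    qed (auto simp: \<phi>_def)
    then show "(\<lambda>n. nn2 (\<lambda>x. \<phi> n x - f x)) \<longlonglongrightarrow> 0" by simp
  qed
  moreover have "L2_tendsto (\<lambda>n. fourier (\<phi> n)) g"
    unfolding F\<phi> by (rule mollify_L2_tendsto[OF g e])
  ultimately show ?thesis
    using \<phi>i \<phi>s fs square_integrable_bcL1[OF g]
    unfolding has_L2_fourier_def f_def[abs_def] c_def by auto
qed

text \<open>Two successive limits: for fixed \<open>k\<close> the approximants of \<open>f\<close>
  converge against \<open>\<psi> k\<close>, and afterwards \<open>k\<close> tends to infinity. The
  intermediate identity is claimed only for large \<open>k\<close>, where
  \<open>fourier (\<psi> k)\<close> is known to be square integrable.\<close>

lemma has_L2_fourier_multiplication_formula:
  assumes 1: "has_L2_fourier f g" and 2: "has_L2_fourier f' g'"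
  shows "(LINT x|lborel. f x * g' x) = (LINT x|lborel. g x * f' x)"
proof -
  from 1 obtain \<phi> where fg: "square_integrable f" "square_integrable g"
    and \<phi>: "\<And>n. integrable lborel (\<phi> n)" "L2_tendsto \<phi> f" "L2_tendsto (\<lambda>n. fourier (\<phi> n)) g"
    unfolding has_L2_fourier_def by blast
  from 2 obtain \<psi> where fg': "square_integrable f'" "square_integrable g'"
    and \<psi>: "\<And>n. integrable lborel (\<psi> n)" "\<And>n. square_integrable (\<psi> n)"
      "L2_tendsto \<psi> f'" "L2_tendsto (\<lambda>n. fourier (\<psi> n)) g'"
    unfolding has_L2_fourier_def by blast
  have m: "\<phi> n \<in> borel_measurable borel" "\<psi> n \<in> borel_measurable borel"
    "fourier (\<phi> n) \<in> borel_measurable borel" "fourier (\<psi> n) \<in> borel_measurable borel" for n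
    using borel_measurable_integrable[OF \<phi>(1)] borel_measurable_integrable[OF \<psi>(1)]
      borel_measurable_fourier \<phi>(1) \<psi>(1) by auto
  have "eventually (\<lambda>k. (LINT x|lborel. f x * fourier (\<psi> k) x) = (LINT x|lborel. g x * \<psi> k x)) sequentially"
    using L2_tendsto_eventually_square_integrable[OF \<psi>(4) fg'(2) m(4)]
  proof eventually_elim
    case (elim k)
    have "(\<lambda>n. LINT x|lborel. \<phi> n x * fourier (\<psi> k) x) \<longlonglongrightarrow> (LINT x|lborel. f x * fourier (\<psi> k) x)"
      by (rule L2_tendsto_pairing[OF \<phi>(2) fg(1) m(1) elim])
    moreover have "(\<lambda>n. LINT x|lborel. fourier (\<phi> n) x * \<psi> k x) \<longlonglongrightarrow> (LINT x|lborel. g x * \<psi> k x)"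
      by (rule L2_tendsto_pairing[OF \<phi>(3) fg(2) m(3) \<psi>(2)])
    ultimately show ?case
      unfolding fourier_multiplication_formula[OF \<phi>(1) \<psi>(1)] by (rule LIMSEQ_unique)
  qed
  moreover have "(\<lambda>k. LINT x|lborel. f x * fourier (\<psi> k) x) \<longlonglongrightarrow> (LINT x|lborel. f x * g' x)"
    using L2_tendsto_pairing[OF \<psi>(4) fg'(2) m(4) fg(1)] by (simp add: mult.commute)
  ultimately have "(\<lambda>k. LINT x|lborel. g x * \<psi> k x) \<longlonglongrightarrow> (LINT x|lborel. f x * g' x)"
    by (rule Lim_transform_eventually[rotated])
  moreover have "(\<lambda>k. LINT x|lborel. g x * \<psi> k x) \<longlonglongrightarrow> (LINT x|lborel. g x * f' x)"
    using L2_tendsto_pairing[OF \<psi>(3) fg'(1) m(2) fg(2)] by (simp add: mult.commute)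
  ultimately show ?thesis by (rule LIMSEQ_unique)
qed

section \<open>Uniqueness almost everywhere by testing\<close>

lemma real_eq_0_AE_if_box_integrals:
  fixes w :: "'a::euclidean_space \<Rightarrow> real"
  assumes [measurable]: "w \<in> borel_measurable borel"
    and i: "\<And>a b. integrable lborel (\<lambda>x. indicator (box a b) x * w x)"
    and z: "\<And>a b. (LINT x|lborel. indicator (box a b) x * w x) = 0"
  shows "AE x in lborel. w x = 0"
proof -
  have nn: "(\<integral>\<^sup>+x. ennreal (w x) * indicator (box a b) x \<partial>lborel) = (\<integral>\<^sup>+x. ennreal (- w x) * indicator (box a b) x \<partial>lborel)"
    "(\<integral>\<^sup>+x. ennreal (w x) * indicator (box a b) x \<partial>lborel) \<noteq> \<infinity>" for a b
  proof -
    let ?f = "\<lambda>x. indicator (box a b) x * w x"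
    have f: "integrable lborel ?f" by (rule i)
    have e: "ennreal (w x) * indicator (box a b) x = ennreal (?f x)"
      "ennreal (- w x) * indicator (box a b) x = ennreal (- ?f x)" for x
      by (auto simp: indicator_def)
    have fin: "(\<integral>\<^sup>+x. ennreal (?f x) \<partial>lborel) \<noteq> \<infinity>" "(\<integral>\<^sup>+x. ennreal (- ?f x) \<partial>lborel) \<noteq> \<infinity>"
      using f unfolding real_integrable_def by auto
    then show "(\<integral>\<^sup>+x. ennreal (w x) * indicator (box a b) x \<partial>lborel) \<noteq> \<infinity>" unfolding e by simp
    have "enn2real (\<integral>\<^sup>+x. ennreal (?f x) \<partial>lborel) = enn2real (\<integral>\<^sup>+x. ennreal (- ?f x) \<partial>lborel)"
      using real_lebesgue_integral_def[OF f] z[of a b] by simp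
    then show "(\<integral>\<^sup>+x. ennreal (w x) * indicator (box a b) x \<partial>lborel) = (\<integral>\<^sup>+x. ennreal (- w x) * indicator (box a b) x \<partial>lborel)"
      unfolding e using fin ennreal_enn2real unfolding infinity_ennreal_def top.not_eq_extremum by fastforce
  qed
  \<comment> \<open>Boxes form an intersection-stable generator of the Borel sets, so equal
    integrals over boxes identify the two measures. Their densities are the positive and the
    negative part of \<open>w\<close>, since \<open>ennreal\<close> truncates negative values to
    0.\<close>
  have "density lborel (\<lambda>x. ennreal (w x)) = density lborel (\<lambda>x. ennreal (- w x))" (is "?M = ?N")
  proof (rule measure_eqI_generator_eq)
    let ?E = "range (\<lambda>(a, b). box a b::'a set)"
    define A where "A n = (box (- (real n *\<^sub>R One)) (real n *\<^sub>R One) :: 'a set)" for n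
    show "Int_stable ?E"
      by (auto simp: Int_stable_def box_Int_box)
    show "?E \<subseteq> Pow UNIV" "sets ?M = sigma_sets UNIV ?E" "sets ?N = sigma_sets UNIV ?E"
      by (simp_all add: borel_eq_box)
    show "range A \<subseteq> ?E" "(\<Union>i. A i) = UNIV"
      unfolding A_def UN_box_eq_UNIV by auto
    show "emeasure ?M (A n) \<noteq> \<infinity>" for n
      unfolding A_def using nn(2) by (simp add: emeasure_density)
    show "emeasure ?M X = emeasure ?N X" if "X \<in> ?E" for X
      using that nn(1) by (auto simp: emeasure_density)
  qed
  then have "AE x in lborel. ennreal (w x) = ennreal (- w x)"
    by (intro sigma_finite_measure.density_unique[OF sigma_finite_lborel]) auto
  then show ?thesis
  proof eventually_elim
    case (elim x)
    show ?case
    proof (cases "w x \<ge> 0")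
      case True
      then have "ennreal (w x) = 0" using elim by (simp add: ennreal_neg)
      then show ?thesis using True by (simp add: ennreal_eq_0_iff)
    next
      case False
      then have "ennreal (- w x) = 0" using elim by (simp add: ennreal_neg)
      then show ?thesis using False by (simp add: ennreal_eq_0_iff)
    qed
  qed
qed

lemma eq_0_AE_if_Cc_integrals:
  fixes w :: "'a::euclidean_space \<Rightarrow> complex"
  assumes [measurable]: "w \<in> borel_measurable borel"
    and i: "\<And>\<psi>. Cc \<psi> \<Longrightarrow> integrable lborel (\<lambda>x. w x * \<psi> x)"
    and z: "\<And>\<psi>. Cc \<psi> \<Longrightarrow> (LINT x|lborel. w x * \<psi> x) = 0"
  shows "AE x in lborel. w x = 0"
proof -
  have box: "integrable lborel (\<lambda>x. complex_of_real (indicator (box a b) x) * w x)" (is "integrable _ ?bw")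
    "(LINT x|lborel. complex_of_real (indicator (box a b) x) * w x) = 0" for a b
  proof -
    obtain R where R: "\<And>x. x \<in> box a b \<Longrightarrow> norm x \<le> R"
      using bounded_box[of a b] unfolding bounded_iff by auto
    define \<psi> where "\<psi> x = complex_of_real (max 0 (min 1 (R + 1 - norm x)))" for x :: 'a
    have \<psi>: "Cc \<psi>"
      unfolding Cc_def
    proof
      show "continuous_on UNIV \<psi>" unfolding \<psi>_def by (intro continuous_intros)
      show "bounded {x. \<psi> x \<noteq> 0}"
        unfolding bounded_iff by (intro exI[of _ "R + 1"]) (auto simp: \<psi>_def max_def min_def split: if_splits)
    qed
    have \<psi>1: "\<psi> x = 1" if "x \<in> box a b" for x
      using R[OF that] by (simp add: \<psi>_def)
    show "integrable lborel ?bw"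
      using i[OF \<psi>] by (rule integrable_dominated) (auto simp: indicator_def \<psi>1)
    \<comment> \<open>Continuous functions supported in the box that increase to its indicator as
      \<open>n\<close> grows; \<open>\<psi>\<close> equals 1 on the box, so
      \<open>w x * \<psi> x\<close> provides a common integrable majorant.\<close>
    define \<eta> where "\<eta> n x = complex_of_real (min 1 (real n * infdist x (- box a b)))" for n x
    have ne: "- box a b \<noteq> {}"
      using bounded_box[of a b] not_bounded_UNIV[where 'a='a] by (metis Compl_empty_eq double_complement)
    have id: "infdist x (- box a b) = 0 \<longleftrightarrow> x \<notin> box a b" for x
      using in_closed_iff_infdist_zero[of "- box a b" x] ne by (auto simp: closed_Compl)
    have \<eta>0: "\<eta> n x = 0" if "x \<notin> box a b" for n x
      using that id[of x] by (simp add: \<eta>_def)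
    have \<eta>: "Cc (\<eta> n)" for n
      unfolding Cc_def
    proof
      show "continuous_on UNIV (\<eta> n)" unfolding \<eta>_def by (intro continuous_intros)
      show "bounded {x. \<eta> n x \<noteq> 0}"
        by (rule bounded_subset[OF bounded_box[of a b]]) (use \<eta>0 in auto)
    qed
    have lim: "(\<lambda>n. \<eta> n x) \<longlonglongrightarrow> complex_of_real (indicator (box a b) x)" for x
    proof (cases "x \<in> box a b")
      case True
      then have p: "infdist x (- box a b) > 0"
        using id[of x] infdist_nonneg[of x "- box a b"] by simp
      obtain N where N: "1 / infdist x (- box a b) < real N" using reals_Archimedean2 by blast
      have "eventually (\<lambda>n. \<eta> n x = 1) sequentially"
        using eventually_ge_at_top[of N]
      proof eventually_elim
        case (elim n)
        then have "1 / infdist x (- box a b) \<le> real n" using N by linarith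
        then have "1 \<le> real n * infdist x (- box a b)" using p by (simp add: divide_le_eq)
        then show ?case by (simp add: \<eta>_def)
      qed
      then show ?thesis using True by (simp add: tendsto_eventually)
    qed (simp add: \<eta>0)
    have "(\<lambda>n. LINT x|lborel. w x * \<eta> n x) \<longlonglongrightarrow> (LINT x|lborel. w x * complex_of_real (indicator (box a b) x))"
    proof (rule integral_dominated_convergence[where w="\<lambda>x. cmod (w x * \<psi> x)"])
      show "AE x in lborel. (\<lambda>n. w x * \<eta> n x) \<longlonglongrightarrow> w x * complex_of_real (indicator (box a b) x)"
        by (intro AE_I2 tendsto_intros lim)
      show "AE x in lborel. norm (w x * \<eta> n x) \<le> cmod (w x * \<psi> x)" for n
      proof (rule AE_I2)
        show "norm (w x * \<eta> n x) \<le> cmod (w x * \<psi> x)" for x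
        proof (cases "x \<in> box a b")
          case True
          then show ?thesis
            by (simp add: \<psi>1 norm_mult \<eta>_def infdist_nonneg mult_left_le)
        qed (simp add: \<eta>0)
      qed
    qed (use i[OF \<psi>] i[OF \<eta>] in auto)
    then show "(LINT x|lborel. complex_of_real (indicator (box a b) x) * w x) = 0"
      unfolding z[OF \<eta>] by (simp add: LIMSEQ_const_iff mult.commute)
  qed
  have "AE x in lborel. Re (w x) = 0"
  proof (rule real_eq_0_AE_if_box_integrals)
    show "integrable lborel (\<lambda>x. indicator (box a b) x * Re (w x))" for a b
      using integrable_Re[OF box(1)] by simp
    show "(LINT x|lborel. indicator (box a b) x * Re (w x)) = 0" for a b
      using integral_Re[OF box(1)] box(2) by simp
  qed measurable
  moreover have "AE x in lborel. Im (w x) = 0"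
  proof (rule real_eq_0_AE_if_box_integrals)
    show "integrable lborel (\<lambda>x. indicator (box a b) x * Im (w x))" for a b
      using integrable_Im[OF box(1)] by simp
    show "(LINT x|lborel. indicator (box a b) x * Im (w x)) = 0" for a b
      using integral_Im[OF box(1)] box(2) by simp
  qed measurable
  ultimately show ?thesis
    by eventually_elim (simp add: complex_eq_iff)
qed

text \<open>Every continuous \<open>\<psi>\<close> of bounded support is the transform of its own
  inverse transform, so the multiplication formula expresses the pairing of \<open>f\<close> with
  \<open>\<psi>\<close> through \<open>g\<close> alone.\<close>

lemma has_L2_fourier_unique:
  fixes f g :: "'a::euclidean_space \<Rightarrow> complex"
  assumes "has_L2_fourier f g" "has_L2_fourier f' g"
  shows "AE x in lborel. f x = f' x"
proof -
  have s: "square_integrable f" "square_integrable f'"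
    using assms by (auto simp: has_L2_fourier_def)
  note [measurable] = square_integrable_measurable[OF s(1)] square_integrable_measurable[OF s(2)]
  have "AE x in lborel. f x - f' x = 0"
  proof (rule eq_0_AE_if_Cc_integrals)
    fix \<psi> :: "'a \<Rightarrow> complex" assume \<psi>: "Cc \<psi>"
    then have \<psi>s: "square_integrable \<psi>" and b: "bcL1 \<psi>"
      using CcD(6) square_integrable_bcL1 by auto
    show "integrable lborel (\<lambda>x. (f x - f' x) * \<psi> x)"
      by (intro integrable_times_square_integrable square_integrable_diff s \<psi>s)
    show "(LINT x|lborel. (f x - f' x) * \<psi> x) = 0"
      using has_L2_fourier_multiplication_formula[OF assms(1) has_L2_fourier_inverse[OF b]]
        has_L2_fourier_multiplication_formula[OF assms(2) has_L2_fourier_inverse[OF b]]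
        integrable_times_square_integrable[OF s(1) \<psi>s] integrable_times_square_integrable[OF s(2) \<psi>s]
      by (simp add: left_diff_distrib)
  qed measurable
  then show ?thesis by simp
qed

lemma has_L2_fourier_inv_fourier:
  "has_L2_fourier f g \<Longrightarrow> has_L2_fourier (inv_fourier g) g"
  unfolding inv_fourier_def by (rule someI[of "\<lambda>f. has_L2_fourier f g"])

lemma continuous_eq_0_if_AE:
  fixes d :: "'a::euclidean_space \<Rightarrow> complex"
  assumes "continuous_on UNIV d" "AE x in lborel. d x = 0"
  shows "d x = 0"
proof -
  have "closed {x. d x = 0}"
    using assms(1) by (intro closed_Collect_eq continuous_intros)
  moreover have "AE x in lebesgue. x \<in> {x. d x = 0}"
    using assms(2) by (auto intro: AE_completion)
  ultimately have "x \<in> {x. d x = 0}"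
    by (rule mem_closed_if_AE_lebesgue)
  then show ?thesis by simp
qed

text \<open>Reconciles the L2 transform with the Fourier integral. Testing gives equality almost
  everywhere, and since both sides are continuous it holds at every point; this permits evaluation
  on the null set where the first group of frequencies vanishes.\<close>

lemma has_L2_fourier_eq_fourier:
  fixes f g :: "'a::euclidean_space \<Rightarrow> complex"
  assumes fg: "has_L2_fourier f g" and f: "integrable lborel f" and g: "continuous_on UNIV g"
  shows "fourier f \<xi> = g \<xi>"
proof -
  have s: "square_integrable g"
    using fg by (auto simp: has_L2_fourier_def)
  note [measurable] = square_integrable_measurable[OF s] borel_measurable_fourier[OF f]
  have "AE x in lborel. fourier f x - g x = 0"
  proof (rule eq_0_AE_if_Cc_integrals)
    fix \<psi> :: "'a \<Rightarrow> complex" assume \<psi>: "Cc \<psi>"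
    then have \<psi>s: "square_integrable \<psi>" and b: "bcL1 \<psi>"
      using CcD(6) square_integrable_bcL1 by auto
    have i: "integrable lborel (\<lambda>x. fourier f x * \<psi> x)" "integrable lborel (\<lambda>x. g x * \<psi> x)"
      using integrable_bounded_times(1)[OF cmod_fourier_le borel_measurable_fourier[OF f] CcD(4)[OF \<psi>]]
        integrable_times_square_integrable[OF s \<psi>s] by auto
    then show "integrable lborel (\<lambda>x. (fourier f x - g x) * \<psi> x)"
      by (simp add: left_diff_distrib)
    show "(LINT x|lborel. (fourier f x - g x) * \<psi> x) = 0"
      using has_L2_fourier_multiplication_formula[OF fg has_L2_fourier_bcL1[OF b]]
        fourier_multiplication_formula[OF f CcD(4)[OF \<psi>]] i
      by (simp add: left_diff_distrib)
  qed measurable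
  then have "fourier f \<xi> - g \<xi> = 0"
    using continuous_fourier[OF f] g by (intro continuous_eq_0_if_AE[of "\<lambda>x. fourier f x - g x"] continuous_intros)
  then show ?thesis by simp
qed

text \<open>The graph of the L2 transform is closed: each pair is itself a limit of integrable
  functions, so a diagonal choice with errors at most 1/(n+1) in both squared norms approximates the
  limit pair.\<close>

lemma has_L2_fourier_limit:
  assumes vg: "\<And>n. has_L2_fourier (v n) (g n)" and v: "L2_tendsto v V" and g: "L2_tendsto g G"
    and V: "square_integrable V" and G: "square_integrable G"
  shows "has_L2_fourier V G"
proof -
  define P where "P n \<phi> \<longleftrightarrow> integrable lborel \<phi> \<and> square_integrable \<phi> \<and>
      nn2 (\<lambda>x. \<phi> x - v n x) \<le> ennreal (inverse (real (Suc n))) \<and>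
      nn2 (\<lambda>x. fourier \<phi> x - g n x) \<le> ennreal (inverse (real (Suc n)))" for n \<phi>
  have "\<exists>\<phi>. P n \<phi>" for n
  proof -
    obtain \<phi> where \<phi>: "\<And>k. integrable lborel (\<phi> k)" "\<And>k. square_integrable (\<phi> k)"
       "L2_tendsto \<phi> (v n)" "L2_tendsto (\<lambda>k. fourier (\<phi> k)) (g n)"
      using vg[of n] unfolding has_L2_fourier_def by blast
    have "eventually (\<lambda>k. nn2 (\<lambda>x. \<phi> k x - v n x) < ennreal (inverse (real (Suc n))) \<and>
       nn2 (\<lambda>x. fourier (\<phi> k) x - g n x) < ennreal (inverse (real (Suc n)))) sequentially"
      using \<phi>(3,4) unfolding L2_tendsto_def
      by (intro eventually_conj order_tendstoD(2)) auto
    then obtain k where "nn2 (\<lambda>x. \<phi> k x - v n x) < ennreal (inverse (real (Suc n)))"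
       "nn2 (\<lambda>x. fourier (\<phi> k) x - g n x) < ennreal (inverse (real (Suc n)))"
      using eventually_happens'[OF sequentially_bot] by blast
    then show ?thesis unfolding P_def using \<phi>(1,2) less_imp_le by blast
  qed
  then have "\<exists>\<phi>. \<forall>n. P n (\<phi> n)" by (intro choice allI)
  then obtain \<phi> where \<phi>': "\<forall>n. P n (\<phi> n)" by (rule exE)
  have \<phi>: "\<And>n. integrable lborel (\<phi> n)" "\<And>n. square_integrable (\<phi> n)"
      "\<And>n. nn2 (\<lambda>x. \<phi> n x - v n x) \<le> ennreal (inverse (real (Suc n)))"
      "\<And>n. nn2 (\<lambda>x. fourier (\<phi> n) x - g n x) \<le> ennreal (inverse (real (Suc n)))"
    using \<phi>' unfolding P_def by blast+
  have m: "v n \<in> borel_measurable borel" "g n \<in> borel_measurable borel" "\<phi> n \<in> borel_measurable borel"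
    "fourier (\<phi> n) \<in> borel_measurable borel" "V \<in> borel_measurable borel" "G \<in> borel_measurable borel" for n
    using vg[of n] borel_measurable_integrable[OF \<phi>(1)] borel_measurable_fourier[OF \<phi>(1)] V G
    by (auto simp: has_L2_fourier_def square_integrable_measurable)
  have lim0: "(\<lambda>n. 2 * ennreal (inverse (real (Suc n))) + 2 * b n) \<longlonglongrightarrow> 0" if "b \<longlonglongrightarrow> 0" for b
  proof -
    have "(\<lambda>n. 2 * ennreal (inverse (real (Suc n))) + 2 * b n) \<longlonglongrightarrow> 2 * ennreal 0 + 2 * 0"
      by (intro tendsto_add tendsto_mult_ennreal tendsto_const tendsto_ennrealI LIMSEQ_inverse_real_of_nat that) auto
    then show ?thesis by simp
  qed
  have "nn2 (\<lambda>x. \<phi> n x - V x) \<le> 2 * ennreal (inverse (real (Suc n))) + 2 * nn2 (\<lambda>x. v n x - V x)" for n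
    by (rule order_trans[OF nn2_diff_trans[OF m(3,1,5)]], rule add_mono[OF mult_left_mono[OF \<phi>(3)]]) simp_all
  then have "L2_tendsto \<phi> V"
    unfolding L2_tendsto_def
    by (intro tendsto_sandwich[OF _ _ tendsto_const lim0[OF v[unfolded L2_tendsto_def]]] always_eventually allI zero_le)
  moreover have "nn2 (\<lambda>x. fourier (\<phi> n) x - G x) \<le> 2 * ennreal (inverse (real (Suc n))) + 2 * nn2 (\<lambda>x. g n x - G x)" for n
    by (rule order_trans[OF nn2_diff_trans[OF m(4,2,6)]], rule add_mono[OF mult_left_mono[OF \<phi>(4)]]) simp_all
  then have "L2_tendsto (\<lambda>n. fourier (\<phi> n)) G"
    unfolding L2_tendsto_def
    by (intro tendsto_sandwich[OF _ _ tendsto_const lim0[OF g[unfolded L2_tendsto_def]]] always_eventually allI zero_le)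
  ultimately show ?thesis
    using V G \<phi>(1,2) unfolding has_L2_fourier_def by blast
qed

section \<open>Integrable multipliers\<close>

text \<open>The algebra of Fourier transforms of integrable functions, with a bound for its norm.
  The bound is carried explicitly because it becomes part of the final constant.\<close>

definition wiener :: "('a::euclidean_space \<Rightarrow> complex) \<Rightarrow> real \<Rightarrow> bool" where
  "wiener g C \<longleftrightarrow> (\<exists>\<kappa>. integrable lborel \<kappa> \<and> (LINT x|lborel. cmod (\<kappa> x)) \<le> C \<and> fourier \<kappa> = g)"

lemma wiener_nonneg: "wiener g C \<Longrightarrow> 0 \<le> C"
  unfolding wiener_def by (auto intro: order_trans[rotated])

lemma wiener_mult:
  assumes "wiener g C" "wiener h D"
  shows "\<exists>E. wiener (\<lambda>\<xi>. g \<xi> * h \<xi>) E"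
proof -
  obtain \<kappa> \<nu> where *: "integrable lborel \<kappa>" "fourier \<kappa> = g" "integrable lborel \<nu>" "fourier \<nu> = h"
    using assms unfolding wiener_def by blast
  have "fourier (conv \<kappa> \<nu>) = (\<lambda>\<xi>. g \<xi> * h \<xi>)"
    using * by (auto simp: fourier_conv)
  then show ?thesis
    using integrable_conv[OF *(1,3)] unfolding wiener_def by blast
qed

lemma wiener_diff:
  assumes "wiener g C" "wiener h D"
  shows "\<exists>E. wiener (\<lambda>\<xi>. g \<xi> - h \<xi>) E"
proof -
  obtain \<kappa> \<nu> where *: "integrable lborel \<kappa>" "fourier \<kappa> = g" "integrable lborel \<nu>" "fourier \<nu> = h"
    using assms unfolding wiener_def by blast
  have "fourier (\<lambda>x. \<kappa> x - \<nu> x) = (\<lambda>\<xi>. g \<xi> - h \<xi>)"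
    using * by (auto simp: fourier_diff)
  then show ?thesis
    using * unfolding wiener_def by (intro exI[of _ "LINT x|lborel. cmod (\<kappa> x - \<nu> x)"] exI[of _ "\<lambda>x. \<kappa> x - \<nu> x"]) auto
qed

lemma wiener_power_mult:
  assumes "wiener g C" "wiener h D"
  shows "\<exists>E. wiener (\<lambda>\<xi>. g \<xi> ^ s * h \<xi>) E"
proof (induction s)
  case (Suc s)
  then obtain E where "wiener (\<lambda>\<xi>. g \<xi> ^ s * h \<xi>) E" by blast
  from wiener_mult[OF assms(1) this] show ?case by (simp add: mult.assoc)
qed (use assms in auto)

text \<open>Multiplication by \<open>g\<close> corresponds to averaging translates of
  \<open>fourier h\<close> against \<open>\<kappa>\<close>. Only the L1 norm of
  \<open>\<kappa>\<close> enters, so a supremum bound for \<open>fourier h\<close> is passed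
  on.\<close>

lemma wiener_bound:
  assumes g: "wiener g C" and h: "integrable lborel h" and B: "\<And>x. cmod (fourier h x) \<le> B"
  shows "cmod (fourier (\<lambda>\<xi>. g \<xi> * h \<xi>) x) \<le> C * B"
proof -
  obtain \<kappa> where \<kappa>: "integrable lborel \<kappa>" "(LINT x|lborel. cmod (\<kappa> x)) \<le> C" "fourier \<kappa> = g"
    using g unfolding wiener_def by blast
  let ?h = "\<lambda>\<xi>. exp (\<i> * complex_of_real ((- x) \<bullet> \<xi>)) * h \<xi>"
  have hi: "integrable lborel ?h"
    using integrable_fourier_kernel[OF h, of x] by (simp add: inner_commute[of x])
  have "fourier (\<lambda>\<xi>. g \<xi> * h \<xi>) x = (LINT \<xi>|lborel. fourier \<kappa> \<xi> * ?h \<xi>)"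
    unfolding \<kappa>(3) fourier_def[of _ x]
    by (intro LINT_cong) (auto simp: inner_commute[of x])
  also have "\<dots> = (LINT y|lborel. \<kappa> y * fourier h (y - (- x)))"
    unfolding fourier_multiplication_formula[OF \<kappa>(1) hi] fourier_modulate ..
  also have "cmod \<dots> \<le> (LINT y|lborel. cmod (\<kappa> y) * B)"
  proof (rule norm_LINT_le)
    show "integrable lborel (\<lambda>y. \<kappa> y * fourier h (y - (- x)))"
      using B borel_measurable_fourier[OF h] by (intro integrable_bounded_times(2)[OF _ _ \<kappa>(1)]) auto
  qed (use \<kappa>(1) B in \<open>auto simp: norm_mult intro!: mult_left_mono\<close>)
  also have "\<dots> = (LINT y|lborel. cmod (\<kappa> y)) * B" by simp
  also have "\<dots> \<le> C * B"
    using \<kappa>(2) order_trans[OF norm_ge_zero B[of 0]] by (rule mult_right_mono)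
  finally show ?thesis .
qed

text \<open>Inversion applies because \<open>conv p q\<close> is again continuous of bounded
  support; the factor \<open>1/c\<close> and the reflection in \<open>\<kappa>\<close> turn the
  forward integral into the inverse one.\<close>

lemma wiener_conv:
  fixes p q :: "'a::euclidean_space \<Rightarrow> complex"
  assumes p: "Cc p" and q: "Cc q"
  shows "\<exists>C. wiener (conv p q) C"
proof -
  define c where "c = complex_of_real ((2 * pi) ^ DIM('a))"
  have c0: "c \<noteq> 0" by (simp add: c_def)
  define G where "G \<xi> = fourier p \<xi> * fourier q \<xi>" for \<xi>
  have G: "fourier (conv p q) = G"
    unfolding G_def by (auto simp: fourier_conv CcD(4)[OF p] CcD(4)[OF q])
  have Gi: "integrable lborel G"
    unfolding G_def
    by (intro integrable_times_square_integrable square_integrable_fourier CcD(6) p q)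
  note [measurable] = borel_measurable_integrable[OF Gi]
  define \<kappa> where "\<kappa> x = (1/c) * G (- x)" for x
  have "integrable lborel \<kappa>"
    unfolding \<kappa>_def using integrable_lborel_minus[of G] Gi by simp
  moreover have "fourier \<kappa> \<xi> = conv p q \<xi>" for \<xi>
  proof -
    have "fourier \<kappa> \<xi> = (1/c) * fourier G (- \<xi>)"
      unfolding \<kappa>_def by (simp only: fourier_cmult) (simp add: fourier_minus_arg)
    also have "fourier G (- \<xi>) = c * conv p q \<xi>"
      using fourier_inversion[of "conv p q" \<xi>] Cc_conv[OF p q] CcD(6) Gi unfolding G c_def by blast
    finally show ?thesis using c0 by simp
  qed
  ultimately show ?thesis
    unfolding wiener_def by (intro exI[of _ "LINT x|lborel. cmod (\<kappa> x)"] exI[of _ \<kappa>]) auto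
qed

section \<open>Diagonal maps\<close>

definition diagmap :: "('a::euclidean_space \<Rightarrow> real) \<Rightarrow> 'a \<Rightarrow> 'a" where
  "diagmap c x = (\<Sum>b\<in>Basis. (c b * (x \<bullet> b)) *\<^sub>R b)"

lemma diagmap_inner [simp]: "b \<in> Basis \<Longrightarrow> diagmap c x \<bullet> b = c b * (x \<bullet> b)"
  by (simp add: diagmap_def inner_sum_left inner_Basis if_distrib sum.delta cong: if_cong)

lemma diagmap_inner_commute: "diagmap c x \<bullet> y = x \<bullet> diagmap c y"
  by (subst (1 2) euclidean_inner) (simp add: mult_ac)

lemma diagmap_diagmap: "diagmap c (diagmap d x) = diagmap (\<lambda>b. c b * d b) x"
  by (rule euclidean_eqI) simp

lemma diagmap_id: "(\<And>b. b \<in> Basis \<Longrightarrow> c b = 1) \<Longrightarrow> diagmap c x = x"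
  by (rule euclidean_eqI) simp

lemma continuous_diagmap: "continuous_on UNIV (diagmap c)"
  unfolding diagmap_def by (intro continuous_intros)

lemma borel_measurable_diagmap [measurable]: "diagmap c \<in> borel_measurable borel"
  by (intro borel_measurable_continuous_onI continuous_diagmap)

lemma
  fixes c :: "'a::euclidean_space \<Rightarrow> real" and f :: "'a \<Rightarrow> 'b::{banach,second_countable_topology}"
  assumes c: "\<And>b. b \<in> Basis \<Longrightarrow> c b > 0"
  shows nn_integral_diagmap: "g \<in> borel_measurable borel \<Longrightarrow>
      (\<integral>\<^sup>+x. g x \<partial>lborel) = ennreal (\<Prod>b\<in>Basis. c b) * (\<integral>\<^sup>+x. g (diagmap c x) \<partial>lborel)"
    and integrable_diagmap: "f \<in> borel_measurable borel \<Longrightarrow>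
      integrable lborel (\<lambda>x. f (diagmap c x)) \<longleftrightarrow> integrable lborel f"
    and integral_diagmap: "f \<in> borel_measurable borel \<Longrightarrow>
      (\<integral>x. f x \<partial>lborel) = (\<Prod>b\<in>Basis. c b) *\<^sub>R (\<integral>x. f (diagmap c x) \<partial>lborel)"
proof -
  have "lborel = density (distr lborel borel (diagmap c)) (\<lambda>_. (\<Prod>j\<in>Basis. \<bar>c j\<bar>))"
    unfolding diagmap_def[abs_def] using lborel_affine_euclidean[of c 0] c by fastforce
  also have "(\<Prod>j\<in>Basis. \<bar>c j\<bar>) = (\<Prod>j\<in>Basis. c j)"
    using c by (intro prod.cong) (auto simp: less_imp_le)
  finally have *: "lborel = density (distr lborel borel (diagmap c)) (\<lambda>_. ennreal (\<Prod>j\<in>Basis. c j))" .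
  have p: "(\<Prod>b\<in>Basis. c b) > 0" using c by (intro prod_pos) auto
  note t = lborel_transfer[OF borel_measurable_diagmap p *]
  show "g \<in> borel_measurable borel \<Longrightarrow>
      (\<integral>\<^sup>+x. g x \<partial>lborel) = ennreal (\<Prod>b\<in>Basis. c b) * (\<integral>\<^sup>+x. g (diagmap c x) \<partial>lborel)"
   "f \<in> borel_measurable borel \<Longrightarrow>
      integrable lborel (\<lambda>x. f (diagmap c x)) \<longleftrightarrow> integrable lborel f"
   "f \<in> borel_measurable borel \<Longrightarrow>
      (\<integral>x. f x \<partial>lborel) = (\<Prod>b\<in>Basis. c b) *\<^sub>R (\<integral>x. f (diagmap c x) \<partial>lborel)"
    by (rule t; assumption)+
qed

text \<open>The kernel is dilated by the inverse map and multiplied by its Jacobian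
  \<open>P\<close>, which leaves the L1 norm unchanged. The bound \<open>C\<close> therefore
  survives every dilation, and estimates become uniform in the frequency scale.\<close>

lemma wiener_diagmap:
  fixes g :: "'a::euclidean_space \<Rightarrow> complex"
  assumes g: "wiener g C" and c: "\<And>b. b \<in> Basis \<Longrightarrow> c b > 0"
  shows "wiener (\<lambda>\<xi>. g (diagmap c \<xi>)) C"
proof -
  obtain \<kappa> where \<kappa>: "integrable lborel \<kappa>" "(LINT x|lborel. cmod (\<kappa> x)) \<le> C" "fourier \<kappa> = g"
    using g unfolding wiener_def by blast
  note [measurable] = borel_measurable_integrable[OF \<kappa>(1)]
  define d where "d b = 1 / c b" for b
  define P where "P = (\<Prod>b\<in>Basis. d b)"
  have d: "d b > 0" if "b \<in> Basis" for b using c[OF that] by (simp add: d_def)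
  have P: "P > 0" unfolding P_def using d by (intro prod_pos) auto
  have cd: "diagmap c (diagmap d x) = x" for x
    unfolding diagmap_diagmap using c by (intro diagmap_id) (auto simp: d_def less_imp_neq[symmetric])
  define \<nu> where "\<nu> x = complex_of_real P * \<kappa> (diagmap d x)" for x
  have i: "integrable lborel \<nu>"
    unfolding \<nu>_def using \<kappa>(1) by (intro integrable_mult_right) (subst integrable_diagmap[OF d], auto)
  have "(LINT x|lborel. cmod (\<kappa> x)) = P * (LINT x|lborel. cmod (\<kappa> (diagmap d x)))"
    unfolding P_def by (subst integral_diagmap[OF d, where f="\<lambda>x. cmod (\<kappa> x)"]) auto
  then have "(LINT x|lborel. cmod (\<nu> x)) \<le> C"
    using \<kappa>(2) P by (simp add: \<nu>_def norm_mult)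
  moreover have "fourier \<nu> \<xi> = g (diagmap c \<xi>)" for \<xi>
  proof -
    let ?f = "\<lambda>x. exp (- \<i> * of_real (x \<bullet> diagmap c \<xi>)) * \<kappa> x"
    have "g (diagmap c \<xi>) = (LINT x|lborel. ?f x)"
      unfolding \<kappa>(3)[symmetric] fourier_def ..
    also have "\<dots> = P *\<^sub>R (LINT x|lborel. ?f (diagmap d x))"
      unfolding P_def by (rule integral_diagmap[OF d]) auto
    also have "\<dots> = (LINT x|lborel. P *\<^sub>R ?f (diagmap d x))" by simp
    also have "\<dots> = fourier \<nu> \<xi>"
      unfolding fourier_def \<nu>_def diagmap_inner_commute[of c, symmetric] cd
      by (intro LINT_cong) (auto simp: scaleR_conv_of_real mult_ac)
    finally show ?thesis ..
  qed
  ultimately show ?thesis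
    unfolding wiener_def using i by (intro exI[of _ \<nu>]) auto
qed

section \<open>Anisotropic dilations and a smooth resolution of the identity\<close>

text \<open>The exponents of all coordinates are gathered in one function on \<open>Basis\<close>:
  apart from the cancellation argument the two groups of variables are treated alike.\<close>

locale aniso =
  fixes a :: "'a::euclidean_space \<Rightarrow> real"
  assumes a_pos: "b \<in> Basis \<Longrightarrow> a b > 0"
begin

definition rho :: "'a \<Rightarrow> real" where
  "rho x = (\<Sum>b\<in>Basis. \<bar>x \<bullet> b\<bar> powr a b)"

definition adil :: "int \<Rightarrow> 'a \<Rightarrow> 'a" where
  "adil j = diagmap (\<lambda>b. 2 powr (of_int j / a b))"

lemma adil_inner: "b \<in> Basis \<Longrightarrow> adil j x \<bullet> b = 2 powr (of_int j / a b) * (x \<bullet> b)"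
  by (simp add: adil_def)

lemma adil_adil: "adil i (adil j x) = adil (i + j) x"
  by (simp add: adil_def diagmap_diagmap add_divide_distrib powr_add)

lemma adil_0: "adil 0 x = x"
  unfolding adil_def by (rule diagmap_id) simp

lemma continuous_adil: "continuous_on UNIV (adil j)"
  unfolding adil_def by (rule continuous_diagmap)

lemma rho_adil: "rho (adil j x) = 2 powr of_int j * rho x"
proof -
  have "\<bar>adil j x \<bullet> b\<bar> powr a b = 2 powr of_int j * \<bar>x \<bullet> b\<bar> powr a b" if "b \<in> Basis" for b
    using a_pos[OF that] that by (simp add: adil_inner abs_mult powr_mult powr_powr)
  then show ?thesis
    by (simp add: rho_def sum_distrib_left)
qed

lemma rho_nonneg: "rho x \<ge> 0"
  unfolding rho_def by (intro sum_nonneg) auto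

lemma rho_0 [simp]: "rho 0 = 0"
  by (simp add: rho_def)

lemma rho_eq_0_iff: "rho x = 0 \<longleftrightarrow> x = 0"
  unfolding rho_def by (subst sum_nonneg_eq_0_iff) (auto simp: euclidean_eq_iff[of x 0])

lemma continuous_rho: "continuous_on UNIV rho"
  unfolding rho_def
  by (intro continuous_on_sum continuous_on_powr' continuous_intros) (auto dest: a_pos)

lemma abs_inner_le_rho:
  assumes "rho x \<le> r" "b \<in> Basis"
  shows "\<bar>x \<bullet> b\<bar> \<le> r powr (1 / a b)"
proof -
  have "\<bar>x \<bullet> b\<bar> powr a b \<le> rho x"
    unfolding rho_def using assms(2) by (intro member_le_sum) auto
  then have "(\<bar>x \<bullet> b\<bar> powr a b) powr (1 / a b) \<le> r powr (1 / a b)"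
    using assms a_pos[OF assms(2)] by (intro powr_mono2) auto
  then show ?thesis
    using a_pos[OF assms(2)] by (simp add: powr_powr)
qed

lemma bounded_rho_le: "bounded {x. rho x \<le> r}"
  unfolding bounded_iff
proof (intro exI ballI)
  fix x assume "x \<in> {x. rho x \<le> r}"
  then show "norm x \<le> (\<Sum>b\<in>Basis. r powr (1 / a b))"
    using abs_inner_le_rho by (intro order_trans[OF norm_le_l1] sum_mono) auto
qed

text \<open>A modulus of continuity of \<open>rho\<close> on a bounded sublevel set. It tells how
  small the support of a mollifier must be for a convolution to keep prescribed values on sets
  described by \<open>rho\<close>.\<close>

lemma rho_margin:
  assumes "e > 0"
  obtains \<delta> where "\<delta> > 0" "\<And>x z. rho x \<le> R \<Longrightarrow> norm z \<le> \<delta> \<Longrightarrow> \<bar>rho (x - z) - rho x\<bar> < e"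
proof -
  obtain r where r: "\<And>x. rho x \<le> R \<Longrightarrow> norm x \<le> r"
    using bounded_rho_le[of R] unfolding bounded_iff by auto
  have "uniformly_continuous_on (cball 0 (r + 1)) rho"
    by (intro compact_uniformly_continuous continuous_on_subset[OF continuous_rho]) auto
  then obtain d where d: "d > 0" "\<And>x y. norm x \<le> r + 1 \<Longrightarrow> norm y \<le> r + 1 \<Longrightarrow> dist x y < d \<Longrightarrow> dist (rho x) (rho y) < e"
    using assms unfolding uniformly_continuous_on_def by (auto simp: dist_norm)
  show thesis
  proof (rule that[of "min (d/2) 1"])
    fix x z :: 'a assume "rho x \<le> R" "norm z \<le> min (d/2) 1"
    then have "dist (rho (x - z)) (rho x) < e"
      using r[of x] norm_triangle_ineq4[of x z] d(1) by (intro d(2)) (auto simp: dist_norm)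
    then show "\<bar>rho (x - z) - rho x\<bar> < e" by (simp add: dist_real_def)
  qed (use d in auto)
qed

end

text \<open>A normalised tent function. Evenness is recorded because it makes the first moments
  vanish, so that convolution with \<open>q\<close> reproduces linear functions.\<close>

lemma Cc_bump:
  assumes "\<delta> > 0"
  obtains q :: "'a::euclidean_space \<Rightarrow> complex" where "Cc q" "\<And>x. norm x > \<delta> \<Longrightarrow> q x = 0"
    "\<And>x. q (- x) = q x" "(LINT x|lborel. q x) = 1"
proof -
  define f where "f x = max 0 (\<delta> - norm x)" for x :: 'a
  have f: "Cc (\<lambda>x. complex_of_real (f x))"
    unfolding Cc_def
  proof
    show "continuous_on UNIV (\<lambda>x. complex_of_real (f x))" unfolding f_def by (intro continuous_intros)
    show "bounded {x. complex_of_real (f x) \<noteq> 0}"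
      unfolding bounded_iff by (intro exI[of _ \<delta>]) (auto simp: f_def max_def split: if_splits)
  qed
  have fi: "integrable lborel f"
    using CcD(4)[OF f] by (simp add: complex_of_real_integrable_eq)
  define I where "I = (LINT x|lborel. f x)"
  have "I \<noteq> 0"
  proof
    assume "I = 0"
    then have "AE x in lborel. f x = 0"
      unfolding I_def using fi by (subst (asm) integral_nonneg_eq_0_iff_AE) (auto simp: f_def)
    then have "AE x in lborel. complex_of_real (f x) = 0" by simp
    then have "complex_of_real (f 0) = 0"
      by (rule continuous_eq_0_if_AE[OF CcD(1)[OF f]])
    then show False using assms by (simp add: f_def)
  qed
  show thesis
  proof (rule that[of "\<lambda>x. complex_of_real (f x) * of_real (1 / I)"])
    show "Cc (\<lambda>x. complex_of_real (f x) * of_real (1 / I))"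
      using f \<open>I \<noteq> 0\<close> unfolding Cc_def by (auto intro!: continuous_intros)
    have "(LINT x|lborel. complex_of_real (f x) * of_real (1 / I)) = of_real I * of_real (1 / I)"
      unfolding I_def integral_complex_of_real[symmetric] by (rule integral_mult_left_zero)
    also have "\<dots> = 1" using \<open>I \<noteq> 0\<close> by (simp flip: of_real_mult)
    finally show "(LINT x|lborel. complex_of_real (f x) * of_real (1 / I)) = 1" .
  qed (auto simp: f_def)
qed

context aniso
begin

lemma Cc_rho_cutoff:
  assumes "continuous_on UNIV h" "r < s"
  shows "Cc (\<lambda>x. h x * complex_of_real (max 0 (min 1 ((s - rho x) / (s - r)))))"
  unfolding Cc_def
proof
  show "continuous_on UNIV (\<lambda>x. h x * complex_of_real (max 0 (min 1 ((s - rho x) / (s - r)))))"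
    using assms by (intro continuous_intros continuous_rho) auto
  have "rho x \<le> s" if "max 0 (min 1 ((s - rho x) / (s - r))) \<noteq> 0" for x
    using that assms(2) by (auto simp: max_def min_def divide_le_0_iff zero_le_divide_iff split: if_splits)
  then show "bounded {x. h x * complex_of_real (max 0 (min 1 ((s - rho x) / (s - r)))) \<noteq> 0}"
    by (intro bounded_subset[OF bounded_rho_le[of s]]) auto
qed

lemma exists_low_pass:
  obtains \<eta> C where "wiener \<eta> C" "Cc \<eta>" "\<And>\<xi>. rho \<xi> \<le> 1/2 \<Longrightarrow> \<eta> \<xi> = 1" "\<And>\<xi>. rho \<xi> \<ge> 1 \<Longrightarrow> \<eta> \<xi> = 0"
proof -
  obtain \<delta> where \<delta>: "\<delta> > 0" "\<And>x z. rho x \<le> 1 \<Longrightarrow> norm z \<le> \<delta> \<Longrightarrow> \<bar>rho (x - z) - rho x\<bar> < 1/8"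
    using rho_margin[of "1/8" 1] by auto
  obtain q :: "'a \<Rightarrow> complex" where q: "Cc q" "\<And>x. norm x > \<delta> \<Longrightarrow> q x = 0" "(LINT x|lborel. q x) = 1"
    by (rule Cc_bump[OF \<delta>(1)]) blast
  \<comment> \<open>The plateau of \<open>p\<close> ends at 5/8 and its support at 7/8. Shifts in
    the support of \<open>q\<close> change \<open>rho\<close> by less than 1/8, so the convolution
    is 1 up to 1/2 and 0 from 1 on.\<close>
  define p where "p x = 1 * complex_of_real (max 0 (min 1 ((7/8 - rho x) / (7/8 - 5/8))))" for x
  have p: "Cc p" unfolding p_def by (rule Cc_rho_cutoff) auto
  have p1: "p x = 1" if "rho x \<le> 5/8" for x using that by (simp add: p_def)
  have p0: "p x = 0" if "rho x \<ge> 7/8" for x using that by (simp add: p_def)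
  obtain C where C: "wiener (conv q p) C" using wiener_conv[OF q(1) p] by blast
  show thesis
  proof (rule that[OF C Cc_conv[OF q(1) p]])
    fix \<xi> assume \<xi>: "rho \<xi> \<le> 1/2"
    have "q y * p (\<xi> - y) = q y" for y
    proof (cases "norm y \<le> \<delta>")
      case True
      then have "\<bar>rho (\<xi> - y) - rho \<xi>\<bar> < 1/8" using \<xi> by (intro \<delta>(2)) auto
      then have "rho (\<xi> - y) \<le> 5/8" using \<xi> by linarith
      then show ?thesis by (simp add: p1)
    qed (simp add: q(2))
    then show "conv q p \<xi> = 1" unfolding conv_def by (simp only: q(3))
  next
    fix \<xi> assume \<xi>: "rho \<xi> \<ge> 1"
    have "q y * p (\<xi> - y) = 0" for y
    proof (cases "norm y \<le> \<delta>")
      case True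
      \<comment> \<open>The margin is available only around points of a bounded sublevel set, so it
        is applied at \<open>\<xi> - y\<close>, shifted by \<open>- y\<close>, rather than at
        \<open>\<xi>\<close>.\<close>
      have "rho (\<xi> - y) \<ge> 7/8"
      proof (rule ccontr)
        assume "\<not> rho (\<xi> - y) \<ge> 7/8"
        then have "\<bar>rho (\<xi> - y - (- y)) - rho (\<xi> - y)\<bar> < 1/8" using True by (intro \<delta>(2)) auto
        then have "\<bar>rho \<xi> - rho (\<xi> - y)\<bar> < 1/8" by simp
        with \<open>\<not> rho (\<xi> - y) \<ge> 7/8\<close> show False using \<xi> by linarith
      qed
      then show ?thesis by (simp add: p0)
    qed (simp add: q(2))
    then show "conv q p \<xi> = 0" unfolding conv_def by (simp only: integral_zero)
  qed
qed

text \<open>A coordinate is unbounded and so not the transform of an integrable function, but only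
  its values on a bounded set matter. Convolving a truncation with an even bump of integral one
  leaves a linear function unchanged wherever the truncation is inactive.\<close>

lemma exists_coordinate_multiplier:
  assumes b: "b \<in> Basis"
  obtains g C where "wiener g C" "\<And>\<xi>. rho \<xi> \<le> 2 \<Longrightarrow> g \<xi> = of_real (\<xi> \<bullet> b)"
proof -
  obtain \<delta> where \<delta>: "\<delta> > 0" "\<And>x z. rho x \<le> 2 \<Longrightarrow> norm z \<le> \<delta> \<Longrightarrow> \<bar>rho (x - z) - rho x\<bar> < 1"
    using rho_margin[of 1 2] by auto
  obtain q :: "'a \<Rightarrow> complex" where q: "Cc q" "\<And>x. norm x > \<delta> \<Longrightarrow> q x = 0" "\<And>x. q (- x) = q x" "(LINT x|lborel. q x) = 1"
    by (rule Cc_bump[OF \<delta>(1)]) blast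
  define p where "p x = complex_of_real (x \<bullet> b) * complex_of_real (max 0 (min 1 ((4 - rho x) / (4 - 3))))" for x
  have p: "Cc p" unfolding p_def by (rule Cc_rho_cutoff) (auto intro!: continuous_intros)
  have p1: "p x = of_real (x \<bullet> b)" if "rho x \<le> 3" for x using that by (simp add: p_def)
  obtain C where C: "wiener (conv q p) C" using wiener_conv[OF q(1) p] by blast
  have "Cc (\<lambda>y. q y * of_real (y \<bullet> b))"
    using q(1) unfolding Cc_def by (auto intro!: continuous_intros elim!: bounded_subset)
  then have i: "integrable lborel (\<lambda>y. q y * of_real (y \<bullet> b))" and
    m: "(\<lambda>y. q y * complex_of_real (y \<bullet> b)) \<in> borel_measurable borel"
    by (auto dest: CcD)
  have odd: "(LINT y|lborel. q y * of_real (y \<bullet> b)) = 0"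
    using integral_lborel_minus[OF m] by (simp add: q(3))
  show thesis
  proof (rule that[OF C])
    fix \<xi> assume \<xi>: "rho \<xi> \<le> 2"
    have "q y * p (\<xi> - y) = q y * of_real (\<xi> \<bullet> b) - q y * of_real (y \<bullet> b)" for y
    proof (cases "norm y \<le> \<delta>")
      case True
      then have "\<bar>rho (\<xi> - y) - rho \<xi>\<bar> < 1" using \<xi> by (intro \<delta>(2)) auto
      then have "rho (\<xi> - y) \<le> 3" using \<xi> by linarith
      then show ?thesis by (simp add: p1 inner_diff_left algebra_simps)
    qed (simp add: q(2))
    then have "conv q p \<xi> = (LINT y|lborel. q y * of_real (\<xi> \<bullet> b) - q y * of_real (y \<bullet> b))"
      unfolding conv_def by (simp only:)
    also have "\<dots> = of_real (\<xi> \<bullet> b)"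
      using CcD(4)[OF q(1)] i by (simp add: q(4) odd)
    finally show "conv q p \<xi> = of_real (\<xi> \<bullet> b)" .
  qed
qed

text \<open>The fixed profile behind all pieces. For the low-pass functions used below it lives on
  1/2 < \<open>rho\<close> < 2, and the power of the coordinate is, up to a power of \<i>, the
  symbol of an \<open>s\<close>-fold derivative along \<open>b\<close>.\<close>

abbreviation band :: "('a \<Rightarrow> complex) \<Rightarrow> 'a \<Rightarrow> nat \<Rightarrow> 'a \<Rightarrow> complex" where
  "band \<eta> b s \<equiv> \<lambda>\<xi>. of_real (\<xi> \<bullet> b) ^ s * (\<eta> (adil (-1) \<xi>) - \<eta> \<xi>)"

text \<open>One \<open>\<eta>\<close> serves all directions and orders. The truncated coordinate
  \<open>g\<close> may stand in for the true one because the difference of the two low-pass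
  functions vanishes where \<open>rho\<close> exceeds 2.\<close>

lemma exists_band_pass:
  obtains \<eta> :: "'a \<Rightarrow> complex" where "Cc \<eta>" "\<And>\<xi>. rho \<xi> \<le> 1/2 \<Longrightarrow> \<eta> \<xi> = 1" "\<And>\<xi>. rho \<xi> \<ge> 1 \<Longrightarrow> \<eta> \<xi> = 0"
    "\<And>b s. b \<in> Basis \<Longrightarrow> \<exists>C. wiener (band \<eta> b s) C"
proof -
  obtain \<eta> C where \<eta>: "wiener \<eta> C" "Cc \<eta>" "\<And>\<xi>. rho \<xi> \<le> 1/2 \<Longrightarrow> \<eta> \<xi> = 1" "\<And>\<xi>. rho \<xi> \<ge> 1 \<Longrightarrow> \<eta> \<xi> = 0"
    by (rule exists_low_pass) blast
  show thesis
  proof (rule that[OF \<eta>(2-4)])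
    fix b :: 'a and s :: nat assume b: "b \<in> Basis"
    obtain g D where g: "wiener g D" "\<And>\<xi>. rho \<xi> \<le> 2 \<Longrightarrow> g \<xi> = of_real (\<xi> \<bullet> b)"
      by (rule exists_coordinate_multiplier[OF b]) blast
    have "wiener (\<lambda>\<xi>. \<eta> (adil (-1) \<xi>)) C"
      unfolding adil_def by (rule wiener_diagmap[OF \<eta>(1)]) simp
    from wiener_diff[OF this \<eta>(1)] obtain E where E: "wiener (\<lambda>\<xi>. \<eta> (adil (-1) \<xi>) - \<eta> \<xi>) E" ..
    have "(\<lambda>\<xi>. g \<xi> ^ s * (\<eta> (adil (-1) \<xi>) - \<eta> \<xi>)) = (\<lambda>\<xi>. of_real (\<xi> \<bullet> b) ^ s * (\<eta> (adil (-1) \<xi>) - \<eta> \<xi>))"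
    proof
      fix \<xi>
      show "g \<xi> ^ s * (\<eta> (adil (-1) \<xi>) - \<eta> \<xi>) = of_real (\<xi> \<bullet> b) ^ s * (\<eta> (adil (-1) \<xi>) - \<eta> \<xi>)"
      proof (cases "rho \<xi> \<le> 2")
        case False
        then have "rho (adil (-1) \<xi>) \<ge> 1" by (simp add: rho_adil powr_minus)
        then show ?thesis using False \<eta>(4) by simp
      qed (simp add: g(2))
    qed
    then show "\<exists>C. wiener (band \<eta> b s) C"
      using wiener_power_mult[OF g(1) E, of s] by simp
  qed
qed

end

section \<open>Differentiation and summation\<close>

text \<open>The remainder of the exponential is quadratic in the increment and the second moment of
  \<open>h\<close> is integrable, so the difference quotient converges with the explicit rate
  \<open>\<bar>\<tau>\<bar> * K\<close>.\<close>

lemma fourier_has_vector_derivative: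
  fixes h :: "'a::euclidean_space \<Rightarrow> complex" and b x :: 'a
  assumes h: "integrable lborel h" and h1: "integrable lborel (\<lambda>\<xi>. of_real (\<xi> \<bullet> b) * h \<xi>)"
    and h2: "integrable lborel (\<lambda>\<xi>. of_real (\<xi> \<bullet> b) ^ 2 * h \<xi>)"
  shows "((\<lambda>t. fourier h (- (x + t *\<^sub>R b))) has_vector_derivative
      fourier (\<lambda>\<xi>. \<i> * of_real (\<xi> \<bullet> b) * h \<xi>) (- (x + t *\<^sub>R b))) (at t)"
proof -
  define K where "K = (LINT \<xi>|lborel. cmod (of_real (\<xi> \<bullet> b) ^ 2 * h \<xi>))"
  let ?F = "\<lambda>t. fourier h (- (x + t *\<^sub>R b))"
  let ?D = "fourier (\<lambda>\<xi>. \<i> * of_real (\<xi> \<bullet> b) * h \<xi>) (- (x + t *\<^sub>R b))"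
  let ?k = "\<lambda>t \<xi>. exp (- \<i> * of_real (\<xi> \<bullet> (- (x + t *\<^sub>R b))))"
  have h1': "integrable lborel (\<lambda>\<xi>. \<i> * of_real (\<xi> \<bullet> b) * h \<xi>)"
    using integrable_mult_right[OF h1, of \<i>] by (simp add: mult.assoc)
  have ki: "integrable lborel (\<lambda>\<xi>. ?k t \<xi> * h \<xi>)" for t
    using integrable_fourier_kernel[OF h, of "- (x + t *\<^sub>R b)"] by simp
  have ki1: "integrable lborel (\<lambda>\<xi>. ?k t \<xi> * (\<i> * of_real (\<xi> \<bullet> b) * h \<xi>))" for t
    using integrable_fourier_kernel[OF h1', of "- (x + t *\<^sub>R b)"] by simp
  have bound: "cmod (?F (t + \<tau>) - ?F t - of_real \<tau> * ?D) \<le> \<tau>\<^sup>2 * K" for \<tau>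
  proof -
    let ?r = "\<lambda>\<xi>. ?k (t + \<tau>) \<xi> * h \<xi> - ?k t \<xi> * h \<xi> - of_real \<tau> * (?k t \<xi> * (\<i> * of_real (\<xi> \<bullet> b) * h \<xi>))"
    have "?F (t + \<tau>) - ?F t - of_real \<tau> * ?D =
       (LINT \<xi>|lborel. ?r \<xi>)"
      unfolding fourier_def using ki ki1 by simp
    also have "cmod \<dots> \<le> (LINT \<xi>|lborel. \<tau>\<^sup>2 * cmod (of_real (\<xi> \<bullet> b) ^ 2 * h \<xi>))"
    proof (rule norm_LINT_le)
      show "integrable lborel (\<lambda>\<xi>. ?r \<xi>)"
        using ki ki1 by (intro Bochner_Integration.integrable_diff integrable_mult_right) auto
      show "integrable lborel (\<lambda>\<xi>. \<tau>\<^sup>2 * cmod (of_real (\<xi> \<bullet> b) ^ 2 * h \<xi>))"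
        using h2 by (intro integrable_mult_right integrable_norm)
      fix \<xi> :: 'a
      define y where "y = \<tau> * (\<xi> \<bullet> b)"
      have k: "?k (t + \<tau>) \<xi> = ?k t \<xi> * iexp y"
        by (simp add: y_def inner_add_right exp_add[symmetric] algebra_simps)
      have "?r \<xi>
         = ?k t \<xi> * ((iexp y - (1 + \<i> * y)) * h \<xi>)"
        unfolding k y_def by (simp add: algebra_simps)
      moreover have "cmod (?k t \<xi>) = 1" by (simp add: norm_exp_eq_Re)
      ultimately have "cmod (?r \<xi>)
         = cmod (iexp y - (1 + \<i> * y)) * cmod (h \<xi>)"
        by (simp only: norm_mult)
      also have "\<dots> \<le> (\<bar>y\<bar>\<^sup>2 / 2) * cmod (h \<xi>)"
        using iexp_approx1[of y 1] by (intro mult_right_mono) (auto simp: power2_eq_square)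
      also have "\<dots> \<le> \<bar>y\<bar>\<^sup>2 * cmod (h \<xi>)"
        by (intro mult_right_mono) auto
      also have "\<dots> = \<tau>\<^sup>2 * cmod (of_real (\<xi> \<bullet> b) ^ 2 * h \<xi>)"
        by (simp add: y_def power_mult_distrib norm_mult norm_power)
      finally show "cmod (?r \<xi>)
         \<le> \<tau>\<^sup>2 * cmod (of_real (\<xi> \<bullet> b) ^ 2 * h \<xi>)" .
    qed
    also have "\<dots> = \<tau>\<^sup>2 * K" by (simp add: K_def)
    finally show ?thesis .
  qed
  show ?thesis
    unfolding has_vector_derivative_def
  proof (rule has_derivativeI_sandwich[where e=1 and H="\<lambda>y. \<bar>y - t\<bar> * K"])
    show "bounded_linear (\<lambda>y. y *\<^sub>R ?D)" by (rule bounded_linear_scaleR_left)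
    show "((\<lambda>y. \<bar>y - t\<bar> * K) \<longlongrightarrow> 0) (at t)"
      by (rule tendsto_eq_intros refl)+ auto
    fix y assume "y \<noteq> t"
    have "norm (?F y - ?F t - (y - t) *\<^sub>R ?D) \<le> (y - t)\<^sup>2 * K"
      using bound[of "y - t"] by (simp add: scaleR_conv_of_real)
    also have "\<dots> = (\<bar>y - t\<bar> * K) * norm (y - t)"
      by (simp add: power2_eq_square algebra_simps)
    finally show "norm (?F y - ?F t - (y - t) *\<^sub>R ?D) / norm (y - t) \<le> \<bar>y - t\<bar> * K"
      using \<open>y \<noteq> t\<close> by (simp add: divide_le_eq)
  qed simp
qed

lemma vector_derivative_bound:
  fixes f :: "real \<Rightarrow> complex"
  assumes d: "\<And>t. (f has_vector_derivative f' t) (at t)" and B: "\<And>t. cmod (f' t) \<le> B"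
  shows "cmod (f s - f t) \<le> B * \<bar>s - t\<bar>"
proof -
  have "norm (f s - f t) \<le> B * norm (s - t)"
  proof (rule differentiable_bound[of UNIV f "\<lambda>t h. h *\<^sub>R f' t"])
    show "onorm (\<lambda>h. h *\<^sub>R f' t) \<le> B" for t
      using B[of t] order_trans[OF norm_ge_zero B[of t]]
      by (intro onorm_bound) (auto simp: mult.commute[of _ "\<bar>_\<bar>"] intro!: mult_left_mono)
  qed (use d in \<open>auto simp: has_vector_derivative_def\<close>)
  then show ?thesis by simp
qed

lemma sum_geometric_shifted_le:
  fixes q :: real
  assumes q: "0 < q" "q < 1" and F: "finite F" and i: "inj_on f F"
  shows "(\<Sum>j\<in>F. q ^ f j) \<le> 1 / (1 - q)"
proof -
  have "(\<Sum>j\<in>F. q ^ f j) = (\<Sum>n\<in>f ` F. q ^ n)"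
    using i by (simp add: sum.reindex)
  also have "\<dots> \<le> (\<Sum>n. q ^ n)"
    using q F by (intro sum_le_suminf summable_geometric) auto
  also have "\<dots> = 1 / (1 - q)"
    using q by (simp add: suminf_geometric)
  finally show ?thesis .
qed

text \<open>The geometric series is cut at the index where the two bounds coincide, \<open>2 powr (j / a) = 1 / h\<close>.\<close>

lemma sum_two_sided_geometric_le:
  fixes d :: "int \<Rightarrow> real"
  assumes h: "h > 0" and a: "a > 0" and p: "0 < p" "p < 1" and AB: "A \<ge> 0" "B \<ge> 0" and F: "finite F"
    and d1: "\<And>j. d j \<le> A * 2 powr (- (of_int j * p / a))"
    and d2: "\<And>j. d j \<le> h * (B * 2 powr (of_int j * (1 - p) / a))"
  shows "(\<Sum>j\<in>F. d j) \<le> (A / (1 - 2 powr (- (p / a))) + B / (1 - 2 powr (- ((1 - p) / a)))) * h powr p"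
proof -
  define J where "J = \<lfloor>a * log 2 (1 / h)\<rfloor>"
  define q where "q = 2 powr (- (p / a))"
  define r where "r = 2 powr (- ((1 - p) / a))"
  have q: "0 < q" "q < 1" and r: "0 < r" "r < 1"
    using a p by (auto simp: q_def r_def powr_less_one)
  have h_eq: "h powr s = 2 powr (- (a * log 2 (1 / h) * s / a))" for s
  proof -
    have "h = 2 powr (- log 2 (1 / h))"
      using h by (simp add: powr_minus log_divide)
    then have "h powr s = (2 powr (- log 2 (1 / h))) powr s" by simp
    also have "\<dots> = 2 powr (- (a * log 2 (1 / h) * s / a))"
      using a by (simp add: powr_powr)
    finally show ?thesis .
  qed
  \<comment> \<open>Above the cut the supremum bound decays in \<open>j\<close>. Counting starts at
    \<open>J + 1\<close>, where the power of two is already at most \<open>h powr p\<close>.\<close>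
  have high: "d j \<le> A * h powr p * q ^ nat (j - (J + 1))" if "j > J" for j
  proof -
    have "d j \<le> A * 2 powr (- (of_int j * p / a))" by (rule d1)
    also have "2 powr (- (of_int j * p / a)) = 2 powr (- (of_int (J + 1) * p / a)) * q ^ nat (j - (J + 1))"
    proof -
      have "q ^ nat (j - (J + 1)) = q powr of_int (j - (J + 1))"
        using q that by (simp flip: powr_realpow)
      also have "\<dots> = 2 powr (- (of_int (j - (J + 1)) * p / a))"
        by (simp add: q_def powr_powr mult_ac)
      finally have "q ^ nat (j - (J + 1)) = \<dots>" .
      moreover have "- (of_int j * p / a) = - (of_int (J + 1) * p / a) + - (of_int (j - (J + 1)) * p / a)"
        using a by (simp add: field_simps)
      ultimately show ?thesis by (simp only: powr_add)
    qed
    also have "2 powr (- (of_int (J + 1) * p / a)) \<le> h powr p"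
    proof -
      have "a * log 2 (1 / h) \<le> of_int (J + 1)" unfolding J_def by linarith
      then have "a * log 2 (1 / h) * p / a \<le> of_int (J + 1) * p / a"
        using a p by (intro divide_right_mono mult_right_mono) auto
      then show ?thesis unfolding h_eq by (intro powr_mono) auto
    qed
    finally show ?thesis using AB q by (simp add: mult_left_mono mult_right_mono mult.assoc)
  qed
  \<comment> \<open>Up to the cut the derivative bound is used; it decays as \<open>j\<close>
    decreases, and the factor \<open>h\<close> combines with \<open>h powr (- (1 - p))\<close> to
    \<open>h powr p\<close>.\<close>
  have low: "d j \<le> B * h powr p * r ^ nat (J - j)" if "j \<le> J" for j
  proof -
    have "d j \<le> h * (B * 2 powr (of_int j * (1 - p) / a))" by (rule d2)
    also have "2 powr (of_int j * (1 - p) / a) = 2 powr (of_int J * (1 - p) / a) * r ^ nat (J - j)"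
    proof -
      have "r ^ nat (J - j) = r powr of_int (J - j)"
        using r that by (simp flip: powr_realpow)
      also have "\<dots> = 2 powr (- (of_int (J - j) * (1 - p) / a))"
        by (simp add: r_def powr_powr mult_ac)
      finally have "r ^ nat (J - j) = \<dots>" .
      moreover have "of_int j * (1 - p) / a = of_int J * (1 - p) / a + - (of_int (J - j) * (1 - p) / a)"
        using a by (simp add: field_simps)
      ultimately show ?thesis by (simp only: powr_add)
    qed
    also have "2 powr (of_int J * (1 - p) / a) \<le> h powr (- (1 - p))"
    proof -
      have "of_int J \<le> a * log 2 (1 / h)" unfolding J_def by linarith
      then have "of_int J * (1 - p) / a \<le> a * log 2 (1 / h) * (1 - p) / a"
        using a p by (intro divide_right_mono mult_right_mono) auto
      then have "of_int J * (1 - p) / a \<le> - (a * log 2 (1 / h) * (- (1 - p)) / a)"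
        by (simp only: mult_minus_right minus_divide_left minus_minus)
      then show ?thesis unfolding h_eq by (intro powr_mono) auto
    qed
    finally have "d j \<le> h * (B * (h powr (- (1 - p)) * r ^ nat (J - j)))"
      using AB h r by (simp add: mult_left_mono mult_right_mono)
    also have "\<dots> = B * (h powr 1 * h powr (- (1 - p))) * r ^ nat (J - j)"
      using h by simp
    also have "h powr 1 * h powr (- (1 - p)) = h powr p"
      unfolding powr_add[symmetric] by simp
    finally show ?thesis .
  qed
  have "(\<Sum>j\<in>F. d j) = (\<Sum>j\<in>{j\<in>F. j > J}. d j) + (\<Sum>j\<in>{j\<in>F. j \<le> J}. d j)"
    using F by (subst sum.union_disjoint[symmetric]) (auto intro!: sum.cong)
  also have "\<dots> \<le> (\<Sum>j\<in>{j\<in>F. j > J}. A * h powr p * q ^ nat (j - (J + 1))) + (\<Sum>j\<in>{j\<in>F. j \<le> J}. B * h powr p * r ^ nat (J - j))"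
    by (intro add_mono sum_mono high low) auto
  also have "\<dots> = A * h powr p * (\<Sum>j\<in>{j\<in>F. j > J}. q ^ nat (j - (J + 1))) + B * h powr p * (\<Sum>j\<in>{j\<in>F. j \<le> J}. r ^ nat (J - j))"
    by (simp add: sum_distrib_left)
  also have "\<dots> \<le> A * h powr p * (1 / (1 - q)) + B * h powr p * (1 / (1 - r))"
    using AB F q r by (intro add_mono mult_left_mono sum_geometric_shifted_le) (auto intro!: inj_onI)
  also have "\<dots> = (A / (1 - q) + B / (1 - r)) * h powr p"
    by (simp add: algebra_simps)
  finally show ?thesis by (simp add: q_def r_def)
qed

section \<open>Littlewood--Paley pieces\<close>

text \<open>All that is retained of multiplier and function: \<open>g\<close> stands, up to
  normalisation, for the transform of the function to be estimated, \<open>G\<close> bounds it, and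
  \<open>M\<close> controls its pieces cut off by \<open>\<omega>\<close>. \<open>W\<close> is a
  parameter, so that the final constant can be written in terms of data chosen before
  \<open>g\<close>.\<close>

locale littlewood_paley = aniso a for a :: "'a::euclidean_space \<Rightarrow> real" +
  fixes \<eta> g :: "'a \<Rightarrow> complex" and \<omega> :: "real \<Rightarrow> real" and W :: "'a \<Rightarrow> nat \<Rightarrow> real" and G M \<gamma> :: real
  assumes \<eta>: "Cc \<eta>" "\<And>\<xi>. rho \<xi> \<le> 1/2 \<Longrightarrow> \<eta> \<xi> = 1" "\<And>\<xi>. rho \<xi> \<ge> 1 \<Longrightarrow> \<eta> \<xi> = 0"
    and W: "\<And>b s. b \<in> Basis \<Longrightarrow> wiener (band \<eta> b s) (W b s)"
    and \<gamma>: "0 < \<gamma>"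
    and \<omega>: "\<And>t. 1/2 \<le> t \<Longrightarrow> t \<le> 2 \<Longrightarrow> \<omega> t = 1"
    and g [measurable]: "g \<in> borel_measurable borel" and G: "\<And>\<xi>. cmod (g \<xi>) \<le> G"
    and piece: "\<And>j. integrable lborel (\<lambda>\<xi>. of_real (\<omega> (rho (adil (- j) \<xi>))) * g \<xi>)"
    and M: "\<And>j x. cmod (fourier (\<lambda>\<xi>. of_real (\<omega> (rho (adil (- j) \<xi>))) * g \<xi>) x) \<le> 2 powr (- (of_int j * \<gamma>)) * M"
begin

text \<open>The difference of consecutive dilates of \<open>\<eta>\<close>, localised where
  \<open>rho\<close> is of order 2^j; sums over \<open>j\<close> telescope.\<close>

definition theta :: "int \<Rightarrow> 'a \<Rightarrow> complex" where
  "theta j \<xi> = \<eta> (adil (-1) (adil (- j) \<xi>)) - \<eta> (adil (- j) \<xi>)"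

text \<open>The \<open>s\<close>-th derivative along \<open>b\<close> of the \<open>j\<close>-th
  piece: differentiation is the factor under the integral, and evaluation at \<open>- x\<close>
  makes the forward transform an inverse one, whose constant is absorbed in
  \<open>g\<close>.\<close>

definition T :: "'a \<Rightarrow> nat \<Rightarrow> int \<Rightarrow> 'a \<Rightarrow> complex" where
  "T b s j x = fourier (\<lambda>\<xi>. (\<i> * of_real (\<xi> \<bullet> b)) ^ s * (theta j \<xi> * g \<xi>)) (- x)"

text \<open>The indices n and -n-1 exhaust the integers once each, which turns the two-sided series
  into an ordinary one.\<close>

abbreviation T2 :: "'a \<Rightarrow> nat \<Rightarrow> nat \<Rightarrow> 'a \<Rightarrow> complex" where
  "T2 b s n x \<equiv> T b s (int n) x + T b s (- int n - 1) x"

lemma M_nonneg: "0 \<le> M"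
  using order_trans[OF norm_ge_zero M[of 0 0]] by simp

lemma G_nonneg: "0 \<le> G"
  using order_trans[OF norm_ge_zero G] .

lemma W_nonneg: "b \<in> Basis \<Longrightarrow> 0 \<le> W b s"
  using W wiener_nonneg by blast

lemma theta_eq_0: "\<not> (1/2 < rho (adil (- j) \<xi>) \<and> rho (adil (- j) \<xi>) < 2) \<Longrightarrow> theta j \<xi> = 0"
  unfolding theta_def using \<eta>(2,3) by (auto simp: rho_adil powr_minus not_less)

lemma theta_omega: "theta j \<xi> * of_real (\<omega> (rho (adil (- j) \<xi>))) = theta j \<xi>"
  using theta_eq_0[of j \<xi>] \<omega> by fastforce

lemma Cc_poly_theta: "Cc (\<lambda>\<xi>. (c * of_real (\<xi> \<bullet> b)) ^ s * theta j \<xi>)"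
  unfolding Cc_def
proof
  have "continuous_on UNIV (\<lambda>\<xi>. \<eta> (adil i \<xi>))" for i
    by (rule continuous_on_compose2[OF CcD(1)[OF \<eta>(1)] continuous_adil]) simp
  from this[of "- 1 - j"] this[of "- j"] show "continuous_on UNIV (\<lambda>\<xi>. (c * of_real (\<xi> \<bullet> b)) ^ s * theta j \<xi>)"
    unfolding theta_def adil_adil by (intro continuous_intros) auto
  have "rho \<xi> \<le> 2 * 2 powr j" if "theta j \<xi> \<noteq> 0" for \<xi>
  proof -
    have "rho (adil (- j) \<xi>) < 2" using theta_eq_0[of j \<xi>] that by blast
    then show ?thesis by (simp add: rho_adil powr_minus divide_simps mult_ac)
  qed
  then show "bounded {\<xi>. (c * of_real (\<xi> \<bullet> b)) ^ s * theta j \<xi> \<noteq> 0}"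
    by (intro bounded_subset[OF bounded_rho_le[of "2 * 2 powr j"]]) auto
qed

lemma integrable_poly_theta: "integrable lborel (\<lambda>\<xi>. (c * of_real (\<xi> \<bullet> b)) ^ s * (theta j \<xi> * g \<xi>))"
  using integrable_bounded_times(2)[OF G g CcD(4)[OF Cc_poly_theta]] by (simp add: mult.assoc)

text \<open>Rescaling by \<open>adil (- j)\<close> turns the symbol into the fixed
  \<open>band\<close>, at the price of \<open>2 powr (of_int j * s / a b)\<close>. The given cut-off
  is inserted by \<open>theta_omega\<close>, so the bound \<open>M\<close> passes through a
  multiplier of norm at most \<open>W b s\<close>.\<close>

lemma T_high:
  assumes b: "b \<in> Basis"
  shows "cmod (T b s j x) \<le> W b s * M * 2 powr (of_int j * (s / a b - \<gamma>))"
proof -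
  define K where "K = \<i> ^ s * of_real (2 powr (of_int j * s / a b))"
  let ?w = "\<lambda>\<xi>. of_real (\<xi> \<bullet> b) ^ s * (\<eta> (adil (-1) \<xi>) - \<eta> \<xi>)"
  let ?h = "\<lambda>\<xi>. of_real (\<omega> (rho (adil (- j) \<xi>))) * g \<xi>"
  have "wiener (\<lambda>\<xi>. ?w (adil (- j) \<xi>)) (W b s)"
    using wiener_diagmap[OF W[OF b]] unfolding adil_def by simp
  then have w: "cmod (fourier (\<lambda>\<xi>. ?w (adil (- j) \<xi>) * ?h \<xi>) (- x)) \<le> W b s * (2 powr (- (of_int j * \<gamma>)) * M)"
    by (rule wiener_bound[OF _ piece M])
  have "(\<i> * of_real (\<xi> \<bullet> b)) ^ s * (theta j \<xi> * g \<xi>) = K * (?w (adil (- j) \<xi>) * ?h \<xi>)" for \<xi>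
  proof -
    have "(2 powr (of_int (- j) / a b)) ^ s = 2 powr (- (of_int j * s / a b))"
      by (simp add: powr_powr mult_ac flip: powr_realpow)
    then have "2 powr (of_int j * s / a b) * (2 powr (of_int (- j) / a b)) ^ s = 1"
      by (simp add: powr_minus)
    then have "complex_of_real (2 powr (of_int j * s / a b)) * of_real (2 powr (of_int (- j) / a b)) ^ s = 1"
      by (simp only: of_real_power[symmetric] of_real_mult[symmetric]) simp
    moreover have "of_real (adil (- j) \<xi> \<bullet> b) ^ s = complex_of_real (2 powr (of_int (- j) / a b)) ^ s * of_real (\<xi> \<bullet> b) ^ s"
      by (simp only: adil_inner[OF b] of_real_mult power_mult_distrib)
    ultimately have *: "K * of_real (adil (- j) \<xi> \<bullet> b) ^ s = (\<i> * of_real (\<xi> \<bullet> b)) ^ s"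
      unfolding K_def by (simp add: power_mult_distrib mult_ac)
    have "K * (?w (adil (- j) \<xi>) * ?h \<xi>) = (K * of_real (adil (- j) \<xi> \<bullet> b) ^ s) * ((theta j \<xi> * of_real (\<omega> (rho (adil (- j) \<xi>)))) * g \<xi>)"
      by (simp add: theta_def mult_ac)
    also have "\<dots> = (\<i> * of_real (\<xi> \<bullet> b)) ^ s * (theta j \<xi> * g \<xi>)"
      unfolding * theta_omega ..
    finally show ?thesis by (rule sym)
  qed
  then have "T b s j x = K * fourier (\<lambda>\<xi>. ?w (adil (- j) \<xi>) * ?h \<xi>) (- x)"
    unfolding T_def by (simp only: fourier_cmult)
  then have "cmod (T b s j x) \<le> cmod K * (W b s * (2 powr (- (of_int j * \<gamma>)) * M))"
    using w by (simp only: norm_mult mult_left_mono norm_ge_zero)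
  also have "\<dots> = W b s * M * (2 powr (of_int j * s / a b) * 2 powr (- (of_int j * \<gamma>)))"
    by (simp add: K_def norm_mult norm_power)
  also have "2 powr (of_int j * s / a b) * 2 powr (- (of_int j * \<gamma>)) = 2 powr (of_int j * (s / a b - \<gamma>))"
    by (simp add: powr_add[symmetric] algebra_simps)
  finally show ?thesis .
qed

text \<open>The homogeneous dimension: \<open>adil j\<close> has determinant
  \<open>2 powr (of_int j * sigma)\<close>.\<close>

definition sigma :: real where "sigma = (\<Sum>b\<in>Basis. 1 / a b)"

lemma sigma_pos: "sigma > 0"
  unfolding sigma_def using a_pos by (intro sum_pos) auto

text \<open>A crude bound from the L1 norm of \<open>theta j\<close>, which scales like the
  determinant of the dilation, and from the boundedness of \<open>g\<close>. It is summable towards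
  minus infinity, where \<open>T_high\<close> grows for \<open>s\<close> below the Hoelder order;
  its constant involves \<open>G\<close> and serves only for convergence.\<close>

lemma T_low:
  assumes b: "b \<in> Basis"
  shows "\<exists>K\<ge>0. \<forall>j\<le>0. \<forall>x. cmod (T b s j x) \<le> K * 2 powr (of_int j * sigma)"
proof -
  define I where "I = (LINT \<xi>|lborel. cmod (theta 0 \<xi>))"
  define R where "R = 2 powr (1 / a b)"
  have I: "I \<ge> 0" unfolding I_def by simp
  have th: "Cc (theta j)" for j
    using Cc_poly_theta[of 1 0 0 j] by simp
  note [measurable] = CcD(5)[OF th]
  have Ij: "(LINT \<xi>|lborel. cmod (theta j \<xi>)) = 2 powr (of_int j * sigma) * I" for j
  proof -
    have "(LINT \<xi>|lborel. cmod (theta j \<xi>)) = (\<Prod>b\<in>Basis. 2 powr (of_int j / a b)) *\<^sub>R (LINT \<xi>|lborel. cmod (theta j (adil j \<xi>)))"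
      unfolding adil_def by (rule integral_diagmap) auto
    also have "(\<lambda>\<xi>. cmod (theta j (adil j \<xi>))) = (\<lambda>\<xi>. cmod (theta 0 \<xi>))"
      by (simp add: theta_def adil_adil adil_0)
    also have "(\<Prod>b\<in>Basis. 2 powr (of_int j / a b)) = 2 powr (of_int j * sigma)"
      by (simp add: sigma_def sum_distrib_left powr_sum)
    finally show ?thesis by (simp add: I_def)
  qed
  show ?thesis
  proof (intro exI[of _ "R ^ s * G * I"] conjI allI impI)
    show "0 \<le> R ^ s * G * I" using G_nonneg I by (simp add: R_def)
    fix j :: int and x assume j: "j \<le> 0"
    have "cmod (T b s j x) \<le> (LINT \<xi>|lborel. cmod ((\<i> * of_real (\<xi> \<bullet> b)) ^ s * (theta j \<xi> * g \<xi>)))"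
      unfolding T_def by (rule cmod_fourier_le)
    also have "\<dots> \<le> (LINT \<xi>|lborel. (R ^ s * G) * cmod (theta j \<xi>))"
    proof (rule integral_mono)
      show "integrable lborel (\<lambda>\<xi>. cmod ((\<i> * of_real (\<xi> \<bullet> b)) ^ s * (theta j \<xi> * g \<xi>)))"
        using integrable_poly_theta by (rule integrable_norm)
      show "integrable lborel (\<lambda>\<xi>. (R ^ s * G) * cmod (theta j \<xi>))"
        using CcD(4)[OF th] by auto
      fix \<xi>
      show "cmod ((\<i> * of_real (\<xi> \<bullet> b)) ^ s * (theta j \<xi> * g \<xi>)) \<le> (R ^ s * G) * cmod (theta j \<xi>)"
      proof (cases "theta j \<xi> = 0")
        case False
        then have "rho (adil (- j) \<xi>) < 2" using theta_eq_0 by blast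
        then have "rho \<xi> < 2 powr j * 2"
          by (simp add: rho_adil powr_minus divide_simps mult_ac)
        moreover have "2 powr real_of_int j \<le> 1" using powr_mono[of j 0 2] j by simp
        ultimately have "rho \<xi> \<le> 2" by linarith
        then have "\<bar>\<xi> \<bullet> b\<bar> \<le> R" unfolding R_def by (rule abs_inner_le_rho[OF _ b])
        then have "cmod ((\<i> * of_real (\<xi> \<bullet> b)) ^ s) \<le> R ^ s"
          by (simp add: norm_power norm_mult power_mono)
        then have "cmod ((\<i> * of_real (\<xi> \<bullet> b)) ^ s) * (cmod (theta j \<xi>) * cmod (g \<xi>)) \<le> R ^ s * (cmod (theta j \<xi>) * G)"
          using G by (intro mult_mono mult_left_mono) (auto simp: R_def)
        then show ?thesis by (simp only: norm_mult mult_ac)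
      qed simp
    qed
    also have "\<dots> = R ^ s * G * I * 2 powr (of_int j * sigma)" by (simp add: Ij)
    finally show "cmod (T b s j x) \<le> R ^ s * G * I * 2 powr (of_int j * sigma)" .
  qed
qed

lemma T_has_vector_derivative:
  "((\<lambda>t. T b s j (x + t *\<^sub>R b)) has_vector_derivative T b (Suc s) j (x + t *\<^sub>R b)) (at t)"
proof -
  let ?h = "\<lambda>\<xi>. (\<i> * of_real (\<xi> \<bullet> b)) ^ s * (theta j \<xi> * g \<xi>)"
  have p: "integrable lborel (\<lambda>\<xi>. (\<i> * of_real (\<xi> \<bullet> b)) ^ n * ?h \<xi>)" for n
    using integrable_poly_theta[of \<i> b "n + s" j] by (simp add: power_add mult.assoc)
  have "((\<lambda>t. fourier ?h (- (x + t *\<^sub>R b))) has_vector_derivative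
      fourier (\<lambda>\<xi>. \<i> * of_real (\<xi> \<bullet> b) * ?h \<xi>) (- (x + t *\<^sub>R b))) (at t)"
  proof (rule fourier_has_vector_derivative)
    show "integrable lborel ?h" using p[of 0] by simp
    show "integrable lborel (\<lambda>\<xi>. of_real (\<xi> \<bullet> b) * ?h \<xi>)"
      using integrable_mult_right[OF p[of 1], of "- \<i>"] by (simp add: mult.assoc[symmetric])
    show "integrable lborel (\<lambda>\<xi>. of_real (\<xi> \<bullet> b) ^ 2 * ?h \<xi>)"
      using integrable_mult_right[OF p[of 2], of "- 1"] by (simp add: power_mult_distrib)
  qed
  then show ?thesis by (simp add: T_def mult.assoc)
qed

lemma continuous_T: "continuous_on UNIV (T b s j)"
  unfolding T_def
  by (rule continuous_on_compose2[OF continuous_fourier[OF integrable_poly_theta]]) (auto intro!: continuous_intros)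

definition V :: "'a \<Rightarrow> nat \<Rightarrow> 'a \<Rightarrow> complex" where
  "V b s x = (\<Sum>n. T2 b s n x)"

text \<open>For \<open>s\<close> below the Hoelder order the exponent in \<open>T_high\<close> is
  negative for positive indices, so that bound sums the nonnegative indices, and
  \<open>T_low\<close> sums the negative ones.\<close>

lemma T_majorant:
  assumes b: "b \<in> Basis" and s: "s < a b * \<gamma>"
  obtains A where "summable A" "\<And>n x. cmod (T2 b s n x) \<le> A n"
proof -
  obtain K where K: "\<And>j x. j \<le> 0 \<Longrightarrow> cmod (T b s j x) \<le> K * 2 powr (of_int j * sigma)"
    using T_low[OF b] by blast
  define p where "p = 2 powr (s / a b - \<gamma>)"
  define q where "q = 2 powr (- sigma)"
  have "p < 1" "p > 0" "q < 1" "q > 0"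
    using s a_pos[OF b] sigma_pos by (auto simp: p_def q_def powr_less_one field_simps)
  show thesis
  proof (rule that[of "\<lambda>n. W b s * M * p ^ n + K * (q * q ^ n)"])
    show "summable (\<lambda>n. W b s * M * p ^ n + K * (q * q ^ n))"
      using \<open>p < 1\<close> \<open>p > 0\<close> \<open>q < 1\<close> \<open>q > 0\<close>
      by (intro summable_add summable_mult summable_geometric) auto
    fix n x
    have "2 powr (of_int (int n) * (s / a b - \<gamma>)) = p ^ n"
      using \<open>p > 0\<close> by (simp add: p_def powr_powr mult.commute flip: powr_realpow)
    moreover have "2 powr (of_int (- int n - 1) * sigma) = q * q ^ n"
    proof -
      have "q * q ^ n = q powr real (Suc n)"
        using \<open>q > 0\<close> by (simp only: powr_realpow power_Suc)
      moreover have "of_int (- int n - 1) * sigma = - sigma * real (Suc n)"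
        by (simp add: algebra_simps)
      ultimately show ?thesis by (simp only: q_def powr_powr)
    qed
    ultimately show "cmod (T2 b s n x) \<le> W b s * M * p ^ n + K * (q * q ^ n)"
      using T_high[OF b, of s "int n" x] K[of "- int n - 1" x] 
      by (intro norm_triangle_le add_mono) auto
  qed
qed

lemma V_uniform_limit:
  assumes b: "b \<in> Basis" and s: "s < a b * \<gamma>"
  shows "uniform_limit UNIV (\<lambda>N x. \<Sum>n<N. T2 b s n x) (V b s) sequentially"
proof -
  obtain A where A: "summable A" "\<And>n x. cmod (T2 b s n x) \<le> A n"
    by (rule T_majorant[OF b s]) blast
  show ?thesis
    unfolding V_def[abs_def] by (rule Weierstrass_m_test[OF A(2,1)])
qed

lemma continuous_V:
  assumes "b \<in> Basis" "s < a b * \<gamma>"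
  shows "continuous_on UNIV (V b s)"
  by (rule uniform_limit_theorem[OF _ V_uniform_limit[OF assms]])
     (auto intro!: always_eventually continuous_intros continuous_T)

lemma V_sums:
  assumes "b \<in> Basis" "s < a b * \<gamma>"
  shows "(\<lambda>n. T2 b s n x) sums V b s x"
  using tendsto_uniform_limitI[OF V_uniform_limit[OF assms], of x] by (simp add: sums_def)

text \<open>Termwise differentiation along a line; the differentiated series converges uniformly as
  long as \<open>Suc s\<close> stays below the order \<open>a b * \<gamma>\<close>.\<close>

lemma V_has_vector_derivative:
  assumes b: "b \<in> Basis" and s: "Suc s < a b * \<gamma>"
  shows "((\<lambda>t. V b s (x + t *\<^sub>R b)) has_vector_derivative V b (Suc s) (x + t *\<^sub>R b)) (at t)"
proof -
  have s': "s < a b * \<gamma>" using s by linarith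
  let ?f = "\<lambda>s n t. T2 b s n (x + t *\<^sub>R b)"
  have "\<exists>F. \<forall>t\<in>UNIV. (\<lambda>n. ?f s n t) sums F t \<and> (F has_derivative (\<lambda>h. h *\<^sub>R V b (Suc s) (x + t *\<^sub>R b))) (at t within UNIV)"
  proof (rule has_derivative_series[where f' = "\<lambda>n t h. h *\<^sub>R ?f (Suc s) n t" and x=0])
    show "(?f s n has_derivative (\<lambda>h. h *\<^sub>R ?f (Suc s) n t)) (at t within UNIV)" for n t
      unfolding has_vector_derivative_def[symmetric]
      by (intro has_vector_derivative_add T_has_vector_derivative)
    show "(\<lambda>n. ?f s n 0) sums V b s (x + 0 *\<^sub>R b)"
      by (rule V_sums[OF b s'])
    fix e :: real assume e: "e > 0"
    have "eventually (\<lambda>N. \<forall>x\<in>UNIV. dist (\<Sum>n<N. T2 b (Suc s) n x) (V b (Suc s) x) < e) sequentially"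
      using V_uniform_limit[OF b s] e by (rule uniform_limitD)
    then show "\<forall>\<^sub>F N in sequentially. \<forall>t\<in>UNIV. \<forall>h. norm ((\<Sum>n<N. h *\<^sub>R ?f (Suc s) n t) - h *\<^sub>R V b (Suc s) (x + t *\<^sub>R b)) \<le> e * norm h"
    proof eventually_elim
      case (elim N)
      show ?case
      proof (intro ballI allI)
        fix t h :: real
        have "norm ((\<Sum>n<N. h *\<^sub>R ?f (Suc s) n t) - h *\<^sub>R V b (Suc s) (x + t *\<^sub>R b))
          = norm h * norm ((\<Sum>n<N. ?f (Suc s) n t) - V b (Suc s) (x + t *\<^sub>R b))"
          unfolding scaleR_sum_right[symmetric] scaleR_diff_right[symmetric] by simp
        also have "\<dots> \<le> norm h * e"
          using elim by (intro mult_left_mono) (auto simp: dist_norm less_imp_le)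
        finally show "norm ((\<Sum>n<N. h *\<^sub>R ?f (Suc s) n t) - h *\<^sub>R V b (Suc s) (x + t *\<^sub>R b)) \<le> e * norm h"
          by (simp add: mult.commute)
      qed
    qed
  qed auto
  then obtain F where F: "\<And>t. (\<lambda>n. ?f s n t) sums F t" "\<And>t. (F has_vector_derivative V b (Suc s) (x + t *\<^sub>R b)) (at t)"
    unfolding has_vector_derivative_def by auto
  have "F = (\<lambda>t. V b s (x + t *\<^sub>R b))"
    using sums_unique2[OF F(1) V_sums[OF b s']] by blast
  then show ?thesis using F(2) by simp
qed

text \<open>Here \<open>s / a b - \<gamma>\<close> is negative and
  \<open>Suc s / a b - \<gamma>\<close> positive: the sizes of the terms decay at high frequencies
  and their slopes decay at low ones. \<open>T_high\<close> is used for all \<open>j\<close>, hence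
  \<open>G\<close> does not enter the constant.\<close>

lemma V_holder:
  assumes b: "b \<in> Basis" and s: "s < a b * \<gamma>" "a b * \<gamma> < Suc s" and h: "h > 0"
  defines "p \<equiv> a b * \<gamma> - s"
  shows "cmod (V b s (x + h *\<^sub>R b) - V b s x) \<le>
    (2 * W b s / (1 - 2 powr (- (p / a b))) + W b (Suc s) / (1 - 2 powr (- ((1 - p) / a b)))) * M * h powr p"
proof -
  have p: "0 < p" "p < 1" using s by (auto simp: p_def)
  have ab: "a b > 0" using a_pos[OF b] .
  define d where "d j = cmod (T b s j (x + h *\<^sub>R b) - T b s j x)" for j
  have e: "s / a b - \<gamma> = - (p / a b)" "Suc s / a b - \<gamma> = (1 - p) / a b"
    using ab by (auto simp: p_def field_simps)
  have d1: "d j \<le> (2 * W b s * M) * 2 powr (- (of_int j * p / a b))" for j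
    using norm_triangle_ineq4[of "T b s j (x + h *\<^sub>R b)" "T b s j x"] T_high[OF b, of s j "x + h *\<^sub>R b"] T_high[OF b, of s j x]
    unfolding d_def e by simp
  have d2: "d j \<le> h * ((W b (Suc s) * M) * 2 powr (of_int j * (1 - p) / a b))" for j
  proof -
    have "cmod (T b s j (x + h *\<^sub>R b) - T b s j (x + 0 *\<^sub>R b)) \<le> (W b (Suc s) * M * 2 powr (of_int j * (Suc s / a b - \<gamma>))) * \<bar>h - 0\<bar>"
      by (rule vector_derivative_bound[OF T_has_vector_derivative T_high[OF b]])
    then show ?thesis unfolding d_def e using h by (simp add: mult_ac)
  qed
  let ?C = "(2 * W b s * M) / (1 - 2 powr (- (p / a b))) + (W b (Suc s) * M) / (1 - 2 powr (- ((1 - p) / a b)))"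
  let ?S = "\<lambda>N x. \<Sum>n<N. T2 b s n x"
  have S: "cmod (?S N (x + h *\<^sub>R b) - ?S N x) \<le> ?C * h powr p" for N
  proof -
    have "cmod (?S N (x + h *\<^sub>R b) - ?S N x) = cmod (\<Sum>n<N. (T b s (int n) (x + h *\<^sub>R b) - T b s (int n) x) +
       (T b s (- int n - 1) (x + h *\<^sub>R b) - T b s (- int n - 1) x))"
      unfolding sum_subtractf[symmetric] by (simp add: algebra_simps)
    also have "\<dots> \<le> (\<Sum>n<N. d (int n) + d (- int n - 1))"
      unfolding d_def by (intro sum_norm_le norm_triangle_ineq)
    also have "\<dots> = (\<Sum>j\<in>int ` {..<N}. d j) + (\<Sum>j\<in>(\<lambda>n. - int n - 1) ` {..<N}. d j)"
      by (simp add: sum.distrib sum.reindex inj_on_def)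
    also have "\<dots> = (\<Sum>j\<in>int ` {..<N} \<union> (\<lambda>n. - int n - 1) ` {..<N}. d j)"
      by (rule sum.union_disjoint[symmetric]) auto
    also have "\<dots> \<le> ?C * h powr p"
      using W_nonneg[OF b] M_nonneg
      by (intro sum_two_sided_geometric_le[OF h ab p _ _ _ d1 d2]) auto
    finally show ?thesis .
  qed
  have "(\<lambda>N. ?S N (x + h *\<^sub>R b) - ?S N x) \<longlonglongrightarrow> V b s (x + h *\<^sub>R b) - V b s x"
    using V_sums[OF b s(1)] unfolding sums_def by (intro tendsto_diff) auto
  then have "cmod (V b s (x + h *\<^sub>R b) - V b s x) \<le> ?C * h powr p"
    using S by (intro tendsto_upperbound[OF tendsto_norm]) (auto intro: always_eventually)
  also have "?C = (2 * W b s / (1 - 2 powr (- (p / a b))) + W b (Suc s) / (1 - 2 powr (- ((1 - p) / a b)))) * M"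
    by (simp add: algebra_simps)
  finally show ?thesis .
qed

end

section \<open>Identification of the sum as an inverse transform in L2\<close>

locale littlewood_paley_L2 = littlewood_paley +
  assumes g_cont: "continuous_on (- {0}) g" and g_sq: "square_integrable g"
begin

text \<open>What telescoping leaves of the sum of \<open>theta j\<close> over -N <= j < N. It
  vanishes near the origin and tends to 1 away from it.\<close>

definition Z :: "nat \<Rightarrow> 'a \<Rightarrow> complex" where
  "Z N \<xi> = \<eta> (adil (- int N) \<xi>) - \<eta> (adil (int N) \<xi>)"

lemma Cc_eta_adil: "Cc (\<lambda>\<xi>. \<eta> (adil j \<xi>))"
  unfolding Cc_def
proof
  show "continuous_on UNIV (\<lambda>\<xi>. \<eta> (adil j \<xi>))"
    by (rule continuous_on_compose2[OF CcD(1)[OF \<eta>(1)] continuous_adil]) simp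
  have "rho \<xi> \<le> 2 powr (- j)" if "\<eta> (adil j \<xi>) \<noteq> 0" for \<xi>
  proof -
    have "rho (adil j \<xi>) < 1" using \<eta>(3)[of "adil j \<xi>"] that by force
    then show ?thesis by (simp add: rho_adil powr_minus divide_simps mult_ac)
  qed
  then show "bounded {\<xi>. \<eta> (adil j \<xi>) \<noteq> 0}"
    by (intro bounded_subset[OF bounded_rho_le[of "2 powr (- j)"]]) auto
qed

lemma Cc_Z: "Cc (Z N)"
proof -
  have "bounded ({\<xi>. \<eta> (adil (- int N) \<xi>) \<noteq> 0} \<union> {\<xi>. \<eta> (adil (int N) \<xi>) \<noteq> 0})"
    using CcD(2)[OF Cc_eta_adil] by simp
  then have "bounded {\<xi>. Z N \<xi> \<noteq> 0}"
    by (rule bounded_subset) (auto simp: Z_def)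
  then show ?thesis
    unfolding Cc_def using CcD(1)[OF Cc_eta_adil] by (auto simp: Z_def[abs_def] intro!: continuous_intros)
qed

lemma Z_eq_0: "2 powr real N * rho \<xi> \<le> 1/2 \<Longrightarrow> Z N \<xi> = 0"
proof -
  assume *: "2 powr real N * rho \<xi> \<le> 1/2"
  have "2 powr (- real N) * rho \<xi> \<le> 2 powr real N * rho \<xi>"
    by (intro mult_right_mono powr_mono rho_nonneg) auto
  with * show ?thesis by (simp add: Z_def \<eta>(2) rho_adil)
qed

lemma Z_tendsto: "\<xi> \<noteq> 0 \<Longrightarrow> (\<lambda>N. Z N \<xi>) \<longlonglongrightarrow> 1"
proof -
  assume "\<xi> \<noteq> 0"
  then have r: "rho \<xi> > 0" using rho_nonneg[of \<xi>] rho_eq_0_iff[of \<xi>] by linarith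
  obtain N where N: "max (2 * rho \<xi>) (1 / rho \<xi>) < 2 ^ N"
    using real_arch_pow[of 2 "max (2 * rho \<xi>) (1 / rho \<xi>)"] by auto
  have "eventually (\<lambda>n. Z n \<xi> = 1) sequentially"
    using eventually_ge_at_top[of N]
  proof eventually_elim
    case (elim n)
    then have *: "(2::real) ^ N \<le> 2 ^ n" by (intro power_increasing) auto
    have n: "2 * rho \<xi> < 2 ^ n" "1 / rho \<xi> < 2 ^ n"
      using N by (auto intro: less_le_trans[OF _ *])
    have "rho (adil (- int n) \<xi>) \<le> 1/2"
      using n(1) by (simp add: rho_adil powr_minus powr_realpow divide_simps mult_ac)
    moreover have "rho (adil (int n) \<xi>) \<ge> 1"
      using n(2) r by (simp add: rho_adil powr_realpow divide_simps mult_ac)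
    ultimately show ?case by (simp add: Z_def \<eta>)
  qed
  then show ?thesis by (rule tendsto_eventually)
qed

text \<open>\<open>g\<close> need not be continuous at the origin; the product is, because
  \<open>Z N\<close> vanishes in a neighbourhood of it. Two open sets on which continuity is clear
  cover the space.\<close>

lemma Cc_Zg: "Cc (\<lambda>\<xi>. Z N \<xi> * (c * g \<xi>))"
  unfolding Cc_def
proof
  have "continuous_on (- {0} \<union> {\<xi>. 2 powr real N * rho \<xi> < 1/2}) (\<lambda>\<xi>. Z N \<xi> * (c * g \<xi>))"
  proof (rule continuous_on_open_Un)
    show "open {\<xi>. 2 powr real N * rho \<xi> < 1/2}"
      by (intro open_Collect_less continuous_intros continuous_rho)
    show "continuous_on (- {0}) (\<lambda>\<xi>. Z N \<xi> * (c * g \<xi>))"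
      using continuous_on_subset[OF CcD(1)[OF Cc_Z]] g_cont by (intro continuous_intros) auto
    have "continuous_on {\<xi>. 2 powr real N * rho \<xi> < 1/2} (\<lambda>_. 0 :: complex)" by simp
    then show "continuous_on {\<xi>. 2 powr real N * rho \<xi> < 1/2} (\<lambda>\<xi>. Z N \<xi> * (c * g \<xi>))"
      by (rule continuous_on_eq) (simp add: Z_eq_0)
  qed auto
  also have "- {0} \<union> {\<xi>. 2 powr real N * rho \<xi> < 1/2} = UNIV" by auto
  finally show "continuous_on UNIV (\<lambda>\<xi>. Z N \<xi> * (c * g \<xi>))" .
  show "bounded {\<xi>. Z N \<xi> * (c * g \<xi>) \<noteq> 0}"
    by (rule bounded_subset[OF CcD(2)[OF Cc_Z[of N]]]) auto
qed

lemma partial_sum_eq: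
  "(\<Sum>n<N. T2 b 0 n x) = fourier (\<lambda>\<xi>. Z N \<xi> * g \<xi>) (- x)"
proof (induction N)
  case 0
  have "(\<lambda>\<xi>. Z 0 \<xi> * g \<xi>) = (\<lambda>\<xi>. 0)" by (simp add: Z_def)
  then show ?case by (simp add: fourier_def)
next
  case (Suc N)
  have i: "integrable lborel (\<lambda>\<xi>. theta j \<xi> * g \<xi>)" for j
    using integrable_poly_theta[of 1 0 0 j] by simp
  have iZ: "integrable lborel (\<lambda>\<xi>. Z N \<xi> * g \<xi>)"
    using CcD(4)[OF Cc_Zg[of N 1]] by simp
  have "Z (Suc N) \<xi> * g \<xi> = Z N \<xi> * g \<xi> + (theta (int N) \<xi> * g \<xi> + theta (- int N - 1) \<xi> * g \<xi>)" for \<xi>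
    by (simp add: Z_def theta_def adil_adil algebra_simps)
  then have "fourier (\<lambda>\<xi>. Z (Suc N) \<xi> * g \<xi>) (- x) = fourier (\<lambda>\<xi>. Z N \<xi> * g \<xi>) (- x) + 
     (T b 0 (int N) x + T b 0 (- int N - 1) x)"
    unfolding T_def using i iZ by (simp add: fourier_add)
  then show ?case using Suc.IH by simp
qed

lemma V0_tendsto:
  assumes "b \<in> Basis"
  shows "(\<lambda>N. fourier (\<lambda>\<xi>. Z N \<xi> * g \<xi>) (- x)) \<longlonglongrightarrow> V b 0 x"
  using V_sums[OF assms, of 0 x] a_pos[OF assms] \<gamma> unfolding sums_def partial_sum_eq by simp

text \<open>The transforms \<open>GG N\<close> of the partial sums converge in L2 by domination,
  whereas the sums themselves are so far known to converge only pointwise. Plancherel carries the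
  Cauchy property over to the sums, and Fatou identifies their L2 limit with
  \<open>V b 0\<close>.\<close>

lemma V0_has_L2_fourier:
  assumes b: "b \<in> Basis"
  shows "has_L2_fourier (V b 0) (\<lambda>\<xi>. (2 * pi) ^ DIM('a) * g \<xi>)"
proof -
  define c where "c = complex_of_real ((2 * pi) ^ DIM('a))"
  have c0: "c \<noteq> 0" by (simp add: c_def)
  define GG where "GG N \<xi> = Z N \<xi> * (c * g \<xi>)" for N \<xi>
  define S where "S N x = fourier (\<lambda>\<xi>. Z N \<xi> * g \<xi>) (- x)" for N x
  have GG: "Cc (GG N)" for N unfolding GG_def by (rule Cc_Zg)
  have S_eq: "S N x = fourier (GG N) (- x) / c" for N x
  proof -
    have "GG N = (\<lambda>\<xi>. c * (Z N \<xi> * g \<xi>))" by (simp add: GG_def fun_eq_iff mult_ac)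
    then show ?thesis unfolding S_def using c0 by (simp add: fourier_cmult)
  qed
  have SL: "has_L2_fourier (S N) (GG N)" for N
    using has_L2_fourier_inverse[OF CcD(6)[OF GG]] unfolding S_eq[abs_def] c_def .
  have cg: "square_integrable (\<lambda>\<xi>. c * g \<xi>)"
    using g_sq unfolding square_integrable_def by (auto simp: norm_mult power_mult_distrib)
  have mS[measurable]: "S N \<in> borel_measurable borel" for N
    using SL by (auto simp: has_L2_fourier_def square_integrable_measurable)
  have mG[measurable]: "GG N \<in> borel_measurable borel" for N by (rule CcD(5)[OF GG])
  have mg[measurable]: "(\<lambda>\<xi>. c * g \<xi>) \<in> borel_measurable borel" by measurable
  obtain B where B: "\<And>x. cmod (\<eta> x) \<le> B"
    using bounded_range_obtain[OF CcD(3)[OF \<eta>(1)]] by blast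
  let ?d = "\<lambda>N. nn2 (\<lambda>\<xi>. GG N \<xi> - c * g \<xi>)" and ?w = "\<lambda>\<xi>. ennreal ((2 * B + 1)\<^sup>2 * (cmod (c * g \<xi>))\<^sup>2)"
  have GL: "L2_tendsto GG (\<lambda>\<xi>. c * g \<xi>)"
    unfolding L2_tendsto_def
  proof -
    have "(\<lambda>N. ?d N) \<longlonglongrightarrow> (\<integral>\<^sup>+\<xi>. 0 \<partial>(lborel :: 'a measure))"
    proof (rule nn_integral_dominated_convergence[where w="\<lambda>\<xi>. ?w \<xi>"])
      have "(\<integral>\<^sup>+\<xi>. ?w \<xi> \<partial>lborel) = ennreal ((2 * B + 1)\<^sup>2) * nn2 (\<lambda>\<xi>. c * g \<xi>)"
        by (simp add: ennreal_mult nn_integral_cmult)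
      then show "(\<integral>\<^sup>+\<xi>. ?w \<xi> \<partial>lborel) < \<infinity>"
        using cg by (simp add: square_integrable_iff ennreal_mult_less_top)
      have d: "GG N \<xi> - c * g \<xi> = (Z N \<xi> - 1) * (c * g \<xi>)" for N \<xi>
        by (simp add: GG_def algebra_simps)
      have "cmod (Z N \<xi> - 1) \<le> 2 * B + 1" for N \<xi>
      proof -
        have "cmod (Z N \<xi> - 1) \<le> (cmod (\<eta> (adil (- int N) \<xi>)) + cmod (\<eta> (adil (int N) \<xi>))) + 1"
          unfolding Z_def by (rule order_trans[OF norm_triangle_ineq4]) (simp add: norm_triangle_ineq4)
        then show ?thesis using B[of "adil (- int N) \<xi>"] B[of "adil (int N) \<xi>"] by linarith
      qed
      then show "AE \<xi> in lborel. ennreal ((cmod (GG N \<xi> - c * g \<xi>))\<^sup>2) \<le> ?w \<xi>" for N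
        unfolding d norm_mult[of "Z N _ - 1"] power_mult_distrib[of "cmod (Z N _ - 1)"]
        by (intro AE_I2 ennreal_leI mult_right_mono power_mono) auto
      show "AE \<xi> in lborel. (\<lambda>N. ennreal ((cmod (GG N \<xi> - c * g \<xi>))\<^sup>2)) \<longlonglongrightarrow> 0"
        using AE_lborel_singleton[of 0]
      proof eventually_elim
        case (elim \<xi>)
        have "(\<lambda>N. ennreal ((cmod (GG N \<xi> - c * g \<xi>))\<^sup>2)) \<longlonglongrightarrow> ennreal ((cmod ((1 - 1) * (c * g \<xi>)))\<^sup>2)"
          unfolding d by (intro tendsto_ennrealI tendsto_intros Z_tendsto elim)
        then show ?case by simp
      qed
    qed measurable
    then show "(\<lambda>N. ?d N) \<longlonglongrightarrow> 0" by simp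
  qed
  define k where "k = ennreal (1 / (2 * pi) ^ DIM('a))"
  have kfin: "k < \<infinity>" "k \<noteq> 0" by (simp_all add: k_def ennreal_eq_0_iff not_le)
  \<comment> \<open>Plancherel for differences: \<open>k\<close> collects
    \<open>1 / (cmod c)\<^sup>2\<close> from the normalisation of \<open>S\<close> and
    \<open>(2 * pi) ^ DIM('a)\<close> from the identity itself.\<close>
  have Sd: "nn2 (\<lambda>x. S N x - S m x) = k * nn2 (\<lambda>\<xi>. GG N \<xi> - GG m \<xi>)" for N m
  proof -
    let ?f = "\<lambda>\<xi>. GG N \<xi> - GG m \<xi>"
    have d: "bcL1 ?f" by (intro bcL1_diff CcD(6) GG)
    have F: "fourier ?f x = fourier (GG N) x - fourier (GG m) x" for x
      by (rule fourier_diff) (auto intro: CcD(4) GG)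
    define FD where "FD = fourier ?f"
    have [measurable]: "FD \<in> borel_measurable borel"
      unfolding FD_def by (rule borel_measurable_fourier[OF bcL1D(3)[OF d]])
    have "nn2 (\<lambda>x. S N x - S m x) = nn2 (\<lambda>x. FD (- x) / c)"
      by (simp add: FD_def S_eq F diff_divide_distrib)
    also have "\<dots> = (\<integral>\<^sup>+x. ennreal (1 / (cmod c)\<^sup>2) * ennreal ((cmod (FD (- x)))\<^sup>2) \<partial>lborel)"
      by (simp add: norm_divide power_divide flip: ennreal_mult)
    also have "\<dots> = ennreal (1 / (cmod c)\<^sup>2) * (\<integral>\<^sup>+x. ennreal ((cmod (FD (- x)))\<^sup>2) \<partial>lborel)"
      by (intro nn_integral_cmult) measurable
    also have "(\<integral>\<^sup>+x. ennreal ((cmod (FD (- x)))\<^sup>2) \<partial>lborel) = nn2 FD"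
      by (intro nn_integral_lborel_minus[of "\<lambda>x. ennreal ((cmod (FD x))\<^sup>2)"]) measurable
    also have "nn2 FD = ennreal ((2 * pi) ^ DIM('a)) * nn2 ?f"
      unfolding plancherel_nn[OF d] FD_def mult.assoc[symmetric] by (simp flip: ennreal_mult)
    also have "ennreal (1 / (cmod c)\<^sup>2) * (ennreal ((2 * pi) ^ DIM('a)) * nn2 ?f) = k * nn2 ?f"
      unfolding k_def mult.assoc[symmetric] c_def
      by (simp add: norm_mult norm_power power2_eq_square flip: ennreal_mult)
    finally show ?thesis .
  qed
  have Sconv: "(\<lambda>m. S m x) \<longlonglongrightarrow> V b 0 x" for x
    unfolding S_def by (rule V0_tendsto[OF b])
  have mV[measurable]: "V b 0 \<in> borel_measurable borel"
    by (rule borel_measurable_LIMSEQ_metric[OF mS Sconv])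
  \<comment> \<open>Fatou in \<open>m\<close>: the distance to the pointwise limit is at most the
    lower limit of the distances between partial sums.\<close>
  have bound: "nn2 (\<lambda>x. S N x - V b 0 x) \<le> k * (2 * ?d N)" for N
  proof -
    have "nn2 (\<lambda>x. S N x - V b 0 x) = (\<integral>\<^sup>+x. liminf (\<lambda>m. ennreal ((cmod (S N x - S m x))\<^sup>2)) \<partial>lborel)"
      by (intro nn_integral_cong lim_imp_Liminf[symmetric] tendsto_ennrealI tendsto_intros Sconv) auto
    also have "\<dots> \<le> liminf (\<lambda>m. nn2 (\<lambda>x. S N x - S m x))"
      by (rule nn_integral_liminf) measurable
    also have "\<dots> \<le> liminf (\<lambda>m. k * (2 * ?d N + 2 * nn2 (\<lambda>\<xi>. GG m \<xi> - c * g \<xi>)))"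
    proof (intro Liminf_mono always_eventually allI)
      fix m
      show "nn2 (\<lambda>x. S N x - S m x) \<le> k * (2 * ?d N + 2 * nn2 (\<lambda>\<xi>. GG m \<xi> - c * g \<xi>))"
        unfolding Sd nn2_diff_commute[of "GG m"]
        by (intro mult_left_mono nn2_diff_trans mG mg) simp
    qed
    also have "\<dots> = k * (2 * ?d N + 2 * 0)"
      using GL kfin unfolding L2_tendsto_def
      by (intro lim_imp_Liminf tendsto_mult_ennreal tendsto_add tendsto_const) auto
    finally show ?thesis by simp
  qed
  have SV: "L2_tendsto S (V b 0)"
    unfolding L2_tendsto_def
  proof (rule tendsto_sandwich[OF _ _ tendsto_const])
    show "eventually (\<lambda>N. 0 \<le> nn2 (\<lambda>x. S N x - V b 0 x)) sequentially" by simp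
    show "eventually (\<lambda>N. nn2 (\<lambda>x. S N x - V b 0 x) \<le> k * (2 * ?d N)) sequentially"
      using bound by simp
    have "(\<lambda>N. k * (2 * ?d N)) \<longlonglongrightarrow> k * (2 * 0)"
      using GL kfin unfolding L2_tendsto_def by (intro tendsto_mult_ennreal tendsto_const) auto
    then show "(\<lambda>N. k * (2 * ?d N)) \<longlonglongrightarrow> 0" by simp
  qed
  have VS: "square_integrable (V b 0)"
  proof -
    have s: "square_integrable (\<lambda>\<xi>. GG 0 \<xi> - c * g \<xi>)"
      by (intro square_integrable_diff cg square_integrable_bcL1 CcD(6) GG)
    have "nn2 (\<lambda>x. S 0 x - V b 0 x) < \<infinity>"
      using s kfin by (intro order.strict_trans1[OF bound]) (auto simp: square_integrable_iff ennreal_mult_less_top)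
    then have "square_integrable (\<lambda>x. S 0 x - V b 0 x)"
      by (simp add: square_integrable_iff)
    moreover have "square_integrable (S 0)" using SL by (auto simp: has_L2_fourier_def)
    ultimately have "square_integrable (\<lambda>x. S 0 x - (S 0 x - V b 0 x))"
      by (rule square_integrable_diff[rotated])
    then show ?thesis by simp
  qed
  show ?thesis
    using has_L2_fourier_limit[OF SL SV GL VS cg] unfolding c_def by simp
qed

end

section \<open>Hoelder seminorms of the Littlewood--Paley sum\<close>

text \<open>The constant of \<open>V_holder\<close> for \<open>s\<close> the integer part and
  \<open>p\<close> the fractional part of the order, with the factor \<open>M\<close> removed.
  Standing outside the locale, it visibly depends on \<open>a\<close>, \<open>W\<close>,
  \<open>\<gamma>\<close> and the direction alone.\<close>

definition holder_const :: "('a \<Rightarrow> real) \<Rightarrow> ('a \<Rightarrow> nat \<Rightarrow> real) \<Rightarrow> real \<Rightarrow> 'a \<Rightarrow> real" where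
  "holder_const a W \<gamma> b = (let s = nat \<lfloor>a b * \<gamma>\<rfloor>; p = a b * \<gamma> - real s in
     2 * W b s / (1 - 2 powr (- (p / a b))) + W b (Suc s) / (1 - 2 powr (- ((1 - p) / a b))))"

context littlewood_paley
begin

text \<open>With \<open>s = 0\<close> the factor carrying the direction is 1, so one and the same
  function is estimated in all directions.\<close>

lemma V0_eq: "V b 0 = V b' 0"
  by (simp add: V_def[abs_def] T_def[abs_def])

lemma pderiv_dir_V:
  assumes b: "b \<in> Basis" and i: "real i < a b * \<gamma>"
  shows "(pderiv_dir b ^^ i) (V b 0) = V b i"
  using i
proof (induction i)
  case (Suc i)
  have "pderiv_dir b (V b i) = V b (Suc i)"
    unfolding pderiv_dir_def
    using vector_derivative_at[OF V_has_vector_derivative[OF b, where t=0]] Suc.prems by auto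
  then show ?case using Suc by simp
qed simp

lemma holder_const_nonneg:
  assumes b: "b \<in> Basis" and ni: "a b * \<gamma> \<notin> \<int>"
  shows "holder_const a W \<gamma> b \<ge> 0"
proof -
  define p where "p = a b * \<gamma> - nat \<lfloor>a b * \<gamma>\<rfloor>"
  have ab: "a b > 0" using a_pos[OF b] .
  then have "a b * \<gamma> > 0" using \<gamma> by simp
  then have p: "p = frac (a b * \<gamma>)" by (simp add: p_def frac_def)
  have "0 < p" "p < 1" using ni frac_lt_1 by (auto simp: p frac_gt_0_iff)
  then have "2 powr (- (p / a b)) < 1" "2 powr (- ((1 - p) / a b)) < 1"
    using ab by (auto simp: powr_less_one)
  then show ?thesis
    unfolding holder_const_def Let_def p_def[symmetric] using W_nonneg[OF b] by simp
qed

text \<open>A non-integer order lies strictly between \<open>s\<close> and \<open>Suc s\<close>: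
  derivatives up to order \<open>s\<close> exist by termwise differentiation, and
  \<open>V_holder\<close> bounds the increments of the last one.\<close>

lemma holder_seminorm_V:
  assumes b: "b \<in> Basis" and ni: "a b * \<gamma> \<notin> \<int>"
  shows "holder_seminorm b (a b * \<gamma>) (V b 0) \<le> ennreal (holder_const a W \<gamma> b * M)"
proof -
  define s where "s = nat \<lfloor>a b * \<gamma>\<rfloor>"
  define p where "p = a b * \<gamma> - s"
  have pos: "a b * \<gamma> > 0" using \<gamma> a_pos[OF b] by simp
  then have s: "of_int \<lfloor>a b * \<gamma>\<rfloor> = real s" by (simp add: s_def)
  have "frac (a b * \<gamma>) > 0" using ni by (simp add: frac_gt_0_iff)
  then have s1: "real s < a b * \<gamma>" by (simp add: frac_def s)
  have s2: "a b * \<gamma> < real (Suc s)" using frac_lt_1[of "a b * \<gamma>"] by (simp add: frac_def s)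
  have diff: "\<forall>i<s. \<forall>x. (\<lambda>t. (pderiv_dir b ^^ i) (V b 0) (x + t *\<^sub>R b)) differentiable (at 0)"
  proof (intro allI impI)
    fix i x assume "i < s"
    then have "real (Suc i) < a b * \<gamma>" using s1 by linarith
    then show "(\<lambda>t. (pderiv_dir b ^^ i) (V b 0) (x + t *\<^sub>R b)) differentiable (at 0)"
      using differentiableI_vector[OF V_has_vector_derivative[OF b]] pderiv_dir_V[OF b, of i] by auto
  qed
  have C: "holder_const a W \<gamma> b = 2 * W b s / (1 - 2 powr (- (p / a b))) + W b (Suc s) / (1 - 2 powr (- ((1 - p) / a b)))"
    by (simp add: holder_const_def Let_def s_def p_def)
  have "ennreal (cmod (V b s (x + h *\<^sub>R b) - V b s x) / h powr p) \<le> ennreal (holder_const a W \<gamma> b * M)"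
    if "h > 0" for x h
    using V_holder[OF b s1 s2 that, of x] that unfolding C p_def
    by (intro ennreal_leI) (simp add: divide_le_eq)
  then have "(SUP x. SUP h\<in>{0<..}. ennreal (cmod (V b s (x + h *\<^sub>R b) - V b s x) / h powr p)) \<le> ennreal (holder_const a W \<gamma> b * M)"
    by (intro SUP_least) auto
  then show ?thesis
    unfolding holder_seminorm_def s s_def[symmetric] p_def[symmetric] using diff
    by (simp add: pderiv_dir_V[OF b s1])
qed

end

section \<open>Cancellation in the first group of variables\<close>

text \<open>A function of \<open>x2\<close> alone is a limit of superpositions of the characters \<open>x2 \<mapsto> e^(i x2 \<zeta>)\<close>,
  and the pairing with such a character is a value of the transform at \<open>(0, - \<zeta>)\<close>.\<close>

lemma integral_snd_eq_0:
  fixes n :: "'a::euclidean_space \<times> 'b::euclidean_space \<Rightarrow> complex" and U :: "'b \<Rightarrow> complex"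
  assumes n: "integrable lborel n" and z: "\<And>\<zeta>. fourier n (0, \<zeta>) = 0" and U: "bcL1 U"
  shows "(LINT y|lborel. n y * U (snd y)) = 0"
proof -
  obtain e :: "nat \<Rightarrow> real" where e: "\<And>n. e n > 0" "e \<longlonglongrightarrow> 0"
    by (rule exists_null_sequence) blast
  obtain B where B: "\<And>x. cmod (U x) \<le> B"
    using bounded_range_obtain[OF bcL1D(2)[OF U]] by blast
  note Ui = bcL1D(3)[OF U]
  have snd [measurable]: "snd \<in> borel_measurable (borel :: ('a \<times> 'b) measure)"
    by (intro borel_measurable_continuous_onI continuous_intros)
  note nm [measurable] = borel_measurable_integrable[OF n]
  have mm: "mollify (e k) U \<in> borel_measurable borel" for k
    using bcL1D(4)[OF bcL1_conv[OF Ui bcL1_gkernel[OF e(1)]]] .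
  have zero: "(LINT y|lborel. n y * mollify (e k) U (snd y)) = 0" for k
  proof -
    \<comment> \<open>The Gaussian factor makes \<open>w\<close> integrable, as Fubini requires,
      although \<open>fourier U\<close> need not be.\<close>
    define w where "w \<zeta> = fourier U \<zeta> * gauss (e k *\<^sub>R \<zeta>)" for \<zeta>
    have w: "integrable lborel w"
      unfolding w_def
      by (rule integrable_bounded_times(1)[OF cmod_fourier_le borel_measurable_fourier[OF Ui] integrable_gauss_scaled[OF e(1)]])
    note wm [measurable] = borel_measurable_integrable[OF w]
    let ?h = "\<lambda>y \<zeta>. exp (- \<i> * of_real (\<zeta> \<bullet> (- snd y))) * (n y * w \<zeta>)"
    have "(\<lambda>z::('a\<times>'b)\<times>'b. exp (- \<i> * of_real (snd z \<bullet> (- snd (fst z))))) \<in> borel_measurable borel"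
      by (intro borel_measurable_continuous_onI continuous_intros)
    then have [measurable]: "(\<lambda>z::('a\<times>'b)\<times>'b. exp (- \<i> * of_real (snd z \<bullet> (- snd (fst z))))) \<in> borel_measurable (lborel \<Otimes>\<^sub>M lborel)"
      unfolding lborel_prod by simp
    have i: "integrable (lborel \<Otimes>\<^sub>M lborel) (case_prod ?h)"
      using integrable_pair_times[OF n w]
    proof (rule integrable_dominated)
      show "case_prod ?h \<in> borel_measurable (lborel \<Otimes>\<^sub>M lborel)"
        unfolding case_prod_beta by measurable
    qed (auto simp: norm_mult norm_exp_eq_Re)
    have "(2 * pi) ^ DIM('b) * (LINT y|lborel. n y * mollify (e k) U (snd y))
       = (LINT y|lborel. n y * fourier w (- snd y))"
      unfolding w_def fourier_gauss_times_fourier[OF Ui e(1)]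
      by (subst integral_mult_right_zero[symmetric]) (simp add: mult.left_commute)
    also have "\<dots> = (LINT y|lborel. LINT \<zeta>|lborel. ?h y \<zeta>)"
      unfolding fourier_def by (simp add: mult.left_commute flip: integral_mult_right_zero)
    also have "\<dots> = (LINT \<zeta>|lborel. LINT y|lborel. ?h y \<zeta>)"
      by (rule lborel_pair.Fubini_integral[OF i, symmetric])
    also have "\<dots> = (LINT \<zeta>|lborel. w \<zeta> * fourier n (0, - \<zeta>))"
    proof (intro LINT_cong refl)
      fix \<zeta> :: 'b
      have "(LINT y|lborel. ?h y \<zeta>) = (LINT y|lborel. w \<zeta> * (exp (- \<i> * of_real (y \<bullet> (0, - \<zeta>))) * n y))"
        by (intro LINT_cong) (auto simp: inner_prod_def inner_commute[of \<zeta>])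
      also have "\<dots> = w \<zeta> * fourier n (0, - \<zeta>)"
        unfolding fourier_def by (rule integral_mult_right_zero)
      finally show "(LINT y|lborel. ?h y \<zeta>) = w \<zeta> * fourier n (0, - \<zeta>)" .
    qed
    finally show ?thesis by (simp add: z)
  qed
  have "(\<lambda>k. LINT y|lborel. n y * mollify (e k) U (snd y)) \<longlonglongrightarrow> (LINT y|lborel. n y * U (snd y))"
  proof (rule integral_dominated_convergence[where w="\<lambda>y. cmod (n y) * B"])
    show "AE y in lborel. (\<lambda>k. n y * mollify (e k) U (snd y)) \<longlonglongrightarrow> n y * U (snd y)"
      by (intro AE_I2 tendsto_intros mollify_tendsto bcL1D[OF U] e)
    show "AE y in lborel. norm (n y * mollify (e k) U (snd y)) \<le> cmod (n y) * B" for k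
      using mollify_bound[OF bcL1D(4)[OF U] e(1) B] by (auto simp: norm_mult intro!: mult_left_mono)
    show "(\<lambda>y. n y * mollify (e k) U (snd y)) \<in> borel_measurable lborel" for k
      using measurable_compose[OF snd mm[of k]] nm by auto
    show "(\<lambda>y. n y * U (snd y)) \<in> borel_measurable lborel"
      using measurable_compose[OF snd bcL1D(4)[OF U]] nm by auto
  qed (use n in auto)
  then show ?thesis
    unfolding zero by (simp add: LIMSEQ_const_iff)
qed

text \<open>The increments are performed one direction at a time. A negative step is read backwards
  from its end point, as the assumption only covers h > 0.\<close>

lemma holder_path:
  fixes u :: "'a::real_vector \<Rightarrow> complex"
  assumes "finite K" and H: "\<And>k x h. k \<in> K \<Longrightarrow> h > 0 \<Longrightarrow> cmod (u (x + h *\<^sub>R e k) - u x) \<le> H * h powr l k"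
  shows "cmod (u (x + (\<Sum>k\<in>K. c k *\<^sub>R e k)) - u x) \<le> H * (\<Sum>k\<in>K. \<bar>c k\<bar> powr l k)"
  using assms
proof (induction K rule: finite_induct)
  case (insert k K)
  let ?y = "x + (\<Sum>k\<in>K. c k *\<^sub>R e k)"
  have "cmod (u (?y + c k *\<^sub>R e k) - u ?y) \<le> H * \<bar>c k\<bar> powr l k"
  proof (cases "c k" "0::real" rule: linorder_cases)
    case less
    then have "cmod (u ((?y + c k *\<^sub>R e k) + (- c k) *\<^sub>R e k) - u (?y + c k *\<^sub>R e k)) \<le> H * (- c k) powr l k"
      by (intro insert.prems) auto
    then show ?thesis using less by (simp add: norm_minus_commute)
  next
    case greater
    then show ?thesis using insert.prems[of k "c k" ?y] by simp
  qed simp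
  moreover have "cmod (u ?y - u x) \<le> H * (\<Sum>k\<in>K. \<bar>c k\<bar> powr l k)"
    using insert by auto
  moreover have eq: "x + (\<Sum>k\<in>insert k K. c k *\<^sub>R e k) = ?y + c k *\<^sub>R e k"
    using insert.hyps by simp
  ultimately show ?case
    unfolding eq using insert.hyps norm_triangle_ineq[of "u (?y + c k *\<^sub>R e k) - u ?y" "u ?y - u x"]
    by (simp add: distrib_left)
qed simp

section \<open>The product space\<close>

text \<open>A linear form whose values at the unit vectors are the exponents; it merges the two
  index types into one function on \<open>Basis\<close>.\<close>

definition pair_exponent :: "('k::finite \<Rightarrow> real) \<Rightarrow> ('l::finite \<Rightarrow> real) \<Rightarrow> (real^'k) \<times> (real^'l) \<Rightarrow> real" where
  "pair_exponent \<alpha> \<beta> b = (\<Sum>k\<in>UNIV. \<alpha> k * fst b $ k) + (\<Sum>k\<in>UNIV. \<beta> k * snd b $ k)"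

lemma pair_exponent_simps [simp]:
  "pair_exponent \<alpha> \<beta> (axis k 1, 0) = \<alpha> k" "pair_exponent \<alpha> \<beta> (0, axis k' 1) = \<beta> k'"
  by (simp_all add: pair_exponent_def axis_def if_distrib sum.delta cong: if_cong)

lemma Basis_pair: "(Basis :: ((real^'k::finite) \<times> (real^'l::finite)) set) =
    range (\<lambda>k. (axis k 1, 0)) \<union> range (\<lambda>k. (0, axis k 1))"
  unfolding Basis_prod_def Basis_vec_def by auto

lemma axis_pair_Basis [simp]:
  "(axis k 1, 0) \<in> (Basis :: ((real^'k::finite) \<times> (real^'l::finite)) set)"
  "(0, axis k' 1) \<in> (Basis :: ((real^'k::finite) \<times> (real^'l::finite)) set)"
  by (auto simp: Basis_pair)

lemma
  fixes f :: "(real^'k::finite) \<times> (real^'l::finite) \<Rightarrow> 'c::comm_monoid_add"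
  shows sum_Basis_pair: "sum f Basis = (\<Sum>k\<in>UNIV. f (axis k 1, 0)) + (\<Sum>k\<in>UNIV. f (0, axis k 1))"
proof -
  have "sum f Basis = sum f (range (\<lambda>k. (axis k 1, 0))) + sum f (range (\<lambda>k. (0, axis k 1)))"
    unfolding Basis_pair by (rule sum.union_disjoint) (auto simp: axis_eq_0_iff)
  then show ?thesis
    by (simp add: sum.reindex inj_on_def axis_eq_axis)
qed

lemma
  fixes f :: "(real^'k::finite) \<times> (real^'l::finite) \<Rightarrow> 'c::comm_monoid_mult"
  shows prod_Basis_pair: "prod f Basis = (\<Prod>k\<in>UNIV. f (axis k 1, 0)) * (\<Prod>k\<in>UNIV. f (0, axis k 1))"
proof -
  have "prod f Basis = prod f (range (\<lambda>k. (axis k 1, 0))) * prod f (range (\<lambda>k. (0, axis k 1)))"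
    unfolding Basis_pair by (rule prod.union_disjoint) (auto simp: axis_eq_0_iff)
  then show ?thesis
    by (simp add: prod.reindex inj_on_def axis_eq_axis)
qed

lemma inner_axis_pair: "x \<bullet> (axis k 1, 0) = fst x $ k" "x \<bullet> (0, axis k' 1) = snd x $ k'"
  for x :: "(real^'k::finite) \<times> (real^'l::finite)"
  by (simp_all add: inner_prod_def inner_axis)

locale aniso_pair =
  fixes \<alpha> :: "'k::finite \<Rightarrow> real" and \<beta> :: "'l::finite \<Rightarrow> real"
  assumes \<alpha>: "\<And>k. 0 < \<alpha> k" and \<beta>: "\<And>k. 0 < \<beta> k"
begin

abbreviation "ex \<equiv> pair_exponent \<alpha> \<beta>"

sublocale aniso "pair_exponent \<alpha> \<beta>"
  by standard (use \<alpha> \<beta> in \<open>auto simp: Basis_pair\<close>)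

lemma rho_eq: "rho x = aniso_rho \<alpha> \<beta> x"
  by (simp add: rho_def aniso_rho_def sum_Basis_pair inner_axis_pair)

lemma adil_eq: "adil j x = dil \<alpha> \<beta> j x"
proof (rule euclidean_eqI)
  fix b :: "(real^'k) \<times> (real^'l)" assume "b \<in> Basis"
  then show "adil j x \<bullet> b = dil \<alpha> \<beta> j x \<bullet> b"
    by (auto simp: Basis_pair adil_inner inner_axis_pair dil_def)
qed

lemma inv_dil: "inv (dil \<alpha> \<beta> j) = adil (- j)"
  by (rule inv_unique_comp) (auto simp: fun_eq_iff adil_eq[symmetric] adil_adil adil_0)

lemma prod_dil: "(\<Prod>b\<in>Basis. 2 powr (of_int j / ex b)) = dil_det \<alpha> \<beta> j"
  by (simp add: prod_Basis_pair dil_det_def)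

lemma mult_piece_eq: "mult_piece \<alpha> \<beta> \<omega> m j \<xi> = m \<xi> * of_real (\<omega> (rho (adil (- j) \<xi>)))"
  by (simp add: mult_piece_def inv_dil rho_eq)

lemma norm_kernel_eq: "norm_kernel \<alpha> \<beta> \<omega> m j x = inv_fourier (mult_piece \<alpha> \<beta> \<omega> m j) (adil (- j) x) / of_real (dil_det \<alpha> \<beta> j)"
  by (simp add: norm_kernel_def inv_dil)

end

lemma cutoff_continuous: "cutoff \<omega> \<Longrightarrow> continuous_on {0..} \<omega>"
proof -
  assume "cutoff \<omega>"
  then obtain D where D: "\<And>t. t \<ge> 0 \<Longrightarrow> D 0 t = \<omega> t"
    "\<And>n t. t \<ge> 0 \<Longrightarrow> (D n has_real_derivative D (Suc n) t) (at t within {0..})"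
    unfolding cutoff_def smooth_halfline_def by blast
  have "continuous_on {0..} (D 0)"
    using D(2)[of _ 0] by (intro DERIV_continuous_on) auto
  then show ?thesis
    by (rule continuous_on_eq) (use D(1) in auto)
qed

lemma continuous_punctured_measurable:
  fixes m :: "'a::euclidean_space \<Rightarrow> complex"
  assumes "continuous_on (- {0}) m"
  shows "m \<in> borel_measurable borel"
proof (rule measurable_discrete_difference[where X="{0}" and f="\<lambda>x. indicator (- {0}) x *\<^sub>R m x"])
  show "(\<lambda>x. indicator (- {0}) x *\<^sub>R m x) \<in> borel_measurable borel"
    using assms by (intro borel_measurable_continuous_on_indicator) auto
qed auto

text \<open>For an order below one no derivative is taken, so a bound on the seminorm is a bound for
  increments of \<open>u\<close> itself.\<close>

lemma holder_seminorm_lt_1: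
  assumes l: "0 < l" "l < 1" and H: "holder_seminorm e l u \<le> ennreal H" "0 \<le> H" and h: "h > 0"
  shows "cmod (u (x + h *\<^sub>R e) - u x) \<le> H * h powr l"
proof -
  have f: "\<lfloor>l\<rfloor> = 0" using l by (simp add: floor_eq_iff)
  have "ennreal (cmod (u (x + h *\<^sub>R e) - u x) / h powr l) \<le>
      (SUP x. SUP h\<in>{0<..}. ennreal (cmod (u (x + h *\<^sub>R e) - u x) / h powr l))"
    using h by (intro SUP_upper2[of x] SUP_upper2[of h]) auto
  also have "\<dots> = holder_seminorm e l u"
    by (simp add: holder_seminorm_def f)
  also note H(1)
  finally show ?thesis
    using H(2) h by (simp add: divide_le_eq)
qed

section \<open>The multiplier, its kernels and the bound for its dyadic pieces\<close>

locale multiplier_setting = aniso_pair \<alpha> \<beta>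
  for \<alpha> :: "'k::finite \<Rightarrow> real" and \<beta> :: "'l::finite \<Rightarrow> real" +
  fixes \<gamma> :: real and \<omega> :: "real \<Rightarrow> real" and \<mu> :: real
    and m u :: "(real^'k) \<times> (real^'l) \<Rightarrow> complex"
  assumes \<gamma>: "0 < \<gamma>" and \<alpha>\<gamma>: "\<And>k. \<alpha> k * \<gamma> < 1"
    and \<omega>: "cutoff \<omega>"
    and m_cont: "continuous_on (- {0}) m" and m_bdd: "bounded (m ` (- {0}))"
    and m_zero: "\<And>\<xi>2. \<xi>2 \<noteq> 0 \<Longrightarrow> m (0, \<xi>2) = 0"
    and \<mu>: "\<mu> > 0"
    and kernel: "\<And>j. (\<integral>\<^sup>+x. ennreal ((1 + (\<Sum>k\<in>UNIV. \<bar>fst x $ k\<bar> powr (\<alpha> k * \<gamma>)))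
                 * cmod (norm_kernel \<alpha> \<beta> \<omega> m j x)) \<partial>lborel) \<le> ennreal \<mu>"
    and u: "u \<in> holder1_space \<alpha> \<gamma>" "compact (closure {x. u x \<noteq> 0})"
begin

definition S :: real where "S = enn2real (holder1 \<alpha> \<gamma> u)"

lemma S_nonneg: "S \<ge> 0" by (simp add: S_def)

lemma holder1_u: "holder1 \<alpha> \<gamma> u = ennreal S"
  using u(1) by (simp add: S_def holder1_space_def)

lemma u_Cc: "Cc u"
  using u compact_imp_bounded[OF u(2)] bounded_subset[OF _ closure_subset]
  unfolding Cc_def holder1_space_def by auto

lemma u_holder:
  assumes "h > 0"
  shows "cmod (u (x + h *\<^sub>R (axis k 1, 0)) - u x) \<le> S * h powr (\<alpha> k * \<gamma>)"
proof (rule holder_seminorm_lt_1[OF _ \<alpha>\<gamma> _ S_nonneg assms])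
  show "0 < \<alpha> k * \<gamma>" using \<alpha>[of k] \<gamma> by simp
  have "holder_seminorm (axis k 1, 0) (\<alpha> k * \<gamma>) u \<le> holder1 \<alpha> \<gamma> u"
    unfolding holder1_def by (rule member_le_sum) auto
  then show "holder_seminorm (axis k 1, 0) (\<alpha> k * \<gamma>) u \<le> ennreal S"
    by (simp add: holder1_u)
qed

abbreviation piece :: "int \<Rightarrow> (real^'k) \<times> (real^'l) \<Rightarrow> complex" where
  "piece \<equiv> mult_piece \<alpha> \<beta> \<omega> m"

text \<open>The kernel m_j before normalisation; the hypothesis concerns its rescaling
  \<open>norm_kernel\<close> and is translated back in \<open>K_weight\<close>.\<close>

definition K :: "int \<Rightarrow> (real^'k) \<times> (real^'l) \<Rightarrow> complex" where
  "K j = inv_fourier (piece j)"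

definition weight :: "(real^'k) \<times> (real^'l) \<Rightarrow> real" where
  "weight y = (\<Sum>k\<in>UNIV. \<bar>fst y $ k\<bar> powr (\<alpha> k * \<gamma>))"

lemma weight_nonneg: "weight y \<ge> 0"
  unfolding weight_def by (intro sum_nonneg) auto

lemma weight_measurable [measurable]: "weight \<in> borel_measurable borel"
  unfolding weight_def
  using \<alpha> \<gamma>
  by (intro borel_measurable_continuous_onI continuous_on_sum continuous_on_powr' continuous_intros) (auto simp: less_imp_neq[symmetric] less_imp_le)

lemma weight_adil: "weight (adil j y) = 2 powr (of_int j * \<gamma>) * weight y"
proof -
  have "\<bar>fst (adil j y) $ k\<bar> powr (\<alpha> k * \<gamma>) = 2 powr (of_int j * \<gamma>) * \<bar>fst y $ k\<bar> powr (\<alpha> k * \<gamma>)" for k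
    using \<alpha>[of k] by (simp add: adil_eq dil_def abs_mult powr_mult powr_powr)
  then show ?thesis by (simp add: weight_def sum_distrib_left)
qed

text \<open>\<open>m\<close> may have no limit at the origin, but \<open>\<omega>\<close> vanishes
  as soon as the rescaled \<open>rho\<close> is below 1/4. Bounded support comes from
  \<open>\<omega>\<close> vanishing beyond 4.\<close>

lemma Cc_piece: "Cc (piece j)"
  unfolding Cc_def
proof
  let ?r = "\<lambda>\<xi>. rho (adil (- j) \<xi>)"
  have rc: "continuous_on UNIV ?r"
    by (rule continuous_on_compose2[OF continuous_rho continuous_adil]) simp
  have oc: "continuous_on UNIV (\<lambda>\<xi>. \<omega> (?r \<xi>))"
    by (rule continuous_on_compose2[OF cutoff_continuous[OF \<omega>] rc]) (auto simp: rho_nonneg)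
  have z: "piece j \<xi> = 0" if "?r \<xi> < 1/4" for \<xi>
    using that \<omega> rho_nonneg[of "adil (- j) \<xi>"] by (auto simp: mult_piece_eq cutoff_def)
  have "continuous_on (- {0} \<union> {\<xi>. ?r \<xi> < 1/4}) (piece j)"
  proof (rule continuous_on_open_Un)
    show "open {\<xi>. ?r \<xi> < 1/4}"
      using rc by (intro open_Collect_less continuous_intros) auto
    show "continuous_on (- {0}) (piece j)"
      unfolding mult_piece_eq[abs_def]
      using m_cont continuous_on_subset[OF oc] by (intro continuous_intros) auto
    have "continuous_on {\<xi>. ?r \<xi> < 1/4} (\<lambda>_. 0 :: complex)" by simp
    then show "continuous_on {\<xi>. ?r \<xi> < 1/4} (piece j)"
      by (rule continuous_on_eq) (simp add: z)
  qed auto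
  also have "- {0} \<union> {\<xi>. ?r \<xi> < 1/4} = UNIV" by (auto simp: rho_adil)
  finally show "continuous_on UNIV (piece j)" .
  have "rho \<xi> \<le> 4 * 2 powr j" if "piece j \<xi> \<noteq> 0" for \<xi>
  proof -
    have "?r \<xi> < 4" using that \<omega> by (force simp: mult_piece_eq cutoff_def)
    then show ?thesis by (simp add: rho_adil powr_minus divide_simps mult_ac)
  qed
  then show "bounded {\<xi>. piece j \<xi> \<noteq> 0}"
    by (intro bounded_subset[OF bounded_rho_le[of "4 * 2 powr j"]]) auto
qed

lemma piece_eq_0: "piece j (0, \<xi>2) = 0"
proof (cases "\<xi>2 = 0")
  \<comment> \<open>At the origin the hypothesis on \<open>m\<close> is silent, and the factor
    \<open>\<omega> 0 = 0\<close> takes over.\<close>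
  case True
  then have "(0, \<xi>2) = (0 :: (real^'k) \<times> (real^'l))" by (simp add: zero_prod_def)
  then show ?thesis using \<omega> by (simp add: mult_piece_eq rho_adil cutoff_def)
qed (simp add: mult_piece_eq m_zero)

text \<open>The piece is continuous of bounded support, hence has an inverse transform, so
  \<open>inv_fourier\<close> is not a vacuous choice here.\<close>

lemma K_L2: "has_L2_fourier (K j) (piece j)"
  unfolding K_def by (rule has_L2_fourier_inv_fourier[OF has_L2_fourier_inverse[OF CcD(6)[OF Cc_piece]]])

lemma K_measurable [measurable]: "K j \<in> borel_measurable borel"
  using K_L2[of j] by (auto simp: has_L2_fourier_def square_integrable_measurable)

abbreviation weighted :: "int \<Rightarrow> (real^'k) \<times> (real^'l) \<Rightarrow> ennreal" where
  "weighted j y \<equiv> ennreal ((1 + 2 powr (of_int j * \<gamma>) * weight y) * cmod (K j y))"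

text \<open>The substitution x = A_j y undoes the normalisation: the determinant cancels, and the
  weight is homogeneous of degree \<gamma>, which produces the factor
  \<open>2 powr (of_int j * \<gamma>)\<close>.\<close>

lemma K_weight: "(\<integral>\<^sup>+y. weighted j y \<partial>lborel) \<le> ennreal \<mu>"
proof -
  have d: "dil_det \<alpha> \<beta> j > 0"
    unfolding dil_det_def by (intro mult_pos_pos prod_pos) auto
  let ?f = "\<lambda>x. ennreal ((1 + weight x) * cmod (norm_kernel \<alpha> \<beta> \<omega> m j x))"
  have [measurable]: "adil i \<in> borel_measurable borel" for i
    unfolding adil_def by measurable
  have fm: "?f \<in> borel_measurable borel"
    unfolding norm_kernel_eq K_def[symmetric] by measurable
  have "(\<integral>\<^sup>+x. ?f x \<partial>lborel) = ennreal (dil_det \<alpha> \<beta> j) * (\<integral>\<^sup>+y. ?f (adil j y) \<partial>lborel)"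
    unfolding prod_dil[symmetric] adil_def by (rule nn_integral_diagmap[OF _ fm]) simp
  also have "\<dots> = (\<integral>\<^sup>+y. ennreal (dil_det \<alpha> \<beta> j) * ?f (adil j y) \<partial>lborel)"
    using fm by (intro nn_integral_cmult[symmetric]) simp
  also have "\<dots> = (\<integral>\<^sup>+y. weighted j y \<partial>lborel)"
    using d by (intro nn_integral_cong)
      (simp add: norm_kernel_eq adil_adil adil_0 K_def weight_adil norm_divide weight_nonneg flip: ennreal_mult)
  finally show ?thesis
    using kernel[of j] by (simp add: weight_def)
qed

lemma K_integrable: "integrable lborel (K j)"
proof (rule integrableI_bounded)
  have "(\<integral>\<^sup>+y. ennreal (norm (K j y)) \<partial>lborel) \<le> (\<integral>\<^sup>+y. weighted j y \<partial>lborel)"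
    by (intro nn_integral_mono ennreal_leI) (simp add: distrib_right weight_nonneg)
  also have "\<dots> < \<infinity>"
    using K_weight[of j] by (rule order.strict_trans1) simp
  finally show "(\<integral>\<^sup>+y. ennreal (norm (K j y)) \<partial>lborel) < \<infinity>" .
qed simp

lemma K_fourier: "fourier (K j) \<xi> = piece j \<xi>"
  by (rule has_L2_fourier_eq_fourier[OF K_L2 K_integrable CcD(1)[OF Cc_piece]])

text \<open>The two arguments differ only in the first group of coordinates, so the seminorms
  assumed finite suffice.\<close>

lemma u_increment: "cmod (u (x - y) - u (fst x, snd x - snd y)) \<le> S * weight y"
proof -
  let ?x = "(fst x, snd x - snd y)"
  have "cmod (u (?x + (\<Sum>k\<in>UNIV. (- fst y $ k) *\<^sub>R (axis k 1, 0))) - u ?x)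
      \<le> S * (\<Sum>k\<in>UNIV. \<bar>- fst y $ k\<bar> powr (\<alpha> k * \<gamma>))"
    by (rule holder_path, rule finite, rule u_holder)
  also have "?x + (\<Sum>k\<in>UNIV. (- fst y $ k) *\<^sub>R (axis k 1, 0)) = x - y"
  proof -
    have "(\<Sum>k\<in>UNIV. (- fst y $ k) *\<^sub>R (axis k 1, 0)) = (- fst y, 0 :: real^'l)"
      by (auto simp: prod_eq_iff fst_sum snd_sum vec_eq_iff axis_def if_distrib sum.delta sum_negf cong: if_cong)
    then show ?thesis by (simp add: prod_eq_iff)
  qed
  finally show ?thesis by (simp add: weight_def)
qed

lemma conv_K_bound: "cmod (conv (K j) u x) \<le> 2 powr (- (of_int j * \<gamma>)) * (\<mu> * S)"
proof -
  \<comment> \<open>For fixed \<open>x\<close> the slice \<open>U\<close> inherits continuity and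
    bounded support from \<open>u\<close>, as the cancellation lemma requires.\<close>
  define U where "U z = u (fst x, snd x - z)" for z
  have U: "Cc U"
    unfolding Cc_def
  proof
    show "continuous_on UNIV U"
      unfolding U_def by (rule continuous_on_compose2[OF CcD(1)[OF u_Cc]]) (auto intro!: continuous_intros)
    obtain R where R: "\<And>z. u z \<noteq> 0 \<Longrightarrow> norm z \<le> R"
      using CcD(2)[OF u_Cc] unfolding bounded_iff by auto
    have "norm z \<le> norm (snd x) + R" if "U z \<noteq> 0" for z
    proof -
      have "norm (snd x - z) \<le> R"
        using R[of "(fst x, snd x - z)"] that norm_snd_le[of "snd x - z" "fst x"] by (auto simp: U_def)
      then show ?thesis using norm_triangle_sub[of z "snd x"] by (simp add: norm_minus_commute)
    qed
    then show "bounded {z. U z \<noteq> 0}" unfolding bounded_iff by auto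
  qed
  have snd [measurable]: "snd \<in> borel_measurable (borel :: ((real^'k) \<times> (real^'l)) measure)"
    by (intro borel_measurable_continuous_onI continuous_intros)
  obtain B where B: "\<And>x. cmod (u x) \<le> B"
    using bounded_range_obtain[OF CcD(3)[OF u_Cc]] by blast
  note [measurable] = CcD(5)[OF u_Cc] CcD(5)[OF U]
  have i1: "integrable lborel (\<lambda>y. K j y * u (x - y))"
    by (rule conv_bounded(1)[OF K_integrable B]) measurable
  have i2: "integrable lborel (\<lambda>y. K j y * U (snd y))"
    by (rule integrable_bounded_times(2)[OF _ _ K_integrable, of _ B]) (use B in \<open>auto simp: U_def[symmetric] intro: B[unfolded U_def]\<close>, simp add: U_def B)
  have "(LINT y|lborel. K j y * U (snd y)) = 0"
    by (rule integral_snd_eq_0[OF K_integrable _ CcD(6)[OF U]]) (simp add: K_fourier piece_eq_0)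
  then have "conv (K j) u x = (LINT y|lborel. K j y * u (x - y) - K j y * U (snd y))"
    using i1 i2 by (simp add: conv_def)
  then have "ennreal (cmod (conv (K j) u x)) \<le> (\<integral>\<^sup>+y. ennreal (cmod (K j y * u (x - y) - K j y * U (snd y))) \<partial>lborel)"
    using integral_norm_bound_ennreal[OF Bochner_Integration.integrable_diff[OF i1 i2]] by simp
  also have "\<dots> \<le> (\<integral>\<^sup>+y. ennreal (2 powr (- (of_int j * \<gamma>)) * S) *
      weighted j y \<partial>lborel)"
  proof (intro nn_integral_mono)
    fix y
    have "cmod (K j y * u (x - y) - K j y * U (snd y)) = cmod (K j y) * cmod (u (x - y) - u (fst x, snd x - snd y))"
      by (simp add: U_def norm_mult flip: right_diff_distrib)
    also have "\<dots> \<le> cmod (K j y) * (S * weight y)"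
      by (intro mult_left_mono u_increment) simp
    \<comment> \<open>The weight is completed to the one in \<open>K_weight\<close>; its factor
      \<open>2 powr (of_int j * \<gamma>)\<close> is paid for by the inverse power, which is the
      decay in \<open>j\<close>.\<close>
    also have "\<dots> = 2 powr (- (of_int j * \<gamma>)) * S * (2 powr (of_int j * \<gamma>) * weight y * cmod (K j y))"
      by (simp add: powr_minus)
    also have "\<dots> \<le> 2 powr (- (of_int j * \<gamma>)) * S * ((1 + 2 powr (of_int j * \<gamma>) * weight y) * cmod (K j y))"
      using S_nonneg by (intro mult_left_mono mult_right_mono) auto
    finally show "ennreal (cmod (K j y * u (x - y) - K j y * U (snd y))) \<le> ennreal (2 powr (- (of_int j * \<gamma>)) * S) *
      weighted j y"
      using S_nonneg weight_nonneg[of y] by (simp flip: ennreal_mult)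
  qed
  also have "\<dots> = ennreal (2 powr (- (of_int j * \<gamma>)) * S) *
      (\<integral>\<^sup>+y. weighted j y \<partial>lborel)"
    by (rule nn_integral_cmult) measurable
  also have "\<dots> \<le> ennreal (2 powr (- (of_int j * \<gamma>)) * S) * ennreal \<mu>"
    by (intro mult_left_mono K_weight) simp
  also have "\<dots> = ennreal (2 powr (- (of_int j * \<gamma>)) * (\<mu> * S))"
    using S_nonneg \<mu> by (simp add: mult_ac flip: ennreal_mult)
  finally show ?thesis
    using S_nonneg \<mu> by simp
qed

definition c :: complex where "c = of_real ((2 * pi) ^ DIM((real^'k) \<times> (real^'l)))"

lemma c_neq_0: "c \<noteq> 0" by (simp add: c_def)

text \<open>Divided by the inversion constant, so that \<open>fourier g (- x)\<close> is formally
  the inverse transform of \<open>m \<xi> * fourier u \<xi>\<close>.\<close>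

definition g :: "(real^'k) \<times> (real^'l) \<Rightarrow> complex" where
  "g \<xi> = m \<xi> * fourier u \<xi> / c"

lemma piece_times_fourier: "of_real (\<omega> (rho (adil (- j) \<xi>))) * g \<xi> = (1 / c) * fourier (conv (K j) u) \<xi>"
  by (simp add: fourier_conv[OF K_integrable CcD(4)[OF u_Cc]] K_fourier mult_piece_eq g_def)

lemma integrable_fourier_conv_K: "integrable lborel (fourier (conv (K j) u))"
  unfolding fourier_conv[OF K_integrable CcD(4)[OF u_Cc]] K_fourier
  by (rule integrable_bounded_times(2)[OF cmod_fourier_le borel_measurable_fourier[OF CcD(4)[OF u_Cc]] CcD(4)[OF Cc_piece]])

text \<open>The cut-off piece is, up to the constant, the transform of \<open>conv (K j) u\<close>,
  and inversion returns the convolution at the reflected point. This supplies the bound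
  \<open>M\<close> of the summation argument.\<close>

lemma fourier_piece_bound:
  "cmod (fourier (\<lambda>\<xi>. of_real (\<omega> (rho (adil (- j) \<xi>))) * g \<xi>) x) \<le> 2 powr (- (of_int j * \<gamma>)) * (\<mu> * S)"
proof -
  have "fourier (fourier (conv (K j) u)) (- (- x)) = c * conv (K j) u (- x)"
    unfolding c_def
    by (rule fourier_inversion[OF bcL1_conv[OF K_integrable CcD(6)[OF u_Cc]] integrable_fourier_conv_K])
  then have "fourier (\<lambda>\<xi>. of_real (\<omega> (rho (adil (- j) \<xi>))) * g \<xi>) x = conv (K j) u (- x)"
    unfolding piece_times_fourier fourier_cmult using c_neq_0 by simp
  then show ?thesis by (simp add: conv_K_bound)
qed

lemma m_bound: obtains B where "\<And>\<xi>. cmod (m \<xi>) \<le> B"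
proof -
  obtain B where B: "\<And>\<xi>. \<xi> \<noteq> 0 \<Longrightarrow> cmod (m \<xi>) \<le> B"
    using m_bdd unfolding bounded_iff by auto
  show thesis
    by (rule that[of "max B (cmod (m 0))"]) (use B in \<open>metis le_max_iff_disj order_refl\<close>)
qed

lemma g_measurable: "g \<in> borel_measurable borel"
proof -
  note [measurable] = continuous_punctured_measurable[OF m_cont] borel_measurable_fourier[OF CcD(4)[OF u_Cc]]
  show ?thesis unfolding g_def by measurable
qed

lemma g_bound: obtains G where "\<And>\<xi>. cmod (g \<xi>) \<le> G"
proof -
  obtain B where B: "\<And>\<xi>. cmod (m \<xi>) \<le> B" by (rule m_bound) blast
  show thesis
  proof (rule that)
    fix \<xi>
    have "cmod (m \<xi>) * cmod (fourier u \<xi>) \<le> B * (LINT x|lborel. cmod (u x))"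
      using B cmod_fourier_le order_trans[OF norm_ge_zero B] by (intro mult_mono) auto
    then show "cmod (g \<xi>) \<le> B * (LINT x|lborel. cmod (u x)) / cmod c"
      unfolding g_def norm_divide norm_mult by (rule divide_right_mono) simp
  qed
qed

lemma g_square_integrable: "square_integrable g"
proof -
  obtain B where B: "\<And>\<xi>. cmod (m \<xi>) \<le> B" by (rule m_bound) blast
  have "integrable lborel (\<lambda>\<xi>. (B / cmod c)\<^sup>2 * (cmod (fourier u \<xi>))\<^sup>2)"
    using plancherel(1)[OF CcD(6)[OF u_Cc]] by simp
  then have "integrable lborel (\<lambda>\<xi>. (cmod (g \<xi>))\<^sup>2)"
  proof (rule integrable_dominated)
    show "AE \<xi> in lborel. norm ((cmod (g \<xi>))\<^sup>2) \<le> norm ((B / cmod c)\<^sup>2 * (cmod (fourier u \<xi>))\<^sup>2)"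
    proof (rule AE_I2)
      fix \<xi>
      have "cmod (g \<xi>) = cmod (m \<xi>) / cmod c * cmod (fourier u \<xi>)"
        by (simp add: g_def norm_mult norm_divide)
      also have "\<dots> \<le> B / cmod c * cmod (fourier u \<xi>)"
        using B by (intro mult_right_mono divide_right_mono) auto
      finally have "(cmod (g \<xi>))\<^sup>2 \<le> (B / cmod c * cmod (fourier u \<xi>))\<^sup>2"
        by (rule power_mono) simp
      then have "(cmod (g \<xi>))\<^sup>2 \<le> (B / cmod c)\<^sup>2 * (cmod (fourier u \<xi>))\<^sup>2"
        by (simp only: power_mult_distrib)
      then show "norm ((cmod (g \<xi>))\<^sup>2) \<le> norm ((B / cmod c)\<^sup>2 * (cmod (fourier u \<xi>))\<^sup>2)"
        by simp
    qed
  qed (use g_measurable in measurable)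
  then show ?thesis
    using g_measurable by (simp add: square_integrable_def)
qed

text \<open>\<open>\<eta>\<close> and \<open>W\<close> are parameters rather than chosen here, so
  that the resulting constants do not depend on \<open>m\<close>, \<open>u\<close> and
  \<open>\<mu>\<close>.\<close>

lemma holder_estimate:
  assumes \<eta>: "Cc \<eta>" "\<And>\<xi>. rho \<xi> \<le> 1/2 \<Longrightarrow> \<eta> \<xi> = 1" "\<And>\<xi>. rho \<xi> \<ge> 1 \<Longrightarrow> \<eta> \<xi> = 0"
    and W: "\<And>b s. b \<in> Basis \<Longrightarrow> wiener (band \<eta> b s) (W b s)"
    and ni: "\<And>b. b \<in> Basis \<Longrightarrow> ex b * \<gamma> \<notin> \<int>"
  obtains v where "has_L2_fourier v (\<lambda>\<xi>. m \<xi> * fourier u \<xi>)" "continuous_on UNIV v"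
    "\<And>b. b \<in> Basis \<Longrightarrow> 0 \<le> holder_const ex W \<gamma> b"
    "\<And>b. b \<in> Basis \<Longrightarrow> holder_seminorm b (ex b * \<gamma>) v \<le> ennreal (holder_const ex W \<gamma> b * (\<mu> * S))"
proof -
  obtain G where G: "\<And>\<xi>. cmod (g \<xi>) \<le> G" by (rule g_bound) blast
  interpret littlewood_paley_L2 ex \<eta> g \<omega> W G "\<mu> * S" \<gamma>
  proof
    show "\<omega> t = 1" if "1/2 \<le> t" "t \<le> 2" for t
      using \<omega> that by (simp add: cutoff_def)
    show "integrable lborel (\<lambda>\<xi>. complex_of_real (\<omega> (rho (adil (- j) \<xi>))) * g \<xi>)" for j
      unfolding piece_times_fourier by (intro integrable_mult_right integrable_fourier_conv_K)
    show "continuous_on (- {0}) g"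
      unfolding g_def
      using m_cont continuous_on_subset[OF continuous_fourier[OF CcD(4)[OF u_Cc]]] c_neq_0
      by (intro continuous_intros) auto
  qed (use \<eta> W \<gamma> G g_measurable fourier_piece_bound g_square_integrable in auto)
  \<comment> \<open>Any unit vector does: it merely names the direction index of the
    undifferentiated sum.\<close>
  define b0 :: "(real^'k) \<times> (real^'l)" where "b0 = (axis undefined 1, 0)"
  have b0: "b0 \<in> Basis" by (simp add: b0_def)
  show thesis
  proof (rule that[of "V b0 0"])
    have "(\<lambda>\<xi>. (2 * pi) ^ DIM((real^'k) \<times> (real^'l)) * g \<xi>) = (\<lambda>\<xi>. m \<xi> * fourier u \<xi>)"
      using c_neq_0 by (simp add: g_def c_def fun_eq_iff)
    then show "has_L2_fourier (V b0 0) (\<lambda>\<xi>. m \<xi> * fourier u \<xi>)"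
      using V0_has_L2_fourier[OF b0] by simp
    show "continuous_on UNIV (V b0 0)"
      using continuous_V[OF b0, of 0] a_pos[OF b0] \<gamma> by simp
    fix b :: "(real^'k) \<times> (real^'l)" assume b: "b \<in> Basis"
    show "0 \<le> holder_const ex W \<gamma> b"
      by (rule holder_const_nonneg[OF b ni[OF b]])
    show "holder_seminorm b (ex b * \<gamma>) (V b0 0) \<le> ennreal (holder_const ex W \<gamma> b * (\<mu> * S))"
      unfolding V0_eq[of b0 b] by (rule holder_seminorm_V[OF b ni[OF b]])
  qed
qed

end

section \<open>Choice of the constant and conclusion\<close>

theorem theorem6:
  fixes \<alpha> :: "'k::finite \<Rightarrow> real" and \<beta> :: "'l::finite \<Rightarrow> real"
    and \<gamma> :: real and \<omega> :: "real \<Rightarrow> real"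
  assumes "\<And>k. 0 < \<alpha> k \<and> \<alpha> k \<le> 1"
    and "\<And>k. 0 < \<beta> k"
    and "0 < \<gamma>" "\<gamma> < 1"
    and "\<And>k. \<beta> k * \<gamma> \<notin> \<int>"
    and "cutoff \<omega>"
  shows "\<exists>C>0. \<forall>(m :: (real^'k) \<times> (real^'l) \<Rightarrow> complex) (\<mu>::real) (u :: (real^'k) \<times> (real^'l) \<Rightarrow> complex).
    continuous_on (- {0}) m \<and> bounded (m ` (- {0})) \<and>
    (\<forall>\<xi>2. \<xi>2 \<noteq> 0 \<longrightarrow> m (0, \<xi>2) = 0) \<and>
    \<mu> > 0 \<and>
    (\<forall>j::int. (\<integral>\<^sup>+x. ennreal ((1 + (\<Sum>k\<in>UNIV. \<bar>fst x $ k\<bar> powr (\<alpha> k * \<gamma>)))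
                 * cmod (norm_kernel \<alpha> \<beta> \<omega> m j x)) \<partial>lborel) \<le> ennreal \<mu>) \<and>
    u \<in> holder1_space \<alpha> \<gamma> \<and> compact (closure {x. u x \<noteq> 0})
    \<longrightarrow> (\<exists>v. has_L2_fourier v (\<lambda>\<xi>. m \<xi> * fourier u \<xi>) \<and>
          (AE x in lborel. v x = inv_fourier (\<lambda>\<xi>. m \<xi> * fourier u \<xi>) x) \<and>
          continuous_on UNIV v \<and>
          holder12 \<alpha> \<beta> \<gamma> v < \<infinity> \<and>
          holder12 \<alpha> \<beta> \<gamma> v \<le> ennreal (C * \<mu>) * holder1 \<alpha> \<gamma> u)"
proof -
  interpret aniso_pair \<alpha> \<beta>
    by standard (use assms in auto)
  have \<alpha>\<gamma>: "0 < \<alpha> k * \<gamma>" "\<alpha> k * \<gamma> < 1" for k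
    using assms(1)[of k] assms(3,4) by (auto intro: le_less_trans[OF mult_left_le_one_le])
  have ni: "ex b * \<gamma> \<notin> \<int>" if b: "b \<in> Basis" for b
  proof -
    have "\<alpha> k * \<gamma> \<notin> \<int>" for k
      using \<alpha>\<gamma>[of k] by (auto elim!: Ints_cases)
    then show ?thesis using b assms(5) by (auto simp: Basis_pair)
  qed
  obtain \<eta> :: "(real^'k) \<times> (real^'l) \<Rightarrow> complex" where
    \<eta>: "Cc \<eta>" "\<And>\<xi>. rho \<xi> \<le> 1/2 \<Longrightarrow> \<eta> \<xi> = 1" "\<And>\<xi>. rho \<xi> \<ge> 1 \<Longrightarrow> \<eta> \<xi> = 0"
    and ex_W: "\<And>b s. b \<in> Basis \<Longrightarrow> \<exists>C. wiener (band \<eta> b s) C"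
    by (rule exists_band_pass) blast
  \<comment> \<open>The norms that make up the constant are fixed here, before \<open>m\<close>,
    \<open>\<mu>\<close> and \<open>u\<close> are introduced.\<close>
  define W where "W b s = (SOME C. wiener (band \<eta> b s) C)" for b s
  have W: "wiener (band \<eta> b s) (W b s)" if "b \<in> Basis" for b s
    unfolding W_def by (rule someI_ex[OF ex_W[OF that]])
  \<comment> \<open>The summand 1 secures \<open>C > 0\<close> whatever the size of the Hoelder
    constants.\<close>
  define C where "C = 1 + (\<Sum>b\<in>Basis. \<bar>holder_const ex W \<gamma> b\<bar>)"
  have "C > 0" unfolding C_def by (intro add_pos_nonneg sum_nonneg) auto
  show ?thesis
  proof (intro exI[of _ C] conjI allI impI \<open>C > 0\<close>; (elim conjE)?)
    fix m :: "(real^'k) \<times> (real^'l) \<Rightarrow> complex" and \<mu> :: real and u :: "(real^'k) \<times> (real^'l) \<Rightarrow> complex"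
    assume h: "continuous_on (- {0}) m" "bounded (m ` (- {0}))" "\<forall>\<xi>2. \<xi>2 \<noteq> 0 \<longrightarrow> m (0, \<xi>2) = 0" "0 < \<mu>"
      "\<forall>j::int. (\<integral>\<^sup>+x. ennreal ((1 + (\<Sum>k\<in>UNIV. \<bar>fst x $ k\<bar> powr (\<alpha> k * \<gamma>)))
                 * cmod (norm_kernel \<alpha> \<beta> \<omega> m j x)) \<partial>lborel) \<le> ennreal \<mu>"
      "u \<in> holder1_space \<alpha> \<gamma>" "compact (closure {x. u x \<noteq> 0})"
    interpret multiplier_setting \<alpha> \<beta> \<gamma> \<omega> \<mu> m u
      by standard (use h assms \<alpha>\<gamma> in auto)
    obtain v where v: "has_L2_fourier v (\<lambda>\<xi>. m \<xi> * fourier u \<xi>)" "continuous_on UNIV v"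
      "\<And>b. b \<in> Basis \<Longrightarrow> 0 \<le> holder_const ex W \<gamma> b"
      "\<And>b. b \<in> Basis \<Longrightarrow> holder_seminorm b (ex b * \<gamma>) v \<le> ennreal (holder_const ex W \<gamma> b * (\<mu> * S))"
      by (rule holder_estimate[OF \<eta> W ni]) blast+
    have "holder12 \<alpha> \<beta> \<gamma> v = (\<Sum>b\<in>Basis. holder_seminorm b (ex b * \<gamma>) v)"
      by (simp add: holder12_def sum_Basis_pair)
    also have "\<dots> \<le> (\<Sum>b\<in>Basis. ennreal (holder_const ex W \<gamma> b * (\<mu> * S)))"
      by (intro sum_mono v(4))
    also have "\<dots> = ennreal (\<Sum>b\<in>Basis. holder_const ex W \<gamma> b * (\<mu> * S))"
      using v(3) h(4) S_nonneg by (intro sum_ennreal) auto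
    also have "\<dots> \<le> ennreal (C * (\<mu> * S))"
      unfolding sum_distrib_right[symmetric] C_def using v(3) h(4) S_nonneg
      by (intro ennreal_leI mult_right_mono) auto
    finally have le: "holder12 \<alpha> \<beta> \<gamma> v \<le> ennreal (C * (\<mu> * S))" .
    show "\<exists>v. has_L2_fourier v (\<lambda>\<xi>. m \<xi> * fourier u \<xi>) \<and>
          (AE x in lborel. v x = inv_fourier (\<lambda>\<xi>. m \<xi> * fourier u \<xi>) x) \<and>
          continuous_on UNIV v \<and>
          holder12 \<alpha> \<beta> \<gamma> v < \<infinity> \<and>
          holder12 \<alpha> \<beta> \<gamma> v \<le> ennreal (C * \<mu>) * holder1 \<alpha> \<gamma> u"
    proof (intro exI[of _ v] conjI v(1,2))
      \<comment> \<open>The continuous sum and the representative selected by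
        \<open>inv_fourier\<close> have the same transform and so agree almost everywhere.\<close>
      show "AE x in lborel. v x = inv_fourier (\<lambda>\<xi>. m \<xi> * fourier u \<xi>) x"
        by (rule has_L2_fourier_unique[OF v(1) has_L2_fourier_inv_fourier[OF v(1)]])
      show "holder12 \<alpha> \<beta> \<gamma> v < \<infinity>"
        using le by (rule order.strict_trans1) simp
      show "holder12 \<alpha> \<beta> \<gamma> v \<le> ennreal (C * \<mu>) * holder1 \<alpha> \<gamma> u"
        using le \<open>C > 0\<close> h(4) S_nonneg by (simp add: holder1_u mult.assoc flip: ennreal_mult)
    qed
  qed
qed

end
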